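(* Let $V_D$ be a bounded, nonnegative, nonincreasing potential on the half line $[0,\infty)$ such that, for some $\delta_V>0$, $$V_D'(r)\le-\delta_V(1+r)^{-1}V_D(r)\le 0\quad\text{for all } r\ge 0$$ (in the sense of measures if $V_D$ is not everywhere differentiable). For all $s,s_1,s_2>1/2$ with $s_1+s_2>2$ there is $C>0$ such that for all $\zeta\in\mathbb C\setminus[0,\infty)$ and all $h>0$ we have $$\|(1+r)^{-s}(-h^2\partial_r^2+V_D(r)-\zeta)^{-1}(1+r)^{-s}\|\le\frac{C}{h\sqrt{|\zeta|}},$$ $$\|(1+r)^{-s_1}(-h^2\partial_r^2+V_D(r)-\zeta)^{-1}(1+r)^{-s_2}\|\le\frac{C}{h^2},$$ and $$\|V_D(r)^{1/2}(1+r)^{-1/2}(-h^2\partial_r^2+V_D(r)-\zeta)^{-1}(1+r)^{-s}\|\le\frac{C}{h},$$ where the norms are $L^2(\mathbb R_+)\to L^2(\mathbb R_+)$.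
   Context: $\mathbb R_+=(0,\infty)$. $(-h^2\partial_r^2+V_D-\zeta)^{-1}$ denotes the Dirichlet resolvent, i.e. the resolvent of the self-adjoint operator $-h^2\partial_r^2+V_D$ on $L^2(\mathbb R_+)$ with domain $\{u\in H^2(\mathbb R_+)\mid u(0)=0\}$. *)

theory Defs
  imports "HOL-Analysis.Analysis"
begin

text \<open>Elements of \<open>L\<^sup>2(\<real>\<^sub>+)\<close> are represented by square integrable functions; two functions
  stand for the same element iff they agree almost everywhere on \<open>(0, \<infinity>)\<close>.  Values outside
  \<open>(0, \<infinity>)\<close> are irrelevant.\<close>

abbreviation half_line :: "real measure" where
  "half_line \<equiv> lebesgue_on {0<..}"

definition L2 :: "(real \<Rightarrow> complex) set" where
  "L2 = {f. f \<in> borel_measurable half_line \<and> integrable half_line (\<lambda>r. (cmod (f r))\<^sup>2)}"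

definition L2_norm :: "(real \<Rightarrow> complex) \<Rightarrow> real" where
  "L2_norm f = sqrt (LINT r|half_line. (cmod (f r))\<^sup>2)"

text \<open>Operator norm on \<open>L\<^sup>2(\<real>\<^sub>+)\<close>; it equals \<open>\<infinity>\<close> (the infimum of the empty set) if \<open>T\<close> does
  not map \<open>L\<^sup>2\<close> boundedly into \<open>L\<^sup>2\<close>.\<close>

definition L2_opnorm :: "((real \<Rightarrow> complex) \<Rightarrow> (real \<Rightarrow> complex)) \<Rightarrow> ennreal" where
  "L2_opnorm T = Inf {ennreal K | K. 0 \<le> K \<and> (\<forall>f\<in>L2. T f \<in> L2 \<and> L2_norm (T f) \<le> K * L2_norm f)}"

definition mult_op :: "(real \<Rightarrow> real) \<Rightarrow> (real \<Rightarrow> complex) \<Rightarrow> (real \<Rightarrow> complex)" where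
  "mult_op m f = (\<lambda>r. complex_of_real (m r) * f r)"

text \<open>\<open>C\<^sub>c\<^sup>\<infinity>((0, \<infinity>))\<close>\<close>

definition test_functions :: "(real \<Rightarrow> real) set" where
  "test_functions = {\<phi>. (\<forall>n x. ((deriv ^^ n) \<phi>) differentiable (at x)) \<and>
     compact (closure {x. \<phi> x \<noteq> 0}) \<and> closure {x. \<phi> x \<noteq> 0} \<subseteq> {0<..}}"

text \<open>Used only for \<open>u, v \<in> L\<^sup>2\<close>, so both integrals converge.\<close>

definition has_weak_deriv :: "(real \<Rightarrow> complex) \<Rightarrow> (real \<Rightarrow> complex) \<Rightarrow> bool" where
  "has_weak_deriv u v \<longleftrightarrow> (\<forall>\<phi>\<in>test_functions.
     (LINT r|half_line. deriv \<phi> r *\<^sub>R u r) = - (LINT r|half_line. \<phi> r *\<^sub>R v r))"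

definition H2 :: "(real \<Rightarrow> complex) set" where
  "H2 = {u \<in> L2. \<exists>v\<in>L2. has_weak_deriv u v \<and> (\<exists>w\<in>L2. has_weak_deriv v w)}"

text \<open>Weak derivatives are unique up to null sets, so the choice is immaterial in \<open>L\<^sup>2\<close>.\<close>

definition weak_deriv :: "(real \<Rightarrow> complex) \<Rightarrow> (real \<Rightarrow> complex)" where
  "weak_deriv u = (SOME v. v \<in> L2 \<and> has_weak_deriv u v)"

text \<open>The boundary condition \<open>u(0) = 0\<close> refers to the representative of \<open>u\<close> that is continuous
  up to the boundary.\<close>

definition dirichlet_domain :: "(real \<Rightarrow> complex) set" where
  "dirichlet_domain = {u \<in> H2. \<exists>U. continuous_on {0..} U \<and>
     (AE r in half_line. U r = u r) \<and> U 0 = 0}"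

text \<open>The action of \<open>-h\<^sup>2 \<partial>\<^sub>r\<^sup>2 + V\<close>.\<close>

definition schroedinger :: "(real \<Rightarrow> real) \<Rightarrow> real \<Rightarrow> (real \<Rightarrow> complex) \<Rightarrow> (real \<Rightarrow> complex)" where
  "schroedinger V h u = (\<lambda>r. - complex_of_real (h\<^sup>2) * weak_deriv (weak_deriv u) r
     + complex_of_real (V r) * u r)"

text \<open>Resolvent set and resolvent of an operator \<open>A\<close> in \<open>L\<^sup>2(\<real>\<^sub>+)\<close> with domain \<open>D\<close>.  The lower
  bound gives injectivity of \<open>A - \<zeta>\<close> on \<open>L\<^sup>2\<close> classes and boundedness of the inverse; for \<open>\<zeta>\<close> in
  the resolvent set the resolvent is therefore determined up to null sets.\<close>

definition L2_resolvent_set ::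
    "(real \<Rightarrow> complex) set \<Rightarrow> ((real \<Rightarrow> complex) \<Rightarrow> (real \<Rightarrow> complex)) \<Rightarrow> complex set" where
  "L2_resolvent_set D A = {\<zeta>.
     (\<forall>f\<in>L2. \<exists>u\<in>D. AE r in half_line. A u r - \<zeta> * u r = f r) \<and>
     (\<exists>K. \<forall>u\<in>D. L2_norm u \<le> K * L2_norm (\<lambda>r. A u r - \<zeta> * u r))}"

definition L2_resolvent ::
    "(real \<Rightarrow> complex) set \<Rightarrow> ((real \<Rightarrow> complex) \<Rightarrow> (real \<Rightarrow> complex)) \<Rightarrow> complex
      \<Rightarrow> (real \<Rightarrow> complex) \<Rightarrow> (real \<Rightarrow> complex)" where
  "L2_resolvent D A \<zeta> f = (SOME u. u \<in> D \<and> (AE r in half_line. A u r - \<zeta> * u r = f r))"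

abbreviation dirichlet_resolvent_set :: "(real \<Rightarrow> real) \<Rightarrow> real \<Rightarrow> complex set" where
  "dirichlet_resolvent_set V h \<equiv> L2_resolvent_set dirichlet_domain (schroedinger V h)"

abbreviation dirichlet_resolvent ::
    "(real \<Rightarrow> real) \<Rightarrow> real \<Rightarrow> complex \<Rightarrow> (real \<Rightarrow> complex) \<Rightarrow> (real \<Rightarrow> complex)" where
  "dirichlet_resolvent V h \<equiv> L2_resolvent dirichlet_domain (schroedinger V h)"

text \<open>For \<open>V\<close> nonincreasing on \<open>[0, \<infinity>)\<close>, the nonnegative measure \<open>-V'\<close>: the Lebesgue--Stieltjes
  measure of minus the right-continuous version of \<open>V\<close> (the library construction needs a
  nondecreasing, right-continuous function on the whole line, whence the constant extension to
  \<open>r < 0\<close>).\<close>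

definition minus_deriv_measure :: "(real \<Rightarrow> real) \<Rightarrow> real measure" where
  "minus_deriv_measure V = interval_measure (\<lambda>r. - Lim (at_right (max 0 r)) V)"

text \<open>\<open>V' \<le> - \<delta> (1 + r)\<^sup>-\<^sup>1 V\<close> on \<open>[0, \<infinity>)\<close> as an inequality of measures, i.e.
  \<open>\<delta> (1 + r)\<^sup>-\<^sup>1 V dr \<le> -V'\<close> on every Borel set.\<close>

definition deriv_le_measure_sense :: "(real \<Rightarrow> real) \<Rightarrow> real \<Rightarrow> bool" where
  "deriv_le_measure_sense V \<delta> \<longleftrightarrow> (\<forall>A\<in>sets borel. A \<subseteq> {0..} \<longrightarrow>
     (\<integral>\<^sup>+r\<in>A. ennreal (\<delta> / (1 + r) * V r) \<partial>lborel) \<le> emeasure (minus_deriv_measure V) A)"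

end

theory Submission
  imports Defs
begin

text \<open>Dividing by \<open>h\<^sup>2\<close> replaces \<open>V\<close>, \<open>\<zeta>\<close> by \<open>V / h\<^sup>2\<close>, \<open>\<zeta> / h\<^sup>2\<close> and preserves the hypothesis on
  \<open>V'\<close> with the same \<open>\<delta>\<close>, so it suffices to bound solutions of \<open>- u'' + V u - z u = f\<close>,
  \<open>u(0) = 0\<close>, with constants that depend only on \<open>\<delta>\<close> and the weights.
  For \<open>m = M - (1 + r) powr (1 - 2 s)\<close> one integrates the derivative of \<open>m (|u'|\<^sup>2 + (|z| - V) |u|\<^sup>2)\<close>:
  since \<open>- V' \<ge> \<delta> (1 + r)\<^sup>-\<^sup>1 V\<close>, this controls \<open>(1 + r) powr (- s)\<close> times \<open>u'\<close> and \<open>|z|\<^sup>1\<^sup>/\<^sup>2 u\<close> as well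
  as \<open>V (1 + r)\<^sup>-\<^sup>1 |u|\<^sup>2\<close>; the error \<open>||z| - z| \<integral> |u u'|\<close> is absorbed by the numerical range.
  This gives the first and the third estimate.  Hardy's inequality turns the bound on \<open>u'\<close> into the
  second estimate for \<open>s1 > 3/2\<close>, \<open>s2 > 1/2\<close>; the symmetry of the resolvent exchanges the two
  weights, and a dyadic decomposition of \<open>f\<close> interpolates between the two cases.\<close>

section \<open>Square integrable functions on the half line\<close>

text \<open>The obstacle is that \<open>V\<close> is only monotone: V' is a measure, so an energy
  that contains V is not absolutely continuous. The measure inequality is therefore first turned
  into the monotonicity of (1 + r)^\<delta> V, and the second mean value theorem for this monotone
  factor replaces integration against V'. The absorption works because \<kappa> = |Im z| + |z| - Re
  z bounds ||z| - z| and is comparable to the distance of z from [0, \<infinity>): with J the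
  integral of |f u|, pairing the equation with the conjugate of u bounds \<kappa> ||u||^2 by 4 J and
  \<kappa> ||u'||^2 by 4 |z| J, so the error costs only sqrt |z| J, uniformly up to [0,
  \<infinity>). Boundary terms at infinity vanish because u, u' and u'' are square integrable. The
  two Hardy cases have weight exponents (a + 1, a) and (a, a + 1) with a > 1/2, of total 2 a + 1.
  Excess \<eta> over this total gains a factor 2^(-\<eta>) from each dyadic shell to the next, and a
  close to 1/2 reaches every total above 2.\<close>

lemma sigma_finite_lebesgue: "sigma_finite_measure (lebesgue :: real measure)"
proof -
  obtain A :: "real set set" where A: "countable A" "A \<subseteq> sets lborel" "\<Union>A = UNIV" "\<forall>a\<in>A. emeasure lborel a \<noteq> \<infinity>"
    using lborel.sigma_finite_countable by auto
  thus ?thesis by unfold_locales (intro exI[of _ A], auto)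
qed

lemma sigma_finite_half_line: "sigma_finite_measure half_line"
  using sigma_finite_lebesgue by (rule sigma_finite_measure_restrict_space) simp

interpretation half_line: sigma_finite_measure half_line
  by (rule sigma_finite_half_line)

interpretation half_line_pair: pair_sigma_finite half_line half_line ..

lemma AE_half_line_iff: "(AE r in half_line. P r) \<longleftrightarrow> (AE r in lebesgue. 0 < r \<longrightarrow> P r)"
  by (subst AE_restrict_space_iff) auto

lemma AE_half_line_pos: "AE r in half_line. 0 < r"
  by (simp add: AE_half_line_iff)

lemma borel_measurable_half_lineI:
  "f \<in> borel_measurable borel \<Longrightarrow> f \<in> borel_measurable half_line"
  by (intro measurable_restrict_space1 measurable_completion) simp

lemma AE_half_line_neq: "AE r in half_line. r \<noteq> a"
proof -
  have "AE r in lebesgue. r \<noteq> a" by (rule AE_completion) (rule AE_lborel_singleton)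
  thus ?thesis by (auto simp: AE_half_line_iff elim: eventually_mono)
qed

lemma L2_measurable: "f \<in> L2 \<Longrightarrow> f \<in> borel_measurable half_line"
  by (simp add: L2_def)

lemma L2_integrable_sq: "f \<in> L2 \<Longrightarrow> integrable half_line (\<lambda>r. (cmod (f r))\<^sup>2)"
  by (simp add: L2_def)

lemma L2_norm_nonneg [simp]: "0 \<le> L2_norm f"
  by (simp add: L2_norm_def)

lemma L2_norm_sq: "(L2_norm f)\<^sup>2 = (LINT r|half_line. (cmod (f r))\<^sup>2)"
  by (simp add: L2_norm_def)

lemma L2_bounded_mono:
  assumes "g \<in> L2" "f \<in> borel_measurable half_line" "AE r in half_line. cmod (f r) \<le> B * cmod (g r)"
  shows "f \<in> L2"
proof -
  have "integrable half_line (\<lambda>r. (cmod (f r))\<^sup>2)"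
  proof (rule Bochner_Integration.integrable_bound)
    show "integrable half_line (\<lambda>r. B\<^sup>2 * (cmod (g r))\<^sup>2)"
      using assms by (simp add: L2_def)
    show "AE r in half_line. norm ((cmod (f r))\<^sup>2) \<le> norm (B\<^sup>2 * (cmod (g r))\<^sup>2)"
      using assms(3)
    proof eventually_elim
      case (elim r)
      have "(cmod (f r))\<^sup>2 \<le> (B * cmod (g r))\<^sup>2"
        using elim by (intro power_mono) auto
      thus ?case by (simp add: power_mult_distrib)
    qed
  qed (use assms(2) in simp)
  thus ?thesis using assms(2) by (simp add: L2_def)
qed

lemma L2_norm_bounded_mono:
  assumes "g \<in> L2" "f \<in> borel_measurable half_line" "AE r in half_line. cmod (f r) \<le> B * cmod (g r)" "0 \<le> B"
  shows "L2_norm f \<le> B * L2_norm g"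
proof -
  have "(LINT r|half_line. (cmod (f r))\<^sup>2) \<le> (LINT r|half_line. B\<^sup>2 * (cmod (g r))\<^sup>2)"
  proof (rule integral_mono_AE)
    show "integrable half_line (\<lambda>r. (cmod (f r))\<^sup>2)" 
      using L2_bounded_mono[OF assms(1-3)] by (simp add: L2_def)
    show "integrable half_line (\<lambda>r. B\<^sup>2 * (cmod (g r))\<^sup>2)"
      using assms by (simp add: L2_def)
    show "AE r in half_line. (cmod (f r))\<^sup>2 \<le> B\<^sup>2 * (cmod (g r))\<^sup>2"
      using assms(3)
    proof eventually_elim
      case (elim r)
      have "(cmod (f r))\<^sup>2 \<le> (B * cmod (g r))\<^sup>2"
        using elim by (intro power_mono) auto
      thus ?case by (simp add: power_mult_distrib)
    qed
  qed
  hence "(L2_norm f)\<^sup>2 \<le> (B * L2_norm g)\<^sup>2"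
    by (simp add: L2_norm_sq power_mult_distrib)
  thus ?thesis by (rule power2_le_imp_le) (use assms(4) in auto)
qed

lemma L2_cong_AE: "f \<in> L2 \<Longrightarrow> g \<in> borel_measurable half_line \<Longrightarrow> AE r in half_line. g r = f r \<Longrightarrow> g \<in> L2"
  by (rule L2_bounded_mono[where B=1]) auto

lemma L2_norm_cong_AE:
  assumes "AE r in half_line. g r = f r" "f \<in> L2" "g \<in> borel_measurable half_line"
  shows "L2_norm g = L2_norm f"
proof -
  have "(LINT r|half_line. (cmod (g r))\<^sup>2) = (LINT r|half_line. (cmod (f r))\<^sup>2)"
    by (rule integral_cong_AE) (use assms in \<open>auto intro: borel_measurable_integrable L2_integrable_sq simp: L2_def\<close>)
  thus ?thesis by (simp add: L2_norm_def)
qed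

lemma L2_bounded_mult:
  assumes "f \<in> L2" "m \<in> borel_measurable half_line" "\<And>r. 0 < r \<Longrightarrow> cmod (m r) \<le> B"
  shows "(\<lambda>r. m r * f r) \<in> L2"
  using assms(1)
proof (rule L2_bounded_mono)
  show "AE r in half_line. cmod (m r * f r) \<le> B * cmod (f r)"
    using AE_half_line_pos by eventually_elim (auto simp: norm_mult intro!: mult_right_mono assms)
qed (use assms(1,2) in \<open>auto dest: L2_measurable\<close>)

lemma L2_cmult: "f \<in> L2 \<Longrightarrow> (\<lambda>r. c * f r) \<in> L2"
  by (rule L2_bounded_mult[where B="cmod c"]) auto

lemma L2_norm_cmult: "L2_norm (\<lambda>r. c * f r) = cmod c * L2_norm f"
  by (simp add: L2_norm_def norm_mult power_mult_distrib real_sqrt_mult)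

lemma L2_cnj: "f \<in> L2 \<Longrightarrow> (\<lambda>r. cnj (f r)) \<in> L2"
  by (rule L2_bounded_mono[where B=1 and g=f])
     (auto intro!: borel_measurable_continuous_on[of cnj] continuous_intros dest: L2_measurable)

lemma L2_zero [simp]: "(\<lambda>r. 0) \<in> L2"
  by (simp add: L2_def)

lemma L2_add:
  assumes "f \<in> L2" "g \<in> L2"
  shows "(\<lambda>r. f r + g r) \<in> L2"
proof -
  have "integrable half_line (\<lambda>r. (cmod (f r + g r))\<^sup>2)"
  proof (rule Bochner_Integration.integrable_bound)
    show "integrable half_line (\<lambda>r. 2 * (cmod (f r))\<^sup>2 + 2 * (cmod (g r))\<^sup>2)"
      using assms by (simp add: L2_def)
    show "AE r in half_line. norm ((cmod (f r + g r))\<^sup>2) \<le> norm (2 * (cmod (f r))\<^sup>2 + 2 * (cmod (g r))\<^sup>2)"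
    proof (rule AE_I2)
      fix r
      have "(cmod (f r + g r))\<^sup>2 \<le> (cmod (f r) + cmod (g r))\<^sup>2"
        by (intro power_mono norm_triangle_ineq) auto
      also have "\<dots> \<le> 2 * (cmod (f r))\<^sup>2 + 2 * (cmod (g r))\<^sup>2"
        using sum_squares_bound[of "cmod (f r)" "cmod (g r)"] by (simp add: power2_sum)
      finally show "norm ((cmod (f r + g r))\<^sup>2) \<le> norm (2 * (cmod (f r))\<^sup>2 + 2 * (cmod (g r))\<^sup>2)" by simp
    qed
  qed (use assms[THEN L2_measurable] in simp)
  thus ?thesis using assms[THEN L2_measurable] by (simp add: L2_def)
qed

lemma L2_diff: "f \<in> L2 \<Longrightarrow> g \<in> L2 \<Longrightarrow> (\<lambda>r. f r - g r) \<in> L2"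
  using L2_add[of f "\<lambda>r. (-1) * g r"] L2_cmult[of g "-1"] by simp

lemma integrable_norm_mult_L2:
  assumes "f \<in> L2" "g \<in> L2"
  shows "integrable half_line (\<lambda>r. cmod (f r) * cmod (g r))"
proof (rule Bochner_Integration.integrable_bound)
  show "integrable half_line (\<lambda>r. (cmod (f r))\<^sup>2 + (cmod (g r))\<^sup>2)"
    using assms by (simp add: L2_def)
  show "AE r in half_line. norm (cmod (f r) * cmod (g r)) \<le> norm ((cmod (f r))\<^sup>2 + (cmod (g r))\<^sup>2)"
  proof (rule AE_I2)
    fix r
    have "2 * cmod (f r) * cmod (g r) \<le> (cmod (f r))\<^sup>2 + (cmod (g r))\<^sup>2"
      by (rule sum_squares_bound)
    moreover have "0 \<le> cmod (f r) * cmod (g r)" by simp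
    ultimately show "norm (cmod (f r) * cmod (g r)) \<le> norm ((cmod (f r))\<^sup>2 + (cmod (g r))\<^sup>2)"
      unfolding real_norm_def by linarith
  qed
qed (use assms[THEN L2_measurable] in simp)

lemma integrable_mult_L2:
  assumes "f \<in> L2" "g \<in> L2"
  shows "integrable half_line (\<lambda>r. f r * g r)"
  by (rule Bochner_Integration.integrable_bound[OF integrable_norm_mult_L2[OF assms]])
     (use assms[THEN L2_measurable] in \<open>auto simp: norm_mult\<close>)

section \<open>The Cauchy-Schwarz and triangle inequalities in L2\<close>

lemma quadratic_nonneg_imp:
  fixes a b x :: real
  assumes "\<And>t. 0 \<le> t\<^sup>2 * a - 2 * t * x + b" "0 \<le> a"
  shows "x\<^sup>2 \<le> a * b"
proof (cases "a = 0")
  case False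
  have "0 \<le> (x/a)\<^sup>2 * a - 2 * (x/a) * x + b" by (rule assms)
  also have "\<dots> = (a * b - x\<^sup>2) / a" using False by (simp add: field_simps power2_eq_square)
  finally show ?thesis using False assms(2) by (simp add: zero_le_divide_iff)
next
  case True
  have "x = 0"
  proof (rule ccontr)
    assume "x \<noteq> 0"
    \<comment> \<open>For \<open>a = 0\<close> the polynomial is \<open>b - 2 * t * x\<close>; this
      \<open>t\<close> gives it the value -1.\<close>
    thus False using assms(1)[of "(b+1)/(2*x)"] True by simp
  qed
  thus ?thesis using True by simp
qed

lemma L2_Cauchy_Schwarz:
  assumes "f \<in> L2" "g \<in> L2"
  shows "(LINT r|half_line. cmod (f r) * cmod (g r)) \<le> L2_norm f * L2_norm g"
proof -
  let ?X = "LINT r|half_line. cmod (f r) * cmod (g r)"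
  have "?X\<^sup>2 \<le> (L2_norm f)\<^sup>2 * (L2_norm g)\<^sup>2"
  proof (rule quadratic_nonneg_imp)
    fix t
    have "0 \<le> (LINT r|half_line. (t * cmod (f r) - cmod (g r))\<^sup>2)" by simp
    also have "\<dots> = (LINT r|half_line. t\<^sup>2 * (cmod (f r))\<^sup>2 - 2 * t * (cmod (f r) * cmod (g r)) + (cmod (g r))\<^sup>2)"
      by (simp add: power2_diff power_mult_distrib algebra_simps)
    also have "\<dots> = t\<^sup>2 * (L2_norm f)\<^sup>2 - 2 * t * ?X + (L2_norm g)\<^sup>2"
      using assms integrable_norm_mult_L2[OF assms] by (simp add: L2_norm_sq L2_def)
    finally show "0 \<le> t\<^sup>2 * (L2_norm f)\<^sup>2 - 2 * t * ?X + (L2_norm g)\<^sup>2" .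
  qed auto
  hence "?X\<^sup>2 \<le> (L2_norm f * L2_norm g)\<^sup>2" by (simp add: power_mult_distrib)
  thus ?thesis by (rule power2_le_imp_le) auto
qed

lemma L2_norm_triangle:
  assumes "f \<in> L2" "g \<in> L2"
  shows "L2_norm (\<lambda>r. f r + g r) \<le> L2_norm f + L2_norm g"
proof (rule power2_le_imp_le)
  have "(L2_norm (\<lambda>r. f r + g r))\<^sup>2 \<le> (LINT r|half_line. (cmod (f r))\<^sup>2 + 2 * (cmod (f r) * cmod (g r)) + (cmod (g r))\<^sup>2)"
    unfolding L2_norm_sq
  proof (rule integral_mono)
    fix r
    have "(cmod (f r + g r))\<^sup>2 \<le> (cmod (f r) + cmod (g r))\<^sup>2"
      by (intro power_mono norm_triangle_ineq) auto
    thus "(cmod (f r + g r))\<^sup>2 \<le> (cmod (f r))\<^sup>2 + 2 * (cmod (f r) * cmod (g r)) + (cmod (g r))\<^sup>2"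
      by (simp add: power2_sum algebra_simps)
  qed (use assms L2_add[OF assms] integrable_norm_mult_L2[OF assms] in \<open>auto simp: L2_def\<close>)
  also have "\<dots> = (L2_norm f)\<^sup>2 + 2 * (LINT r|half_line. cmod (f r) * cmod (g r)) + (L2_norm g)\<^sup>2"
    using assms integrable_norm_mult_L2[OF assms] by (simp add: L2_norm_sq L2_def)
  also have "\<dots> \<le> (L2_norm f + L2_norm g)\<^sup>2"
    using L2_Cauchy_Schwarz[OF assms] by (simp add: power2_sum)
  finally show "(L2_norm (\<lambda>r. f r + g r))\<^sup>2 \<le> (L2_norm f + L2_norm g)\<^sup>2" .
qed auto

section \<open>Absolutely continuous functions\<close>

text \<open>Local absolute continuity on [0, \<infinity>), encoded by the integral representation.
  The density is integrable up to the endpoint, so \<open>U 0\<close> is a genuine boundary value,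
  and the product rule becomes a Fubini argument.\<close>

definition ac_deriv :: "(real \<Rightarrow> complex) \<Rightarrow> (real \<Rightarrow> complex) \<Rightarrow> bool" where
  "ac_deriv U u \<longleftrightarrow> (\<forall>r\<ge>0. set_integrable half_line {..r} u \<and> U r = U 0 + (LINT t:{..r}|half_line. u t))"

lemma ac_deriv_integrable: "ac_deriv U u \<Longrightarrow> set_integrable half_line {..r} u"
proof (cases "0 \<le> r")
  case False
  have "set_integrable half_line {..r} u \<longleftrightarrow> integrable half_line (\<lambda>_. 0 :: complex)"
    unfolding set_integrable_def using False by (intro Bochner_Integration.integrable_cong) (auto simp: indicator_def)
  thus ?thesis by simp
qed (simp add: ac_deriv_def)

text \<open>The bridge between the Lebesgue integral over (0, r] and the gauge integral over [0, r],
  whose domains differ by the null set {0}. The fundamental theorem of calculus and the second mean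
  value theorem are applied in the gauge form.\<close>

lemma half_line_set_integral_eq:
  fixes u :: "real \<Rightarrow> 'a :: {euclidean_space}"
  shows "set_integrable half_line {..r} u \<longleftrightarrow> u absolutely_integrable_on {0..r}"
    and "set_integrable half_line {..r} u \<Longrightarrow> (LINT t:{..r}|half_line. u t) = integral {0..r} u"
proof -
  have ind: "indicator {0<..} x *\<^sub>R indicator {..r} x *\<^sub>R u x = indicator {0<..r} x *\<^sub>R u x" for x :: real
    by (auto simp: indicator_def)
  have neg: "negligible (sym_diff {0<..r} {0..r})" "negligible {x \<in> {0..r} - {0<..r}. u x \<noteq> 0}" "negligible {x \<in> {0<..r} - {0..r}. u x \<noteq> 0}"
    by (rule negligible_subset[OF negligible_sing[of "0::real"]], auto)+
  have "set_integrable half_line {..r} u \<longleftrightarrow> u absolutely_integrable_on {0<..r}"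
    unfolding set_integrable_def by (subst integrable_restrict_space) (simp_all add: ind del: scaleR_scaleR)
  also have "\<dots> \<longleftrightarrow> u absolutely_integrable_on {0..r}"
    by (rule absolutely_integrable_spike_set_eq) (rule neg)+
  finally show iff: "set_integrable half_line {..r} u \<longleftrightarrow> u absolutely_integrable_on {0..r}" .
  assume i: "set_integrable half_line {..r} u"
  have "(LINT t:{..r}|half_line. u t) = (LINT t:{0<..r}|lebesgue. u t)"
    unfolding set_lebesgue_integral_def by (subst integral_restrict_space) (simp_all add: ind del: scaleR_scaleR)
  also have "\<dots> = integral {0<..r} u"
    using i absolutely_integrable_spike_set_eq[OF neg(3,2)] iff
    by (intro set_lebesgue_integral_eq_integral(2)) blast
  also have "\<dots> = integral {0..r} u"
    by (rule integral_spike_set) (rule neg)+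
  finally show "(LINT t:{..r}|half_line. u t) = integral {0..r} u" .
qed

lemma ac_deriv_iff:
  "ac_deriv U u \<longleftrightarrow> (\<forall>r\<ge>0. u absolutely_integrable_on {0..r} \<and> U r = U 0 + integral {0..r} u)"
  unfolding ac_deriv_def using half_line_set_integral_eq by metis

lemma continuous_on_atLeastI:
  fixes f :: "real \<Rightarrow> 'a :: topological_space"
  assumes "\<And>R. continuous_on {a..R} f"
  shows "continuous_on {a..} f"
  unfolding continuous_on_def
proof
  fix x assume "x \<in> {a..}"
  hence "(f \<longlongrightarrow> f x) (at x within {a..x+1})"
    using assms[of "x+1"] by (auto simp: continuous_on_def)
  moreover have "at x within {a..x+1} = at x within {a..}"
    by (rule at_within_nhd[of _ "{..<x+1}"]) auto
  ultimately show "(f \<longlongrightarrow> f x) (at x within {a..})" by simp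
qed

lemma ac_deriv_continuous: 
  assumes "ac_deriv U u"
  shows "continuous_on {0..} U"
proof -
  have "continuous_on {0..R} U" for R
  proof (cases "0 \<le> R")
    case True
    have "u absolutely_integrable_on {0..R}" using assms True unfolding ac_deriv_iff by blast
    hence "continuous_on {0..R} (\<lambda>r. U 0 + integral {0..r} u)"
      by (intro continuous_intros indefinite_integral_continuous_1 set_lebesgue_integral_eq_integral(1))
    moreover have "U r = U 0 + integral {0..r} u" if "r \<in> {0..R}" for r
      using assms that unfolding ac_deriv_iff atLeastAtMost_iff by blast
    ultimately show ?thesis by (subst continuous_on_cong[OF refl])
  qed auto
  thus ?thesis
    by (rule continuous_on_atLeastI)
qed

lemma ac_derivI:
  assumes "\<And>r. 0 \<le> r \<Longrightarrow> set_integrable half_line {..r} u"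
    "\<And>r. 0 \<le> r \<Longrightarrow> U r = U 0 + (LINT t:{..r}|half_line. u t)"
  shows "ac_deriv U u"
  using assms unfolding ac_deriv_def by blast

lemma ac_derivD: "ac_deriv U u \<Longrightarrow> 0 \<le> r \<Longrightarrow> U r = U 0 + (LINT t:{..r}|half_line. u t)"
  unfolding ac_deriv_def by blast

lemma ac_deriv_const: "ac_deriv (\<lambda>_. c) (\<lambda>_. 0)"
  by (simp add: ac_deriv_def set_integrable_def)

lemma ac_deriv_add: 
  assumes "ac_deriv U u" "ac_deriv V v"
  shows "ac_deriv (\<lambda>r. U r + V r) (\<lambda>r. u r + v r)"
proof (rule ac_derivI)
  fix r :: real assume r: "0 \<le> r"
  note i = ac_deriv_integrable[OF assms(1), of r] ac_deriv_integrable[OF assms(2), of r]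
  show "set_integrable half_line {..r} (\<lambda>r. u r + v r)" using i by (rule set_integral_add)
  show "U r + V r = U 0 + V 0 + (LINT t:{..r}|half_line. u t + v t)"
    using ac_derivD[OF assms(1) r] ac_derivD[OF assms(2) r] set_integral_add(2)[OF i] by simp
qed

lemma ac_deriv_cmult:
  assumes "ac_deriv U u"
  shows "ac_deriv (\<lambda>r. c * U r) (\<lambda>r. c * u r)"
proof (rule ac_derivI)
  fix r :: real assume r: "0 \<le> r"
  show "set_integrable half_line {..r} (\<lambda>r. c * u r)"
    using ac_deriv_integrable[OF assms, of r] by simp
  show "c * U r = c * U 0 + (LINT t:{..r}|half_line. c * u t)"
    using ac_derivD[OF assms r] by (simp add: distrib_left)
qed

lemma ac_deriv_diff: 
  assumes "ac_deriv U u" "ac_deriv V v"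
  shows "ac_deriv (\<lambda>r. U r - V r) (\<lambda>r. u r - v r)"
  using ac_deriv_add[OF assms(1) ac_deriv_cmult[OF assms(2), of "-1"]] by simp

lemma ac_deriv_cnj:
  assumes "ac_deriv U u"
  shows "ac_deriv (\<lambda>r. cnj (U r)) (\<lambda>r. cnj (u r))"
proof (rule ac_derivI)
  fix r :: real assume r: "0 \<le> r"
  have i: "integrable half_line (\<lambda>t. indicator {..r} t *\<^sub>R u t)"
    using ac_deriv_integrable[OF assms, of r] by (simp add: set_integrable_def)
  show "set_integrable half_line {..r} (\<lambda>r. cnj (u r))"
    using integrable_bounded_linear[OF bounded_linear_cnj i] by (simp add: set_integrable_def)
  show "cnj (U r) = cnj (U 0) + (LINT t:{..r}|half_line. cnj (u t))"
    using integral_bounded_linear[OF bounded_linear_cnj i]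
    by (subst ac_derivD[OF assms r]) (simp add: set_lebesgue_integral_def)
qed

lemma ac_deriv_cong_AE:
  assumes "ac_deriv U u" "AE r in half_line. v r = u r" "v \<in> borel_measurable half_line" "\<And>r. r \<ge> 0 \<Longrightarrow> V r = U r"
  shows "ac_deriv V v"
proof (rule ac_derivI)
  fix r :: real assume "0 \<le> r"
  note i = ac_deriv_integrable[OF assms(1), of r] and e = ac_derivD[OF assms(1) \<open>0 \<le> r\<close>]
  have m: "(\<lambda>t. indicator {..r} t *\<^sub>R v t) \<in> borel_measurable half_line"
    by (intro borel_measurable_scaleR borel_measurable_half_lineI assms) simp
  have ae: "AE t in half_line. indicator {..r} t *\<^sub>R v t = indicator {..r} t *\<^sub>R u t"
    using assms(2) by eventually_elim simp
  show "set_integrable half_line {..r} v"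
    unfolding set_integrable_def
    using i ae m by (subst integrable_cong_AE) (auto simp: set_integrable_def intro: borel_measurable_integrable)
  have "(LINT t:{..r}|half_line. v t) = (LINT t:{..r}|half_line. u t)"
    unfolding set_lebesgue_integral_def
    by (rule integral_cong_AE) (use ae m i in \<open>auto simp: set_integrable_def intro: borel_measurable_integrable\<close>)
  thus "V r = V 0 + (LINT t:{..r}|half_line. v t)"
    using e assms(4)[of r] assms(4)[of 0] \<open>0 \<le> r\<close> by simp
qed

text \<open>The product is the integral of p(t) q(s) over the quadrant. Splitting it along the
  diagonal into s \<le> t and t \<le> s, and integrating the inner variable first, gives the two
  terms; the doubly counted diagonal is a null set.\<close>

lemma Fubini_triangle:
  fixes p q :: "real \<Rightarrow> complex"
  assumes p: "integrable half_line p" and q: "integrable half_line q"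
  shows "(LINT t|half_line. p t) * (LINT t|half_line. q t) =
     (LINT t|half_line. p t * (LINT s:{..t}|half_line. q s)) + (LINT t|half_line. (LINT s:{..t}|half_line. p s) * q t)"
proof -
  let ?M = "half_line"
  let ?f = "\<lambda>(t, s). if s \<le> t then p t * q s else 0"
  let ?g = "\<lambda>(t, s). if t \<le> s then p t * q s else 0"
  have [measurable]: "p \<in> borel_measurable ?M" "q \<in> borel_measurable ?M" using p q by auto
  have [measurable]: "(\<lambda>x. x) \<in> borel_measurable half_line" by (rule borel_measurable_half_lineI) simp
  have pq: "integrable (?M \<Otimes>\<^sub>M ?M) (\<lambda>(t, s). p t * q s)"
  proof (rule half_line_pair.Fubini_integrable)
    show "integrable ?M (\<lambda>t. LINT s|?M. norm (case (t, s) of (t, s) \<Rightarrow> p t * q s))"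
      using p by (simp add: norm_mult)
    show "AE t in ?M. integrable ?M (\<lambda>s. case (t, s) of (t, s) \<Rightarrow> p t * q s)"
      using q by simp
  qed measurable
  have fm: "?f \<in> borel_measurable (?M \<Otimes>\<^sub>M ?M)" by measurable
  have gm: "?g \<in> borel_measurable (?M \<Otimes>\<^sub>M ?M)" by measurable
  have f: "integrable (?M \<Otimes>\<^sub>M ?M) ?f"
    by (rule Bochner_Integration.integrable_bound[OF pq fm]) auto
  have g: "integrable (?M \<Otimes>\<^sub>M ?M) ?g"
    by (rule Bochner_Integration.integrable_bound[OF pq gm]) auto
  have f1: "(LINT t|?M. (LINT s|?M. ?f (t, s))) = (LINT t|?M. p t * (LINT s:{..t}|?M. q s))"
    unfolding set_lebesgue_integral_def
    by (intro Bochner_Integration.integral_cong refl) (simp flip: integral_mult_right_zero integral_mult_left_zero, intro Bochner_Integration.integral_cong refl, simp add: indicator_def)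
  have g1: "(LINT s|?M. (LINT t|?M. ?g (t, s))) = (LINT s|?M. (LINT t:{..s}|?M. p t) * q s)"
    unfolding set_lebesgue_integral_def
    by (intro Bochner_Integration.integral_cong refl) (simp flip: integral_mult_right_zero integral_mult_left_zero, intro Bochner_Integration.integral_cong refl, simp add: indicator_def)
  have g2: "(LINT s|?M. (LINT t|?M. ?g (t, s))) = (LINT t|?M. (LINT s|?M. ?g (t, s)))"
    using half_line_pair.Fubini_integral[of "\<lambda>t s. ?g (t, s)"] g by simp
  have *: "(LINT s|?M. ?f (t, s)) + (LINT s|?M. ?g (t, s)) = p t * (LINT s|?M. q s)" for t
  proof -
    have "(LINT s|?M. ?f (t, s)) + (LINT s|?M. ?g (t, s)) = (LINT s|?M. ?f (t, s) + ?g (t, s))"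
    proof (rule Bochner_Integration.integral_add[symmetric])
      have qt: "integrable ?M (\<lambda>s. p t * q s)" using q by simp
      show "integrable ?M (\<lambda>s. ?f (t, s))" "integrable ?M (\<lambda>s. ?g (t, s))"
        by (rule Bochner_Integration.integrable_bound[OF qt]; simp)+
    qed
    also have "\<dots> = (LINT s|?M. p t * q s)"
      by (rule integral_cong_AE) (use AE_half_line_neq[of t] in \<open>(simp; fail)+, eventually_elim, auto\<close>)
    finally show ?thesis by simp
  qed
  have "(LINT t|?M. p t * (LINT s|?M. q s)) = (LINT t|?M. (LINT s|?M. ?f (t, s)) + (LINT s|?M. ?g (t, s)))"
    unfolding * ..
  also have "\<dots> = (LINT t|?M. (LINT s|?M. ?f (t, s))) + (LINT t|?M. (LINT s|?M. ?g (t, s)))"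
    by (rule Bochner_Integration.integral_add) (rule half_line_pair.integrable_fst, use f g in simp)+
  finally show ?thesis using f1 g1 g2 by simp
qed

lemma set_integral_half_line_zero: "r \<le> 0 \<Longrightarrow> (LINT t:{..r}|half_line. u t) = (0 :: complex)"
proof -
  assume r: "r \<le> 0"
  have "(LINT t:{..r}|half_line. u t) = (LINT t|half_line. 0)"
    unfolding set_lebesgue_integral_def
    by (rule Bochner_Integration.integral_cong) (use r in \<open>auto simp: indicator_def\<close>)
  thus ?thesis by simp
qed

lemma ac_deriv_integral:
  assumes "\<And>r. 0 \<le> r \<Longrightarrow> set_integrable half_line {..r} u"
  shows "ac_deriv (\<lambda>r. c + (LINT t:{..r}|half_line. u t)) u"
  by (rule ac_derivI) (simp_all add: assms set_integral_half_line_zero)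

lemma continuous_measurable_half_line:
  fixes U :: "real \<Rightarrow> 'a :: euclidean_space"
  shows "continuous_on {0..} U \<Longrightarrow> U \<in> borel_measurable half_line"
  by (rule continuous_imp_measurable_on_sets_lebesgue) (auto elim: continuous_on_subset)

lemma ac_deriv_measurable: "ac_deriv U u \<Longrightarrow> U \<in> borel_measurable half_line"
  by (rule continuous_measurable_half_line) (rule ac_deriv_continuous)

lemma set_integrable_mult_continuous:
  fixes u Q :: "real \<Rightarrow> complex"
  assumes u: "set_integrable half_line {..r} u" and Q: "continuous_on {0..} Q"
  shows "set_integrable half_line {..r} (\<lambda>t. u t * Q t)"
proof -
  have "continuous_on {0..r} Q" using Q by (rule continuous_on_subset) auto
  hence "compact (Q ` {0..r})" by (intro compact_continuous_image) auto
  hence "bounded (Q ` {0..r})" by (rule compact_imp_bounded)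
  then obtain B where B: "\<And>t. t \<in> {0..r} \<Longrightarrow> norm (Q t) \<le> B"
    unfolding bounded_iff by blast
  have i: "integrable half_line (\<lambda>t. B *\<^sub>R (indicator {..r} t *\<^sub>R u t))"
    using u unfolding set_integrable_def by (rule integrable_scaleR_right)
  show ?thesis unfolding set_integrable_def
  proof (rule Bochner_Integration.integrable_bound[OF i])
    have "(\<lambda>t. indicator {..r} t *\<^sub>R u t) \<in> borel_measurable half_line"
      using u unfolding set_integrable_def by (rule borel_measurable_integrable)
    hence "(\<lambda>t. (indicator {..r} t *\<^sub>R u t) * Q t) \<in> borel_measurable half_line"
      by (rule borel_measurable_times) (rule continuous_measurable_half_line[OF Q])
    thus "(\<lambda>t. indicator {..r} t *\<^sub>R (u t * Q t)) \<in> borel_measurable half_line"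
      by simp
    show "AE t in half_line. norm (indicator {..r} t *\<^sub>R (u t * Q t)) \<le> norm (B *\<^sub>R indicator {..r} t *\<^sub>R u t)"
      using AE_half_line_pos
    proof eventually_elim
      case (elim t)
      show ?case
      proof (cases "t \<le> r")
        case True
        hence "norm (Q t) \<le> \<bar>B\<bar>" using B[of t] elim by auto
        thus ?thesis using mult_right_mono[of "norm (Q t)" "\<bar>B\<bar>" "norm (u t)"] True by (simp add: norm_mult mult.commute)
      qed simp
    qed
  qed
qed

text \<open>The product of the increments of P and Q over [0, r] is a product of two integrals.
  \<open>Fubini_triangle\<close> splits it into the integrals of p (Q - Q 0) and (P - P 0) q, and
  expanding the constants gives the product rule.\<close>

lemma ac_deriv_mult:
  assumes P: "ac_deriv P p" and Q: "ac_deriv Q q"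
  shows "ac_deriv (\<lambda>r. P r * Q r) (\<lambda>r. p r * Q r + P r * q r)"
proof (rule ac_derivI)
  fix r :: real assume r: "0 \<le> r"
  note ip = ac_deriv_integrable[OF P] and iq = ac_deriv_integrable[OF Q]
  have ipQ: "set_integrable half_line {..r} (\<lambda>t. p t * Q t)"
    by (rule set_integrable_mult_continuous[OF ip ac_deriv_continuous[OF Q]])
  have iPq: "set_integrable half_line {..r} (\<lambda>t. P t * q t)"
    using set_integrable_mult_continuous[OF iq ac_deriv_continuous[OF P], of r] by (simp add: mult.commute)
  show "set_integrable half_line {..r} (\<lambda>r. p r * Q r + P r * q r)"
    using ipQ iPq by (rule set_integral_add)
  \<comment> \<open>Cutting the densities off at \<open>r\<close> makes them integrable over the
    whole half line, as \<open>Fubini_triangle\<close> requires; their primitives are unchanged up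
    to \<open>r\<close>.\<close>
  define p1 where "p1 t = indicator {..r} t *\<^sub>R p t" for t
  define q1 where "q1 t = indicator {..r} t *\<^sub>R q t" for t
  have int: "integrable half_line p1" "integrable half_line q1"
    using ip[of r] iq[of r] unfolding p1_def q1_def set_integrable_def by auto
  have eqs: "(LINT s:{..t}|half_line. q1 s) = Q t - Q 0" "(LINT s:{..t}|half_line. p1 s) = P t - P 0"
    if "0 < t" "t \<le> r" for t
  proof -
    have "(LINT s:{..t}|half_line. q1 s) = (LINT s:{..t}|half_line. q s)"
      unfolding set_lebesgue_integral_def q1_def using that
      by (intro Bochner_Integration.integral_cong) (auto simp: indicator_def)
    thus "(LINT s:{..t}|half_line. q1 s) = Q t - Q 0" using ac_derivD[OF Q, of t] that by simp
    have "(LINT s:{..t}|half_line. p1 s) = (LINT s:{..t}|half_line. p s)"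
      unfolding set_lebesgue_integral_def p1_def using that
      by (intro Bochner_Integration.integral_cong) (auto simp: indicator_def)
    thus "(LINT s:{..t}|half_line. p1 s) = P t - P 0" using ac_derivD[OF P, of t] that by simp
  qed
  have "(LINT t:{..r}|half_line. p t) * (LINT t:{..r}|half_line. q t) = (LINT t|half_line. p1 t) * (LINT t|half_line. q1 t)"
    by (simp add: p1_def q1_def set_lebesgue_integral_def)
  also have "\<dots> = (LINT t|half_line. p1 t * (LINT s:{..t}|half_line. q1 s)) + (LINT t|half_line. (LINT s:{..t}|half_line. p1 s) * q1 t)"
    by (rule Fubini_triangle) (fact int)+
  also have "(LINT t|half_line. p1 t * (LINT s:{..t}|half_line. q1 s)) = (LINT t:{..r}|half_line. p t * Q t - Q 0 * p t)"
    unfolding set_lebesgue_integral_def[of _ "{..r}"]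
    by (intro Bochner_Integration.integral_cong refl) (auto simp: p1_def eqs indicator_def algebra_simps)
  also have "\<dots> = (LINT t:{..r}|half_line. p t * Q t) - Q 0 * (LINT t:{..r}|half_line. p t)"
    using ipQ ip[of r] by (subst set_integral_diff) auto
  also have "(LINT t|half_line. (LINT s:{..t}|half_line. p1 s) * q1 t) = (LINT t:{..r}|half_line. P t * q t - P 0 * q t)"
    unfolding set_lebesgue_integral_def[of _ "{..r}"]
    by (intro Bochner_Integration.integral_cong refl) (auto simp: q1_def eqs indicator_def algebra_simps)
  also have "\<dots> = (LINT t:{..r}|half_line. P t * q t) - P 0 * (LINT t:{..r}|half_line. q t)"
    using iPq iq[of r] by (subst set_integral_diff) auto
  finally have *: "(LINT t:{..r}|half_line. p t * Q t) + (LINT t:{..r}|half_line. P t * q t) =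
     (LINT t:{..r}|half_line. p t) * (LINT t:{..r}|half_line. q t)
     + Q 0 * (LINT t:{..r}|half_line. p t) + P 0 * (LINT t:{..r}|half_line. q t)"
    by (simp add: algebra_simps)
  have Pr: "P r = P 0 + (LINT t:{..r}|half_line. p t)" and Qr: "Q r = Q 0 + (LINT t:{..r}|half_line. q t)"
    using ac_derivD[OF P r] ac_derivD[OF Q r] by auto
  have "P r * Q r = P 0 * Q 0 + ((LINT t:{..r}|half_line. p t * Q t) + (LINT t:{..r}|half_line. P t * q t))"
    unfolding * by (subst Pr, subst Qr) (simp add: algebra_simps)
  thus "P r * Q r = P 0 * Q 0 + (LINT t:{..r}|half_line. p t * Q t + P t * q t)"
    using ipQ iPq by (simp add: set_integral_add)
qed

lemma ac_deriv_C1: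
  assumes d: "\<And>r. 0 \<le> r \<Longrightarrow> (m has_vector_derivative m' r) (at r)" and c: "continuous_on {0..} m'"
  shows "ac_deriv m m'"
  unfolding ac_deriv_iff
proof (intro allI impI conjI)
  fix r :: real assume r: "0 \<le> r"
  have "continuous_on {0..r} m'" using c by (rule continuous_on_subset) auto
  thus "m' absolutely_integrable_on {0..r}"
    using absolutely_integrable_continuous_real by blast
  have "(m' has_integral (m r - m 0)) {0..r}"
    by (rule fundamental_theorem_of_calculus) (use r d in \<open>auto intro: has_vector_derivative_at_within\<close>)
  thus "m r = m 0 + integral {0..r} m'" by (simp add: integral_unique)
qed

lemma set_integral_half_line_tendsto:
  fixes p :: "real \<Rightarrow> 'a :: euclidean_space"
  assumes "integrable half_line p"
  shows "((\<lambda>r. LINT t:{..r}|half_line. p t) \<longlongrightarrow> (LINT t|half_line. p t)) at_top"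
proof (rule tendsto_at_topI_sequentially)
  fix X :: "nat \<Rightarrow> real" assume X: "filterlim X at_top sequentially"
  show "(\<lambda>n. LINT t:{..X n}|half_line. p t) \<longlonglongrightarrow> (LINT t|half_line. p t)"
    unfolding set_lebesgue_integral_def
  proof (rule integral_dominated_convergence[where w="\<lambda>t. norm (p t)"])
    have "(\<lambda>t. indicator {..X i} t :: real) \<in> borel_measurable half_line" for i
      by (rule borel_measurable_half_lineI) auto
    thus "(\<lambda>t. indicator {..X i} t *\<^sub>R p t) \<in> borel_measurable half_line" for i
      using assms by (intro borel_measurable_scaleR) auto
    show "AE t in half_line. (\<lambda>i. indicator {..X i} t *\<^sub>R p t) \<longlonglongrightarrow> p t"
    proof (rule AE_I2)
      fix t
      have "eventually (\<lambda>i. t \<le> X i) sequentially" using X by (simp add: filterlim_at_top)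
      hence "eventually (\<lambda>i. indicator {..X i} t *\<^sub>R p t = p t) sequentially"
        by eventually_elim simp
      thus "(\<lambda>i. indicator {..X i} t *\<^sub>R p t) \<longlonglongrightarrow> p t" by (rule tendsto_eventually)
    qed
  qed (use assms in \<open>auto simp: indicator_def\<close>)
qed

text \<open>If L were nonzero, |P| would exceed |L| / 2 on a half line of infinite measure, against
  integrability.\<close>

lemma integrable_half_line_tendsto_imp_zero:
  fixes P :: "real \<Rightarrow> complex"
  assumes i: "integrable half_line P" and L: "(P \<longlongrightarrow> L) at_top"
  shows "L = 0"
proof (rule ccontr)
  assume L0: "L \<noteq> 0"
  have "((\<lambda>r. norm (P r)) \<longlongrightarrow> norm L) at_top" using L by (rule tendsto_norm)
  hence "eventually (\<lambda>r. norm L / 2 < norm (P r)) at_top"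
    by (rule order_tendstoD) (use L0 in simp)
  then obtain N where N: "\<And>r. r \<ge> N \<Longrightarrow> norm L / 2 < norm (P r)" by (auto simp: eventually_at_top_linorder)
  define N' where "N' = max N 0"
  have "integrable half_line (\<lambda>r. indicator {N'<..} r :: real)"
  proof (rule Bochner_Integration.integrable_bound)
    show "integrable half_line (\<lambda>r. (2 / norm L) *\<^sub>R P r)" using i by (rule integrable_scaleR_right)
    show "(\<lambda>r. indicator {N'<..} r :: real) \<in> borel_measurable half_line"
      by (intro borel_measurable_half_lineI) auto
    show "AE r in half_line. norm (indicator {N'<..} r :: real) \<le> norm ((2 / norm L) *\<^sub>R P r)"
      using N L0 by (intro AE_I2) (auto simp: indicator_def N'_def field_simps less_imp_le)
  qed
  hence "integrable lebesgue (\<lambda>r. indicator {0<..} r *\<^sub>R (indicator {N'<..} r :: real))"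
    by (subst (asm) integrable_restrict_space) auto
  also have "(\<lambda>r. indicator {0<..} r *\<^sub>R (indicator {N'<..} r :: real)) = indicator {N'<..}"
    by (auto simp: indicator_def N'_def)
  finally have "emeasure lebesgue {N'<..} < \<infinity>"
    by (simp add: integrable_indicator_iff)
  moreover have "ennreal K \<le> emeasure lebesgue {N'<..}" if "K \<ge> 0" for K
  proof -
    have "emeasure lebesgue {N'<..N'+K} \<le> emeasure lebesgue {N'<..}"
      by (rule emeasure_mono) auto
    thus ?thesis using that by simp
  qed
  from this[of "enn2real (emeasure lebesgue {N'<..}) + 1"]
  have "ennreal (enn2real (emeasure lebesgue {N'<..}) + 1) \<le> emeasure lebesgue {N'<..}"
    by (simp del: ennreal_plus)
  ultimately show False
    by (cases "emeasure lebesgue {N'<..}") (auto simp: top_unique)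
qed

text \<open>Integrability of p gives P a limit at infinity, and integrability of P forces this limit
  to be 0. This removes the boundary term at infinity in all integrations by parts below.\<close>

lemma ac_deriv_integral_half_line:
  assumes P: "ac_deriv P p" and i: "integrable half_line P" "integrable half_line p"
  shows "(LINT t|half_line. p t) = - P 0"
proof -
  have "((\<lambda>r. P 0 + (LINT t:{..r}|half_line. p t)) \<longlongrightarrow> P 0 + (LINT t|half_line. p t)) at_top"
    by (intro tendsto_intros set_integral_half_line_tendsto i)
  moreover have "eventually (\<lambda>r. P 0 + (LINT t:{..r}|half_line. p t) = P r) at_top"
    using eventually_ge_at_top[of 0] by eventually_elim (rule ac_derivD[OF P, symmetric])
  ultimately have "(P \<longlongrightarrow> P 0 + (LINT t|half_line. p t)) at_top"
    by (rule Lim_transform_eventually)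
  hence "P 0 + (LINT t|half_line. p t) = 0" by (rule integrable_half_line_tendsto_imp_zero[OF i(1)])
  thus ?thesis by (simp add: eq_neg_iff_add_eq_0 add.commute)
qed

section \<open>Test functions\<close>

definition smooth :: "(real \<Rightarrow> real) \<Rightarrow> bool" where
  "smooth f \<longleftrightarrow> (\<forall>n x. ((deriv ^^ n) f) differentiable (at x))"

text \<open>Smoothness is shown by exhibiting a family of differentiable functions that is closed
  under \<open>deriv\<close>; this avoids formulas for higher derivatives.\<close>

lemma smooth_coinduct:
  assumes "\<And>f x. f \<in> S \<Longrightarrow> f differentiable (at x)" "\<And>f. f \<in> S \<Longrightarrow> deriv f \<in> S" "f \<in> S"
  shows "smooth f"
proof -
  have "(deriv ^^ n) f \<in> S" for n
    by (induction n) (use assms in auto)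
  thus ?thesis using assms(1) by (auto simp: smooth_def)
qed

lemma smooth_differentiable: "smooth f \<Longrightarrow> f differentiable (at x)"
  unfolding smooth_def using funpow_0[of deriv f] by (auto dest: spec[of _ 0])

lemma smooth_has_derivative: "smooth f \<Longrightarrow> (f has_real_derivative deriv f x) (at x)"
  using DERIV_deriv_iff_real_differentiable smooth_differentiable by blast

lemma smooth_continuous: "smooth f \<Longrightarrow> continuous_on A f"
  by (meson DERIV_isCont continuous_at_imp_continuous_on smooth_has_derivative)

lemma smooth_deriv: "smooth f \<Longrightarrow> smooth (deriv f)"
  unfolding smooth_def
proof (intro allI)
  fix n x assume "\<forall>n x. (deriv ^^ n) f differentiable at x"
  hence "(deriv ^^ Suc n) f differentiable at x" by blast
  thus "(deriv ^^ n) (deriv f) differentiable at x" unfolding funpow_Suc_right by simp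
qed

lemma smooth_antideriv:
  assumes "\<And>x. (F has_real_derivative f x) (at x)" "smooth f"
  shows "smooth F"
  unfolding smooth_def
proof (intro allI)
  have "deriv F = f" using assms(1) by (auto intro: DERIV_imp_deriv)
  fix n x
  show "(deriv ^^ n) F differentiable at x"
  proof (cases n)
    case 0
    thus ?thesis using assms(1)[of x] by (auto simp: real_differentiable_def)
  next
    case (Suc m)
    hence "(deriv ^^ n) F = (deriv ^^ m) f" using \<open>deriv F = f\<close> by (simp add: funpow_Suc_right del: funpow.simps)
    thus ?thesis using assms(2) by (simp add: smooth_def)
  qed
qed

text \<open>The derivative of a product is a sum of products, so the algebra generated by the smooth
  functions is closed under \<open>deriv\<close> and fits \<open>smooth_coinduct\<close>.\<close>

inductive_set smooth_algebra :: "(real \<Rightarrow> real) set" where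
  base: "smooth f \<Longrightarrow> f \<in> smooth_algebra"
| add: "f \<in> smooth_algebra \<Longrightarrow> g \<in> smooth_algebra \<Longrightarrow> (\<lambda>x. f x + g x) \<in> smooth_algebra"
| mult: "f \<in> smooth_algebra \<Longrightarrow> g \<in> smooth_algebra \<Longrightarrow> (\<lambda>x. f x * g x) \<in> smooth_algebra"

lemma smooth_algebra_closed:
  assumes "f \<in> smooth_algebra"
  shows "(\<forall>x. f differentiable (at x)) \<and> deriv f \<in> smooth_algebra"
  using assms
proof induction
  case (base f)
  thus ?case by (auto intro: smooth_differentiable smooth_deriv smooth_algebra.base)
next
  case (add f g)
  have "deriv (\<lambda>x. f x + g x) = (\<lambda>x. deriv f x + deriv g x)"
    by (intro ext DERIV_imp_deriv DERIV_add) (use add in \<open>auto simp: DERIV_deriv_iff_real_differentiable\<close>)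
  thus ?case using add by (auto intro!: smooth_algebra.add)
next
  case (mult f g)
  have "deriv (\<lambda>x. f x * g x) = (\<lambda>x. deriv f x * g x + deriv g x * f x)"
    by (intro ext DERIV_imp_deriv DERIV_mult) (use mult in \<open>auto simp: DERIV_deriv_iff_real_differentiable\<close>)
  thus ?case using mult by (auto intro!: smooth_algebra.add smooth_algebra.mult)
qed

lemma smooth_algebra_smooth: "f \<in> smooth_algebra \<Longrightarrow> smooth f"
  by (rule smooth_coinduct[of smooth_algebra]) (use smooth_algebra_closed in auto)

lemma smooth_add: "smooth f \<Longrightarrow> smooth g \<Longrightarrow> smooth (\<lambda>x. f x + g x)"
  by (rule smooth_algebra_smooth, rule smooth_algebra.add) (auto intro: smooth_algebra.base)

lemma smooth_mult: "smooth f \<Longrightarrow> smooth g \<Longrightarrow> smooth (\<lambda>x. f x * g x)"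
  by (rule smooth_algebra_smooth, rule smooth_algebra.mult) (auto intro: smooth_algebra.base)

lemma smooth_const: "smooth (\<lambda>x. c)"
  by (rule smooth_coinduct[of "range (\<lambda>c x. c)"]) auto

lemma smooth_affine:
  assumes "smooth f"
  shows "smooth (\<lambda>x. f (a * x + b))"
\<comment> \<open>The factor \<open>k\<close> absorbs the powers of \<open>a\<close> that the chain
  rule produces.\<close>
proof (rule smooth_coinduct[of "{\<lambda>x. k * g (a * x + b) | k g. smooth g}"])
  have d: "((\<lambda>x. k * g (a * x + b)) has_real_derivative (k * a) * deriv g (a * x + b)) (at x)" if "smooth g" for g k x
  proof -
    have "((\<lambda>x. g (a * x + b)) has_real_derivative deriv g (a * x + b) * a) (at x)"
      by (rule DERIV_chain2[where f=g, OF smooth_has_derivative[OF that]]) (auto intro!: derivative_eq_intros)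
    hence "((\<lambda>x. k * g (a * x + b)) has_real_derivative k * (deriv g (a * x + b) * a)) (at x)"
      by (rule DERIV_cmult)
    thus ?thesis by (simp add: mult_ac)
  qed
  show "h differentiable (at x)" if "h \<in> {\<lambda>x. k * g (a * x + b) | k g. smooth g}" for h x
    using that d by (auto simp: real_differentiable_def intro: exI)
  show "deriv h \<in> {\<lambda>x. k * g (a * x + b) | k g. smooth g}" if h': "h \<in> {\<lambda>x. k * g (a * x + b) | k g. smooth g}" for h
  proof -
    obtain k g where h: "h = (\<lambda>x. k * g (a * x + b))" and g: "smooth g" using h' by auto
    have "deriv h = (\<lambda>x. (k * a) * deriv g (a * x + b))"
      unfolding h by (intro ext DERIV_imp_deriv d g)
    thus ?thesis using smooth_deriv[OF g] by blast
  qed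
  show "(\<lambda>x. f (a * x + b)) \<in> {\<lambda>x. k * g (a * x + b) | k g. smooth g}"
    using assms by (auto intro!: exI[of _ 1] exI[of _ f])
qed

definition flat_exp :: "real \<Rightarrow> real" where
  "flat_exp x = (if 0 < x then exp (- 1 / x) else 0)"

lemma poly_exp_tendsto_0: "((\<lambda>y::real. poly p y * exp (- y)) \<longlongrightarrow> 0) at_top"
proof -
  have "((\<lambda>y::real. \<Sum>i\<le>degree p. coeff p i * (y ^ i / exp y)) \<longlongrightarrow> (\<Sum>i\<le>degree p. coeff p i * 0)) at_top"
    by (intro tendsto_sum tendsto_mult tendsto_const tendsto_power_div_exp_0)
  thus ?thesis by (simp add: poly_altdef sum_divide_distrib exp_minus divide_inverse sum_distrib_right mult.assoc)
qed

lemma smooth_flat_exp: "smooth flat_exp"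
proof -
  define E where "E p x = (if 0 < x then poly p (1/x) * exp (- 1 / x) else 0)" for p :: "real poly" and x :: real
  \<comment> \<open>In the variable y = 1/x, differentiating p(y) exp(-y) with respect to x
    multiplies by -y^2 and gives y^2 (p - p') exp(-y). Hence the family \<open>E p\<close> over all
    polynomials p is closed under \<open>deriv\<close>.\<close>
  define D where "D p = monom 1 2 * (p - pderiv p)" for p :: "real poly"
  have d: "(E p has_real_derivative E (D p) x) (at x)" for p x
  proof -
    consider "x < 0" | "x = 0" | "x > 0" by linarith
    thus ?thesis
    proof cases
      case 1
      have "((\<lambda>x. 0) has_real_derivative E (D p) x) (at x)"
        using 1 by (simp add: E_def)
      thus ?thesis
        by (rule has_field_derivative_transform_within_open[where S="{..<0}"]) (use 1 in \<open>auto simp: E_def\<close>)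
    next
      case 3
      have "((\<lambda>x. poly p (1/x) * exp (- 1 / x)) has_real_derivative E (D p) x) (at x)"
        using 3 by (auto intro!: derivative_eq_intros simp: E_def D_def poly_monom field_simps power2_eq_square)
      thus ?thesis
        by (rule has_field_derivative_transform_within_open[where S="{0<..}"]) (use 3 in \<open>auto simp: E_def\<close>)
    next
      case 2
      have "((\<lambda>h. E p h / h) \<longlongrightarrow> 0) (at_left 0)"
        by (rule tendsto_eventually) (auto simp: E_def eventually_at_filter)
      moreover have "((\<lambda>h. E p h / h) \<longlongrightarrow> 0) (at_right 0)"
      proof -
        \<comment> \<open>Dividing by h raises the degree in 1/h by one, so the difference quotient
          from the right is again a polynomial times a decaying exponential in 1/h.\<close>
        have "((\<lambda>h. poly (monom 1 1 * p) (inverse h) * exp (- inverse h)) \<longlongrightarrow> 0) (at_right (0::real))"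
          by (rule filterlim_compose[OF poly_exp_tendsto_0 filterlim_inverse_at_top_right])
        moreover have "eventually (\<lambda>h. poly (monom 1 1 * p) (inverse h) * exp (- inverse h) = E p h / h) (at_right (0::real))"
          by (auto simp: E_def eventually_at_filter poly_monom field_simps)
        ultimately show ?thesis by (rule Lim_transform_eventually)
      qed
      ultimately have "((\<lambda>h. E p h / h) \<longlongrightarrow> 0) (at 0)"
        by (simp add: filterlim_at_split)
      moreover have "E p 0 = 0" "E (D p) 0 = 0" by (auto simp: E_def)
      ultimately show ?thesis using 2 by (simp add: DERIV_def)
    qed
  qed
  have "smooth (E 1)"
  proof (rule smooth_coinduct[of "range E"])
    show "f differentiable (at x)" if "f \<in> range E" for f x
      using that d by (auto simp: real_differentiable_def intro: exI)
    show "deriv f \<in> range E" if f': "f \<in> range E" for f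
    proof -
      obtain p where f: "f = E p" using f' by auto
      have "deriv f = E (D p)" unfolding f by (intro ext DERIV_imp_deriv d)
      thus ?thesis by simp
    qed
  qed simp
  moreover have "E 1 = flat_exp" by (auto simp: E_def flat_exp_def)
  ultimately show ?thesis by simp
qed

lemma test_functionsI:
  assumes "smooth \<phi>" "0 < a" "\<And>x. x \<notin> {a..b} \<Longrightarrow> \<phi> x = 0"
  shows "\<phi> \<in> test_functions"
proof -
  have "closure {x. \<phi> x \<noteq> 0} \<subseteq> {a..b}"
    by (rule closure_minimal) (use assms(3) in \<open>blast, simp\<close>)
  moreover from this have "compact (closure {x. \<phi> x \<noteq> 0})"
    by (metis compact_Icc closed_closure compact_Int_closed inf.absorb_iff2)
  ultimately show ?thesis using assms(1,2) by (auto simp: test_functions_def smooth_def)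
qed

lemma test_functionsE:
  assumes "\<phi> \<in> test_functions"
  obtains a b where "smooth \<phi>" "0 < a" "a < b" "\<And>x. x \<notin> {a..b} \<Longrightarrow> \<phi> x = 0"
proof -
  let ?K = "closure {x. \<phi> x \<noteq> 0}"
  have s: "smooth \<phi>" and K: "compact ?K" "?K \<subseteq> {0<..}"
    using assms by (auto simp: test_functions_def smooth_def)
  show ?thesis
  proof (cases "?K = {}")
    case True
    thus ?thesis using that[of 1 2] s by auto
  next
    case False
    obtain a where a: "a \<in> ?K" "\<And>x. x \<in> ?K \<Longrightarrow> a \<le> x" using compact_attains_inf[OF K(1) False] by blast
    obtain b where b: "b \<in> ?K" "\<And>x. x \<in> ?K \<Longrightarrow> x \<le> b" using compact_attains_sup[OF K(1) False] by blast
    \<comment> \<open>The right end is enlarged by 1 because only \<open>a \<le> b\<close> is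
      known.\<close>
    have "0 < a" "a < b + 1" using a(1) K(2) b(2)[OF a(1)] by auto
    moreover have "\<phi> x = 0" if "x \<notin> {a..b+1}" for x
    proof (rule ccontr)
      assume "\<phi> x \<noteq> 0"
      hence "x \<in> {x. \<phi> x \<noteq> 0}" by simp
      hence x: "x \<in> ?K" using closure_subset by (rule rev_subsetD)
      show False using a(2)[OF x] b(2)[OF x] that by simp
    qed
    ultimately show ?thesis using s by (intro that)
  qed
qed

lemma test_functions_deriv:
  assumes "\<phi> \<in> test_functions" shows "deriv \<phi> \<in> test_functions"
proof -
  obtain a b where ab: "smooth \<phi>" "0 < a" "a < b" "\<And>x. x \<notin> {a..b} \<Longrightarrow> \<phi> x = 0"
    by (rule test_functionsE[OF assms]) blast
  show ?thesis
  proof (rule test_functionsI[OF smooth_deriv[OF ab(1)] ab(2)])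
    fix x assume x: "x \<notin> {a..b}"
    have "((\<lambda>x. 0) has_real_derivative 0) (at x)" by simp
    hence "(\<phi> has_real_derivative 0) (at x)"
      by (rule has_field_derivative_transform_within_open[where S="- {a..b}"]) (use x ab(4) in auto)
    thus "deriv \<phi> x = 0" by (rule DERIV_imp_deriv)
  qed
qed

lemma test_mult_integrable:
  fixes w :: "real \<Rightarrow> complex"
  assumes "\<phi> \<in> test_functions" "\<And>r. set_integrable half_line {..r} w"
  shows "integrable half_line (\<lambda>r. \<phi> r *\<^sub>R w r)"
proof -
  obtain a b where ab: "smooth \<phi>" "0 < a" "a < b" "\<And>x. x \<notin> {a..b} \<Longrightarrow> \<phi> x = 0"
    by (rule test_functionsE[OF assms(1)]) blast
  have "set_integrable half_line {..b} (\<lambda>r. w r * of_real (\<phi> r))"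
    by (intro set_integrable_mult_continuous assms continuous_intros smooth_continuous ab)
  also have "set_integrable half_line {..b} (\<lambda>r. w r * of_real (\<phi> r)) \<longleftrightarrow> integrable half_line (\<lambda>r. \<phi> r *\<^sub>R w r)"
    unfolding set_integrable_def
    by (intro Bochner_Integration.integrable_cong) (auto simp: indicator_def scaleR_conv_of_real ab(4))
  finally show ?thesis .
qed

lemma ac_deriv_smooth: "smooth \<phi> \<Longrightarrow> ac_deriv (\<lambda>r. complex_of_real (\<phi> r)) (\<lambda>r. complex_of_real (deriv \<phi> r))"
  by (rule ac_deriv_C1)
     (auto intro!: has_vector_derivative_of_real continuous_intros smooth_continuous smooth_deriv
        dest: smooth_has_derivative simp flip: has_real_derivative_iff_has_vector_derivative)

lemma test_integral_by_parts:
  assumes \<phi>: "\<phi> \<in> test_functions" and U: "ac_deriv U u"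
  shows "(LINT r|half_line. deriv \<phi> r *\<^sub>R U r) = - (LINT r|half_line. \<phi> r *\<^sub>R u r)"
proof -
  obtain a b where ab: "smooth \<phi>" "0 < a" "a < b" "\<And>x. x \<notin> {a..b} \<Longrightarrow> \<phi> x = 0"
    by (rule test_functionsE[OF \<phi>]) blast
  have li: "set_integrable half_line {..r} U" for r
    using ac_deriv_integrable[OF ac_deriv_integral[of U 0]] 
    using absolutely_integrable_continuous_real[OF continuous_on_subset[OF ac_deriv_continuous[OF U], of "{0..r}"]]
    by (auto simp: half_line_set_integral_eq(1))
  have p: "ac_deriv (\<lambda>r. of_real (\<phi> r) * U r) (\<lambda>r. of_real (deriv \<phi> r) * U r + of_real (\<phi> r) * u r)"
    by (intro ac_deriv_mult ac_deriv_smooth ab U)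
  have i: "integrable half_line (\<lambda>r. \<phi> r *\<^sub>R U r)" "integrable half_line (\<lambda>r. deriv \<phi> r *\<^sub>R U r)"
     "integrable half_line (\<lambda>r. \<phi> r *\<^sub>R u r)"
    by (intro test_mult_integrable test_functions_deriv \<phi> li ac_deriv_integrable[OF U])+
  have "(LINT r|half_line. of_real (deriv \<phi> r) * U r + of_real (\<phi> r) * u r) = - (of_real (\<phi> 0) * U 0)"
    by (rule ac_deriv_integral_half_line[OF p]) (use i in \<open>auto simp: scaleR_conv_of_real\<close>)
  also have "\<phi> 0 = 0" using ab by auto
  finally have "(LINT r|half_line. deriv \<phi> r *\<^sub>R U r + \<phi> r *\<^sub>R u r) = 0" by (simp add: scaleR_conv_of_real)
  thus ?thesis using i by (simp add: eq_neg_iff_add_eq_0)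
qed

section \<open>Weak derivatives and the Dirichlet domain\<close>

text \<open>The rays {..r} form an intersection-stable generator of the Borel sets, so by a Dynkin
  argument the integral vanishes over all Borel sets; the condition on the total integral handles
  complements. Lebesgue sets are Borel up to null sets, and uniqueness of densities
  finishes.\<close>

lemma AE_zero_if_atMost_integrals_zero:
  fixes g :: "real \<Rightarrow> complex"
  assumes g: "integrable lebesgue g" and r: "\<And>r. (LINT t:{..r}|lebesgue. g t) = 0"
    and U: "(LINT t|lebesgue. g t) = 0"
  shows "AE t in lebesgue. g t = 0"
proof -
  have si: "set_integrable lebesgue A g" if "A \<in> sets lebesgue" for A
    using g that unfolding set_integrable_def by (rule integrable_mult_indicator[rotated])
  have borel: "(LINT t:A|lebesgue. g t) = 0" if "A \<in> sets borel" for A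
  proof -
    have IS: "Int_stable (range (\<lambda>a::real. {..a}))" by (auto simp: Int_stable_def)
    have Pow: "range (\<lambda>a::real. {..a}) \<subseteq> Pow UNIV" by simp
    have "A \<in> sigma_sets UNIV (range (\<lambda>a::real. {..a}))"
      using that by (simp add: borel_eq_atMost)
    from IS Pow this show ?thesis
    proof (induction rule: sigma_sets_induct_disjoint)
      case (basic A) thus ?case using r by auto
    next
      case empty thus ?case by (simp add: set_lebesgue_integral_def)
    next
      case (compl A)
      have "A \<in> sets (borel :: real measure)" using compl(1) by (simp add: borel_eq_atMost)
      hence A: "A \<in> sets lebesgue" by simp
      have "(LINT t:(UNIV - A) \<union> A|lebesgue. g t) = (LINT t:UNIV - A|lebesgue. g t) + (LINT t:A|lebesgue. g t)"
        by (rule set_integral_Un) (use sets.compl_sets[OF A] in \<open>auto intro: si A\<close>)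
      thus ?case using compl U by (simp add: set_lebesgue_integral_def)
    next
      case (union A)
      have "A i \<in> sets (borel :: real measure)" for i using union(2) by (auto simp: borel_eq_atMost)
      hence A: "A i \<in> sets lebesgue" for i by simp
      have "(LINT t:(\<Union>i. A i)|lebesgue. g t) = (\<Sum>i. (LINT t:A i|lebesgue. g t))"
        by (rule lebesgue_integral_countable_add) (use A union(1) si in \<open>auto simp: disjoint_family_on_def\<close>)
      thus ?case using union by simp
    qed
  qed
  have "AE t in lebesgue. g t = (\<lambda>_. 0) t"
  proof (rule sigma_finite_measure.density_unique_banach[OF sigma_finite_lebesgue g])
    fix A assume A: "A \<in> sets (lebesgue :: real measure)"
    then obtain S N N' where S: "A = S \<union> N" "N \<subseteq> N'" "N' \<in> null_sets lborel" "S \<in> sets lborel"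
      by (rule sets_completionE)
    have "AE t in lebesgue. t \<notin> N'" by (intro AE_completion AE_not_in S)
    hence "(LINT t:A|lebesgue. g t) = (LINT t:S|lebesgue. g t)"
      unfolding set_lebesgue_integral_def
      by (intro integral_cong_AE) (use A S g si[OF A] si[of S] in \<open>auto simp: set_integrable_def intro: borel_measurable_integrable elim!: eventually_mono simp: indicator_def\<close>)
    thus "set_lebesgue_integral lebesgue A g = set_lebesgue_integral lebesgue A (\<lambda>_. 0)"
      using borel[of S] S by (simp add: set_lebesgue_integral_def)
  qed simp
  thus ?thesis by simp
qed

text \<open>Here h is only locally integrable, so the previous lemma is applied to its cut-offs at
  the natural numbers.\<close>

lemma AE_half_line_zero_if_atMost_integrals_zero:
  fixes h :: "real \<Rightarrow> complex"
  assumes i: "\<And>r. set_integrable half_line {..r} h" and z: "\<And>r. 0 \<le> r \<Longrightarrow> (LINT t:{..r}|half_line. h t) = 0"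
  shows "AE t in half_line. h t = 0"
proof -
  have "AE t in half_line. t \<le> real n \<longrightarrow> h t = 0" for n
  proof -
    define g where "g t = indicator {0<..} t *\<^sub>R (indicator {..real n} t *\<^sub>R h t)" for t
    have g: "integrable lebesgue g"
      using i[of n] unfolding set_integrable_def g_def by (subst (asm) integrable_restrict_space) auto
    have eq: "(LINT t:{..r}|lebesgue. g t) = (LINT t:{..min r n}|half_line. h t)" for r
    proof -
      have "(LINT t:{..min r n}|half_line. h t) = (LINT t|lebesgue. indicator {0<..} t *\<^sub>R (indicator {..min r n} t *\<^sub>R h t))"
        unfolding set_lebesgue_integral_def by (subst integral_restrict_space) auto
      also have "\<dots> = (LINT t:{..r}|lebesgue. g t)"
        unfolding set_lebesgue_integral_def g_def
        by (intro Bochner_Integration.integral_cong) (auto simp: indicator_def)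
      finally show ?thesis ..
    qed
    have "AE t in lebesgue. g t = 0"
    proof (rule AE_zero_if_atMost_integrals_zero[OF g])
      show "(LINT t:{..r}|lebesgue. g t) = 0" for r
        unfolding eq by (cases "0 \<le> r") (auto simp: set_integral_half_line_zero min_def intro!: z)
      have "(LINT t|lebesgue. g t) = (LINT t:{..real n}|lebesgue. g t)"
        unfolding set_lebesgue_integral_def g_def
        by (intro Bochner_Integration.integral_cong) (auto simp: indicator_def)
      also have "\<dots> = 0" unfolding eq by (auto intro!: z)
      finally show "(LINT t|lebesgue. g t) = 0" .
    qed
    thus ?thesis unfolding AE_half_line_iff by eventually_elim (auto simp: g_def)
  qed
  hence "AE t in half_line. \<forall>n. t \<le> real n \<longrightarrow> h t = 0" unfolding AE_all_countable by blast
  thus ?thesis by eventually_elim (use real_arch_simple in blast)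
qed

lemma flat_exp_bounds: "0 \<le> flat_exp x" "flat_exp x \<le> 1"
  by (auto simp: flat_exp_def)

lemma flat_exp_scaled_tendsto: "(\<lambda>n. flat_exp (real (Suc n) * x)) \<longlonglongrightarrow> (if 0 < x then 1 else 0)"
proof (cases "0 < x")
  case True
  have "filterlim (\<lambda>n. real (Suc n)) at_top sequentially"
    by (rule filterlim_compose[OF filterlim_real_sequentially filterlim_Suc])
  hence "(\<lambda>n. - (1 / x) / real (Suc n)) \<longlonglongrightarrow> 0"
    by (rule real_tendsto_divide_at_top[OF tendsto_const])
  hence "(\<lambda>n. exp (- (1 / x) / real (Suc n))) \<longlonglongrightarrow> exp 0" by (rule tendsto_exp)
  moreover have "flat_exp (real (Suc n) * x) = exp (- (1 / x) / real (Suc n))" for n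
    using True mult_pos_pos[of "real (Suc n)" x] by (simp add: flat_exp_def del: of_nat_Suc)
  ultimately show ?thesis using True by simp
next
  case False
  hence "flat_exp (real (Suc n) * x) = 0" for n
    unfolding flat_exp_def by (simp add: zero_less_mult_iff)
  thus ?thesis using False by simp
qed

text \<open>Supported in [a, b] for every n, with values in [0, 1], and converging pointwise to the
  indicator of the open interval (a, b): a dominated approximation by test functions.\<close>

definition bump :: "nat \<Rightarrow> real \<Rightarrow> real \<Rightarrow> real \<Rightarrow> real" where
  "bump n a b x = flat_exp (real (Suc n) * (x - a)) * flat_exp (real (Suc n) * (b - x))"

lemma bump_test_function:
  assumes "0 < a" shows "bump n a b \<in> test_functions"
proof (rule test_functionsI[OF _ assms])
  have "bump n a b = (\<lambda>x. flat_exp (real (Suc n) * x + - real (Suc n) * a) * flat_exp (- real (Suc n) * x + real (Suc n) * b))"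
    by (intro ext) (simp add: bump_def algebra_simps)
  moreover have "smooth \<dots>" by (rule smooth_mult; rule smooth_affine[OF smooth_flat_exp])
  ultimately show "smooth (bump n a b)" by (simp only:)
  fix x assume "x \<notin> {a..b}"
  thus "bump n a b x = 0" by (auto simp: bump_def flat_exp_def zero_less_mult_iff)
qed

lemma bump_tendsto: "(\<lambda>n. bump n a b x) \<longlonglongrightarrow> indicator {a<..<b} x"
proof -
  have "(\<lambda>n. bump n a b x) \<longlonglongrightarrow> (if 0 < x - a then 1 else 0) * (if 0 < b - x then 1 else 0)"
    unfolding bump_def by (intro tendsto_mult flat_exp_scaled_tendsto)
  also have "(if 0 < x - a then 1 else 0) * (if 0 < b - x then 1 else 0) = (indicator {a<..<b} x :: real)"
    by (auto simp: indicator_def)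
  finally show ?thesis .
qed

text \<open>Testing with bumps that converge to the indicator of (a, b) shows that the primitive H
  of h takes equal values at all positive a and b. Test functions do not see the point 0, where
  constancy follows by continuity of H. Then all integrals of h over (0, r] vanish.\<close>

lemma fundamental_lemma:
  fixes h :: "real \<Rightarrow> complex"
  assumes i: "\<And>r. set_integrable half_line {..r} h"
    and z: "\<And>\<phi>. \<phi> \<in> test_functions \<Longrightarrow> (LINT r|half_line. \<phi> r *\<^sub>R h r) = 0"
  shows "AE r in half_line. h r = 0"
proof (rule AE_half_line_zero_if_atMost_integrals_zero[OF i])
  fix r :: real assume r: "0 \<le> r"
  define H where "H r = 0 + (LINT t:{..r}|half_line. h t)" for r
  have H: "ac_deriv H h" unfolding H_def by (rule ac_deriv_integral) (rule i)
  have eq: "H b = H a" if "0 < a" "a < b" for a b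
  proof -
    have int: "integrable half_line (\<lambda>t. indicator {..b} t *\<^sub>R h t)"
      using i[of b] by (simp add: set_integrable_def)
    have lim: "(\<lambda>n. LINT t|half_line. bump n a b t *\<^sub>R h t) \<longlonglongrightarrow> (LINT t|half_line. indicator {a<..<b} t *\<^sub>R (indicator {..b} t *\<^sub>R h t))"
    proof (rule integral_dominated_convergence[where w="\<lambda>t. norm (indicator {..b} t *\<^sub>R h t)"])
      show "(\<lambda>t. indicator {a<..<b} t *\<^sub>R (indicator {..b} t *\<^sub>R h t)) \<in> borel_measurable half_line"
        by (rule borel_measurable_scaleR[OF borel_measurable_half_lineI borel_measurable_integrable[OF int]]) simp
      show "(\<lambda>t. bump n a b t *\<^sub>R h t) \<in> borel_measurable half_line" for n
        by (intro borel_measurable_integrable test_mult_integrable bump_test_function that i)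
      show "integrable half_line (\<lambda>t. norm (indicator {..b} t *\<^sub>R h t))" using int by (rule integrable_norm)
      have "(\<lambda>n. bump n a b t *\<^sub>R h t) \<longlonglongrightarrow> indicator {a<..<b} t *\<^sub>R h t" for t
        by (intro tendsto_intros bump_tendsto)
      moreover have "indicator {a<..<b} t *\<^sub>R (indicator {..b} t *\<^sub>R h t) = indicator {a<..<b} t *\<^sub>R h t" for t
        by (auto simp: indicator_def)
      ultimately show "AE t in half_line. (\<lambda>n. bump n a b t *\<^sub>R h t) \<longlonglongrightarrow> indicator {a<..<b} t *\<^sub>R (indicator {..b} t *\<^sub>R h t)"
        by (intro AE_I2) metis
      show "AE t in half_line. norm (bump n a b t *\<^sub>R h t) \<le> norm (indicator {..b} t *\<^sub>R h t)" for n
      proof (rule AE_I2)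
        fix t
        have "\<bar>bump n a b t\<bar> \<le> indicator {..b} t"
          using flat_exp_bounds by (auto simp: bump_def abs_mult indicator_def mult_le_one flat_exp_def zero_less_mult_iff)
        thus "norm (bump n a b t *\<^sub>R h t) \<le> norm (indicator {..b} t *\<^sub>R h t)"
          by (simp add: mult_right_mono)
      qed
    qed
    have "(LINT t|half_line. bump n a b t *\<^sub>R h t) = 0" for n by (rule z) (rule bump_test_function[OF that(1)])
    with lim have "(LINT t|half_line. indicator {a<..<b} t *\<^sub>R (indicator {..b} t *\<^sub>R h t)) = 0"
      by (simp add: LIMSEQ_const_iff)
    also have "(LINT t|half_line. indicator {a<..<b} t *\<^sub>R (indicator {..b} t *\<^sub>R h t))
       = (LINT t|half_line. indicator {..b} t *\<^sub>R h t - indicator {..a} t *\<^sub>R h t)"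
    proof (rule integral_cong_AE)
      show "AE t in half_line. indicator {a<..<b} t *\<^sub>R (indicator {..b} t *\<^sub>R h t) = indicator {..b} t *\<^sub>R h t - indicator {..a} t *\<^sub>R h t"
        using AE_half_line_neq[of b] by eventually_elim (use that in \<open>auto simp: indicator_def\<close>)
      show "(\<lambda>t. indicator {a<..<b} t *\<^sub>R (indicator {..b} t *\<^sub>R h t)) \<in> borel_measurable half_line"
        by (rule borel_measurable_scaleR[OF borel_measurable_half_lineI borel_measurable_integrable[OF int]]) simp
      show "(\<lambda>t. indicator {..b} t *\<^sub>R h t - indicator {..a} t *\<^sub>R h t) \<in> borel_measurable half_line"
        using i[of a] int by (intro borel_measurable_diff borel_measurable_integrable) (simp_all add: set_integrable_def)
    qed
    also have "\<dots> = H b - H a"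
      using i[of a] i[of b] by (simp add: H_def set_integrable_def set_lebesgue_integral_def)
    finally show ?thesis by simp
  qed
  have "H 0 = H 1"
  proof (rule continuous_constant_on_closure[of "{0<..}" H])
    show "continuous_on (closure {0<..}) H" using ac_deriv_continuous[OF H] by simp
    show "H x = H 1" if "x \<in> {0<..}" for x using eq[of x 1] eq[of 1 x] that by (cases x "1::real" rule: linorder_cases) auto
  qed simp
  moreover have "H r = H 1" if "r \<noteq> 0" using eq[of r 1] eq[of 1 r] that r by (cases r "1::real" rule: linorder_cases) auto
  ultimately have "H r = H 0" by (cases "r = 0") auto
  thus "(LINT t:{..r}|half_line. h t) = 0" by (simp add: H_def set_integral_half_line_zero)
qed

lemma test_integrable:
  assumes "\<phi> \<in> test_functions"
  shows "integrable half_line \<phi>"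
proof -
  have "set_integrable half_line {..r} (\<lambda>_. 1 :: complex)" for r
    using absolutely_integrable_continuous_real[OF continuous_on_const] by (simp add: half_line_set_integral_eq(1))
  from test_mult_integrable[OF assms this] have "integrable half_line (\<lambda>r. complex_of_real (\<phi> r))"
    by (simp add: scaleR_conv_of_real)
  from integrable_bounded_linear[OF bounded_linear_Re this] show ?thesis by simp
qed

text \<open>The primitive from the left vanishes before the support of g; to the right of the
  support it equals the total integral of g, so the mean zero condition is what keeps its support
  compact.\<close>

lemma test_antiderivative:
  assumes g: "g \<in> test_functions" and z: "(LINT r|half_line. g r) = 0"
  obtains \<eta> where "\<eta> \<in> test_functions" "deriv \<eta> = g"
proof -
  obtain a b where ab: "smooth g" "0 < a" "a < b" "\<And>x. x \<notin> {a..b} \<Longrightarrow> g x = 0"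
    by (rule test_functionsE[OF g]) blast
  define \<eta> where "\<eta> x = integral {0..x} g" for x
  have int: "g integrable_on {0..x}" for x
    by (intro integrable_continuous_real smooth_continuous ab)
  have lt: "\<eta> x = 0" if "x < a" for x
  proof -
    have "integral {0..x} g = integral {0..x} (\<lambda>_. 0)"
      by (rule Henstock_Kurzweil_Integration.integral_cong) (use that ab(4) in auto)
    thus ?thesis by (simp add: \<eta>_def)
  qed
  have gt: "\<eta> x = 0" if "b < x" for x
  proof -
    have "(LINT t:{..x}|half_line. g t) = (LINT t|half_line. g t)"
      unfolding set_lebesgue_integral_def
      by (rule Bochner_Integration.integral_cong) (use that ab(4) in \<open>auto simp: indicator_def\<close>)
    moreover have "(LINT t:{..x}|half_line. g t) = integral {0..x} g"
      using half_line_set_integral_eq absolutely_integrable_continuous_real[OF smooth_continuous[OF ab(1)]] by blast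
    ultimately show ?thesis using z by (simp add: \<eta>_def)
  qed
  have d: "(\<eta> has_real_derivative g x) (at x)" for x
  proof (cases "x < a")
    case True
    have "((\<lambda>_. 0) has_real_derivative g x) (at x)" using True ab(4)[of x] by simp
    thus ?thesis
      by (rule has_field_derivative_transform_within_open[where S="{..<a}"]) (use True lt in auto)
  next
    case False
    hence "(\<eta> has_real_derivative g x) (at x within {0..x+1})"
      unfolding \<eta>_def using ab by (intro integral_has_real_derivative smooth_continuous) auto
    moreover have "at x within {0..x+1} = at x"
      using False ab(2) by (intro at_within_interior) auto
    ultimately show ?thesis by simp
  qed
  have "\<eta> \<in> test_functions"
    by (rule test_functionsI[OF smooth_antideriv[OF d ab(1)] ab(2), of b]) (use lt gt in force)
  moreover have "deriv \<eta> = g" using d by (auto intro: DERIV_imp_deriv)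
  ultimately show ?thesis by (rule that)
qed

lemma test_functions_lincomb:
  assumes "\<phi> \<in> test_functions" "\<psi> \<in> test_functions"
  shows "(\<lambda>x. \<phi> x + c * \<psi> x) \<in> test_functions"
proof -
  obtain a b where ab: "smooth \<phi>" "0 < a" "a < b" "\<And>x. x \<notin> {a..b} \<Longrightarrow> \<phi> x = 0"
    by (rule test_functionsE[OF assms(1)]) blast
  obtain a' b' where ab': "smooth \<psi>" "0 < a'" "a' < b'" "\<And>x. x \<notin> {a'..b'} \<Longrightarrow> \<psi> x = 0"
    by (rule test_functionsE[OF assms(2)]) blast
  show ?thesis
  proof (rule test_functionsI[of _ "min a a'" "max b b'"])
    show "smooth (\<lambda>x. \<phi> x + c * \<psi> x)" by (intro smooth_add smooth_mult smooth_const ab ab')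
    show "0 < min a a'" using ab ab' by simp
    show "\<phi> x + c * \<psi> x = 0" if "x \<notin> {min a a'..max b b'}" for x
    proof -
      have "x \<notin> {a..b}" "x \<notin> {a'..b'}" using that by auto
      thus ?thesis using ab(4) ab'(4) by simp
    qed
  qed
qed

lemma bump_integral_pos: "0 < (LINT r|half_line. bump 0 1 2 r)"
proof -
  have i: "integrable half_line (bump 0 1 2)" by (intro test_integrable bump_test_function) simp
  have nn: "0 \<le> bump 0 1 2 r" for r by (simp add: bump_def flat_exp_bounds)
  have "(LINT r|half_line. bump 0 1 2 r) \<noteq> 0"
  proof
    assume "(LINT r|half_line. bump 0 1 2 r) = 0"
    hence "AE r in half_line. bump 0 1 2 r = 0"
      using integral_nonneg_eq_0_iff_AE[OF i] nn by simp
    hence "AE r in lebesgue. r \<in> - {1<..<2::real}"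
      unfolding AE_half_line_iff by eventually_elim (auto simp: bump_def flat_exp_def)
    \<comment> \<open>A closed set that contains almost every point contains every point; the
      complement of (1, 2) would then contain 3/2.\<close>
    hence "(3/2::real) \<in> - {1<..<2::real}" by (rule mem_closed_if_AE_lebesgue[rotated]) (simp add: closed_def)
    thus False by simp
  qed
  moreover have "0 \<le> (LINT r|half_line. bump 0 1 2 r)" by (rule Bochner_Integration.integral_nonneg) (rule nn)
  ultimately show ?thesis by simp
qed

text \<open>Subtracting a multiple of one fixed bump \<psi> gives any test function mean zero and
  hence makes it a derivative of a test function. The constant c is the mean of h with respect to
  the normalized \<psi>, and h - c falls to \<open>fundamental_lemma\<close>.\<close>

lemma du_Bois_Reymond:
  fixes h :: "real \<Rightarrow> complex"
  assumes i: "\<And>r. set_integrable half_line {..r} h"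
    and z: "\<And>\<phi>. \<phi> \<in> test_functions \<Longrightarrow> (LINT r|half_line. deriv \<phi> r *\<^sub>R h r) = 0"
  obtains c where "AE r in half_line. h r = c"
proof -
  define \<psi> where "\<psi> = bump 0 1 2"
  define k where "k = (LINT r|half_line. \<psi> r)"
  have k: "k > 0" unfolding k_def \<psi>_def by (rule bump_integral_pos)
  have \<psi>: "\<psi> \<in> test_functions" unfolding \<psi>_def by (rule bump_test_function) simp
  define c where "c = (LINT r|half_line. \<psi> r *\<^sub>R h r) / of_real k"
  have ci: "set_integrable half_line {..r} (\<lambda>_. c)" for r
    using absolutely_integrable_continuous_real[OF continuous_on_const] by (simp add: half_line_set_integral_eq(1))
  have "AE r in half_line. h r - c = 0"
  proof (rule fundamental_lemma)
    show "set_integrable half_line {..r} (\<lambda>r. h r - c)" for r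
      by (rule set_integral_diff(1)[OF i ci])
    fix \<phi> assume \<phi>: "\<phi> \<in> test_functions"
    define m where "m = (LINT r|half_line. \<phi> r)"
    have i\<phi>: "integrable half_line (\<lambda>r. \<phi> r *\<^sub>R h r)" "integrable half_line (\<lambda>r. \<psi> r *\<^sub>R h r)"
      by (intro test_mult_integrable \<phi> \<psi> i)+
    \<comment> \<open>The multiple of \<psi> is chosen so that g has integral 0 and is therefore
      \<eta>' for a test function \<eta>.\<close>
    define g where "g = (\<lambda>x. \<phi> x + (- m / k) * \<psi> x)"
    have g: "g \<in> test_functions" unfolding g_def by (rule test_functions_lincomb[OF \<phi> \<psi>])
    have "(LINT r|half_line. g r) = m + (- m / k) * k"
      unfolding g_def m_def k_def using test_integrable[OF \<phi>] test_integrable[OF \<psi>] by simp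
    hence "(LINT r|half_line. g r) = 0" using k by simp
    then obtain \<eta> where "\<eta> \<in> test_functions" "deriv \<eta> = g" using test_antiderivative[OF g] by blast
    hence "0 = (LINT r|half_line. g r *\<^sub>R h r)" using z by metis
    also have "\<dots> = (LINT r|half_line. \<phi> r *\<^sub>R h r + (- m / k) *\<^sub>R (\<psi> r *\<^sub>R h r))"
      by (simp add: g_def scaleR_left_diff_distrib)
    also have "\<dots> = (LINT r|half_line. \<phi> r *\<^sub>R h r) + (- m / k) *\<^sub>R (LINT r|half_line. \<psi> r *\<^sub>R h r)"
      using i\<phi> by (simp del: scaleR_scaleR)
    also have "(- m / k) *\<^sub>R (LINT r|half_line. \<psi> r *\<^sub>R h r) = - (m *\<^sub>R c)"
      using k by (simp add: c_def scaleR_conv_of_real field_simps)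
    also have "m *\<^sub>R c = (LINT r|half_line. \<phi> r *\<^sub>R c)" unfolding m_def
      using test_integrable[OF \<phi>] by simp
    finally have "(LINT r|half_line. \<phi> r *\<^sub>R h r) - (LINT r|half_line. \<phi> r *\<^sub>R c) = 0" by simp
    thus "(LINT r|half_line. \<phi> r *\<^sub>R (h r - c)) = 0"
      using i\<phi>(1) test_mult_integrable[OF \<phi> ci] by (simp add: scaleR_diff_right)
  qed
  thus ?thesis by (intro that[of c]) simp
qed

section \<open>Weak derivatives and absolutely continuous representatives\<close>

lemma L2_set_integrable:
  assumes "f \<in> L2" shows "set_integrable half_line {..r} f"
proof -
  have "integrable half_line (\<lambda>t. indicator {0<..r} t :: complex)"
  proof -
    have "set_integrable half_line {..r} (\<lambda>_. 1 :: complex)"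
      using absolutely_integrable_continuous_real[OF continuous_on_const] by (simp add: half_line_set_integral_eq(1))
    also have "?this \<longleftrightarrow> ?thesis" unfolding set_integrable_def
      by (intro Bochner_Integration.integrable_cong) (auto simp: indicator_def)
    finally show ?thesis .
  qed
  hence "integrable half_line (\<lambda>t. (cmod (indicator {0<..r} t))\<^sup>2)"
    by (subst Bochner_Integration.integrable_cong[OF refl, where g="\<lambda>t. cmod (indicator {0<..r} t)"])
       (auto simp: indicator_def)
  hence "(\<lambda>t. indicator {0<..r} t :: complex) \<in> L2"
    unfolding L2_def using borel_measurable_half_lineI[of "\<lambda>t. indicator {0<..r} t :: complex"] by simp
  from integrable_mult_L2[OF this assms] have "integrable half_line (\<lambda>t. indicator {0<..r} t * f t)" .
  also have "?this \<longleftrightarrow> ?thesis" unfolding set_integrable_def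
    by (intro Bochner_Integration.integrable_cong) (auto simp: indicator_def)
  finally show ?thesis .
qed

lemma ac_deriv_weak_deriv: "ac_deriv U u \<Longrightarrow> has_weak_deriv U u"
  unfolding has_weak_deriv_def using test_integral_by_parts by blast

text \<open>The difference of u and a primitive of v has weak derivative 0, so it is constant by
  \<open>du_Bois_Reymond\<close>; the constant is added to the primitive.\<close>

lemma weak_deriv_ac_deriv:
  assumes u: "u \<in> L2" and v: "v \<in> L2" and w: "has_weak_deriv u v"
  obtains U where "ac_deriv U v" "AE r in half_line. u r = U r"
proof -
  define P where "P r = 0 + (LINT t:{..r}|half_line. v t)" for r
  have P: "ac_deriv P v" unfolding P_def by (rule ac_deriv_integral) (rule L2_set_integrable[OF v])
  have Pi: "set_integrable half_line {..r} P" for r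
    using absolutely_integrable_continuous_real[OF continuous_on_subset[OF ac_deriv_continuous[OF P], of "{0..r}"]]
    by (auto simp: half_line_set_integral_eq(1))
  obtain c where c: "AE r in half_line. u r - P r = c"
  proof (rule du_Bois_Reymond)
    show "set_integrable half_line {..r} (\<lambda>r. u r - P r)" for r
      by (rule set_integral_diff(1)[OF L2_set_integrable[OF u] Pi])
    fix \<phi> assume \<phi>: "\<phi> \<in> test_functions"
    have "(LINT r|half_line. deriv \<phi> r *\<^sub>R u r) = (LINT r|half_line. deriv \<phi> r *\<^sub>R P r)"
      using w test_integral_by_parts[OF \<phi> P] \<phi> by (simp add: has_weak_deriv_def)
    thus "(LINT r|half_line. deriv \<phi> r *\<^sub>R (u r - P r)) = 0"
      using test_mult_integrable[OF test_functions_deriv[OF \<phi>] L2_set_integrable[OF u]]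
        test_mult_integrable[OF test_functions_deriv[OF \<phi>] Pi]
      by (simp add: scaleR_diff_right)
  qed blast
  have "ac_deriv (\<lambda>r. P r + c) (\<lambda>r. v r + 0)" by (rule ac_deriv_add[OF P ac_deriv_const])
  moreover have "AE r in half_line. u r = P r + c" using c by eventually_elim (simp add: algebra_simps)
  ultimately show ?thesis using that by simp
qed

lemma weak_deriv_unique:
  assumes v: "v \<in> L2" "has_weak_deriv u v" and w: "w \<in> L2" "has_weak_deriv u w"
  shows "AE r in half_line. v r = w r"
proof -
  have "AE r in half_line. v r - w r = 0"
  proof (rule fundamental_lemma)
    show "set_integrable half_line {..r} (\<lambda>r. v r - w r)" for r
      by (intro L2_set_integrable L2_diff v w)
    fix \<phi> assume \<phi>: "\<phi> \<in> test_functions"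
    have "(LINT r|half_line. \<phi> r *\<^sub>R v r) = (LINT r|half_line. \<phi> r *\<^sub>R w r)"
      using v(2) w(2) \<phi> unfolding has_weak_deriv_def by fastforce
    thus "(LINT r|half_line. \<phi> r *\<^sub>R (v r - w r)) = 0"
      using test_mult_integrable[OF \<phi> L2_set_integrable[OF v(1)]] test_mult_integrable[OF \<phi> L2_set_integrable[OF w(1)]]
      by (simp add: scaleR_diff_right)
  qed
  thus ?thesis by simp
qed

lemma has_weak_deriv_cong_AE:
  assumes "AE r in half_line. u r = u' r" "u \<in> L2" "u' \<in> L2" "has_weak_deriv u v"
  shows "has_weak_deriv u' v"
  unfolding has_weak_deriv_def
proof
  fix \<phi> assume \<phi>: "\<phi> \<in> test_functions"
  have "(LINT r|half_line. deriv \<phi> r *\<^sub>R u' r) = (LINT r|half_line. deriv \<phi> r *\<^sub>R u r)"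
  proof (rule integral_cong_AE)
    show "AE r in half_line. deriv \<phi> r *\<^sub>R u' r = deriv \<phi> r *\<^sub>R u r" using assms(1) by eventually_elim simp
  qed (intro borel_measurable_integrable test_mult_integrable test_functions_deriv \<phi> L2_set_integrable assms)+
  thus "(LINT r|half_line. deriv \<phi> r *\<^sub>R u' r) = - (LINT r|half_line. \<phi> r *\<^sub>R v r)"
    using assms(4) \<phi> by (simp add: has_weak_deriv_def)
qed

lemma weak_deriv_props:
  assumes "v \<in> L2" "has_weak_deriv u v"
  shows "weak_deriv u \<in> L2" "has_weak_deriv u (weak_deriv u)" "AE r in half_line. weak_deriv u r = v r"
proof -
  have "weak_deriv u \<in> L2 \<and> has_weak_deriv u (weak_deriv u)"
    unfolding weak_deriv_def by (rule someI[of _ v]) (use assms in simp)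
  thus "weak_deriv u \<in> L2" "has_weak_deriv u (weak_deriv u)" by auto
  thus "AE r in half_line. weak_deriv u r = v r" using assms by (intro weak_deriv_unique)
qed

lemma weak_deriv_weak_deriv:
  assumes "v \<in> L2" "has_weak_deriv u v" "w \<in> L2" "has_weak_deriv v w"
  shows "AE r in half_line. weak_deriv (weak_deriv u) r = w r" "weak_deriv (weak_deriv u) \<in> L2"
proof -
  note p = weak_deriv_props[OF assms(1,2)]
  have "AE r in half_line. v r = weak_deriv u r" using p(3) by eventually_elim simp
  hence "has_weak_deriv (weak_deriv u) w"
    by (rule has_weak_deriv_cong_AE) (use p assms in auto)
  thus "AE r in half_line. weak_deriv (weak_deriv u) r = w r" "weak_deriv (weak_deriv u) \<in> L2"
    using weak_deriv_props[OF assms(3)] by auto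
qed

lemma dirichlet_domainE:
  assumes "u \<in> dirichlet_domain"
  obtains U Y W where "AE r in half_line. u r = U r" "ac_deriv U Y" "ac_deriv Y W"
    "U \<in> L2" "Y \<in> L2" "W \<in> L2" "U 0 = 0" "AE r in half_line. weak_deriv (weak_deriv u) r = W r"
    "u \<in> L2" "weak_deriv (weak_deriv u) \<in> L2"
proof -
  obtain v w where u: "u \<in> L2" and v: "v \<in> L2" "has_weak_deriv u v" and w: "w \<in> L2" "has_weak_deriv v w"
    using assms by (auto simp: dirichlet_domain_def H2_def)
  obtain Y where Y: "ac_deriv Y w" "AE r in half_line. v r = Y r"
    using weak_deriv_ac_deriv[OF v(1) w] by blast
  obtain U where U: "ac_deriv U v" "AE r in half_line. u r = U r"
    using weak_deriv_ac_deriv[OF u v] by blast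
  have Ym: "Y \<in> borel_measurable half_line" by (rule ac_deriv_measurable[OF Y(1)])
  have "ac_deriv U Y"
    by (rule ac_deriv_cong_AE[OF U(1)]) (use Y(2) Ym in \<open>auto elim: eventually_mono\<close>)
  moreover have "U \<in> L2"
    by (rule L2_cong_AE[OF u ac_deriv_measurable[OF U(1)]]) (use U(2) in \<open>auto elim: eventually_mono\<close>)
  moreover have "Y \<in> L2"
    by (rule L2_cong_AE[OF v(1) Ym]) (use Y(2) in \<open>auto elim: eventually_mono\<close>)
  moreover have "U 0 = 0"
  proof -
    obtain U0 where U0: "continuous_on {0..} U0" "AE r in half_line. U0 r = u r" "U0 0 = 0"
      using assms by (auto simp: dirichlet_domain_def)
    \<comment> \<open>The boundary condition is given for some continuous representative and has to
      be transferred to U. Even reflection makes the difference continuous on the whole line, so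
      that its zero set is closed and an almost everywhere identity holds at every positive point,
      then at 0 by continuity.\<close>
    define d where "d x = U0 \<bar>x\<bar> - U \<bar>x\<bar>" for x
    have "continuous_on {0..} (\<lambda>r. U0 r - U r)"
      by (intro continuous_intros U0 ac_deriv_continuous[OF U(1)])
    hence "continuous_on UNIV d" unfolding d_def
      by (rule continuous_on_compose2) (auto intro!: continuous_intros)
    have pos: "d x = 0" if "0 < x" for x
    proof -
      have "closed {y. d y = 0}"
        using \<open>continuous_on UNIV d\<close> by (intro closed_Collect_eq) auto
      hence "closed ({..0} \<union> {y. d y = 0})" by (intro closed_Un) auto
      moreover have "AE y in lebesgue. y \<in> {..0} \<union> {y. d y = 0}"
        using U0(2) U(2) unfolding AE_half_line_iff by eventually_elim (auto simp: d_def abs_if)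
      ultimately have "x \<in> {..0} \<union> {y. d y = 0}" by (rule mem_closed_if_AE_lebesgue)
      thus ?thesis using that by simp
    qed
    have "d 0 = 0"
    proof (rule continuous_constant_on_closure[of "{0<..}" d])
      show "continuous_on (closure {0<..}) d" using \<open>continuous_on UNIV d\<close> by (rule continuous_on_subset) simp
    qed (use pos in auto)
    thus ?thesis using U0(3) by (simp add: d_def)
  qed
  ultimately show ?thesis
    using that[of U Y w] U Y u v w weak_deriv_weak_deriv[OF v w] by blast
qed

lemma dirichlet_domainI:
  assumes "ac_deriv U Y" "ac_deriv Y W" "U \<in> L2" "Y \<in> L2" "W \<in> L2" "U 0 = 0"
  shows "U \<in> dirichlet_domain" "AE r in half_line. weak_deriv (weak_deriv U) r = W r"
proof -
  have w: "has_weak_deriv U Y" "has_weak_deriv Y W" using assms by (auto intro: ac_deriv_weak_deriv)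
  thus "U \<in> dirichlet_domain"
    using assms ac_deriv_continuous[OF assms(1)] by (auto simp: dirichlet_domain_def H2_def)
  show "AE r in half_line. weak_deriv (weak_deriv U) r = W r"
    by (rule weak_deriv_weak_deriv(1)[OF assms(4) w(1) assms(5) w(2)])
qed

section \<open>The potential\<close>

lemma antimono_borel_measurable_half_line:
  fixes V :: "real \<Rightarrow> real"
  assumes "antimono_on {0..} V"
  shows "V \<in> borel_measurable half_line"
proof -
  have "mono (\<lambda>x. - V (max 0 x))"
  proof (rule monoI)
    fix x y :: real assume "x \<le> y"
    hence "V (max 0 y) \<le> V (max 0 x)" by (intro monotone_onD[OF assms]) auto
    thus "- V (max 0 x) \<le> - V (max 0 y)" by simp
  qed
  hence "(\<lambda>x. - V (max 0 x)) \<in> borel_measurable borel" by (rule borel_measurable_mono)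
  hence "(\<lambda>x. - (- V (max 0 x))) \<in> borel_measurable borel" by (rule borel_measurable_uminus)
  hence m: "(\<lambda>x. V (max 0 x)) \<in> borel_measurable half_line" by (intro borel_measurable_half_lineI) simp
  show ?thesis by (rule measurable_cong[THEN iffD1, OF _ m]) simp
qed

text \<open>For a nonincreasing function the right limit at r is the supremum of the values on (r,
  \<infinity>), which yields all four facts.\<close>

lemma antimono_right_limit:
  fixes V :: "real \<Rightarrow> real"
  assumes anti: "antimono_on {0..} V" and r: "0 \<le> r"
  defines "L \<equiv> Lim (at_right r) V"
  shows "(V \<longlongrightarrow> L) (at_right r)" and "L \<le> V r" and "\<And>t. r < t \<Longrightarrow> V t \<le> L"
    and "\<And>c. c < L \<Longrightarrow> \<exists>t>r. c < V t"
proof -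
  define S where "S = Sup (V ` {r<..})"
  have le: "V t \<le> V x" if "0 \<le> x" "x \<le> t" for x t using that by (intro monotone_onD[OF anti]) auto
  have bdd: "bdd_above (V ` {r<..})" by (rule bdd_aboveI2[of _ _ "V r"]) (use le r in auto)
  have up: "V t \<le> S" if "r < t" for t unfolding S_def using bdd that by (intro cSUP_upper) auto
  have low: "\<exists>t>r. c < V t" if "c < S" for c
    using less_cSUP_iff[OF _ bdd, of c] that unfolding S_def by auto
  have lim: "(V \<longlongrightarrow> S) (at_right r)"
  proof (rule order_tendstoI)
    fix c assume "c < S"
    then obtain t where t: "r < t" "c < V t" using low by blast
    have "c < V x" if "r < x" "x < t" for x using le[of x t] that t r by linarith
    thus "eventually (\<lambda>x. c < V x) (at_right r)" using t(1) by (auto simp: eventually_at_right)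
  next
    fix c assume "S < c"
    hence "V x < c" if "r < x" for x using up[OF that] by simp
    thus "eventually (\<lambda>x. V x < c) (at_right r)" by (intro eventually_mono[OF eventually_at_right_less])
  qed
  hence LS: "L = S" unfolding L_def by (intro tendsto_Lim) auto
  show "(V \<longlongrightarrow> L) (at_right r)" "\<And>t. r < t \<Longrightarrow> V t \<le> L" "\<And>c. c < L \<Longrightarrow> \<exists>t>r. c < V t"
    using lim up low unfolding LS by auto
  show "L \<le> V r" unfolding LS S_def by (rule cSUP_least) (use le r in auto)
qed

text \<open>The right limits form a right-continuous nonincreasing function, so the Stieltjes
  formula applies. The constant extension to the left of 0 starts from the right limit at 0.\<close>

lemma emeasure_minus_deriv_measure:
  fixes V :: "real \<Rightarrow> real"
  assumes anti: "antimono_on {0..} V" and ab: "0 \<le> a" "a \<le> b"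
  shows "emeasure (minus_deriv_measure V) {a<..b} = ennreal (Lim (at_right a) V - Lim (at_right b) V)"
proof -
  define L where "L r = Lim (at_right r) V" for r
  note lim = antimono_right_limit[OF anti, folded L_def]
  have anti_L: "L t \<le> L r" if "0 \<le> r" "r \<le> t" for r t
    using lim(2)[of t] lim(3)[of r t] that by (cases "r = t") auto
  define F where "F r = - L (max 0 r)" for r
  have cont: "continuous (at_right x) F" for x
  proof (cases "x < 0")
    case True
    have "eventually (\<lambda>y. F x = F y) (at_right x)"
      using True by (auto simp: eventually_at_right F_def max_def intro!: exI[of _ 0])
    thus ?thesis by (auto simp: continuous_within intro: tendsto_eventually elim!: eventually_mono)
  next
    case False
    have "(L \<longlongrightarrow> L x) (at_right x)"
    proof (rule order_tendstoI)
      fix c assume "c < L x"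
      then obtain t where t: "x < t" "c < V t" using lim(4)[of x c] False by auto
      have "c < L y" if "x < y" "y < t" for y using lim(3)[of y t] that t False by simp
      thus "eventually (\<lambda>y. c < L y) (at_right x)" using t(1) by (auto simp: eventually_at_right)
    next
      fix c assume "L x < c"
      hence "L y < c" if "x < y" for y using anti_L[of x y] that False by simp
      thus "eventually (\<lambda>y. L y < c) (at_right x)" by (intro eventually_mono[OF eventually_at_right_less])
    qed
    hence "((\<lambda>y. - L y) \<longlongrightarrow> F x) (at_right x)" using False by (auto simp: F_def max_def intro: tendsto_minus)
    moreover have "eventually (\<lambda>y. - L y = F y) (at_right x)"
      using False by (intro eventually_mono[OF eventually_at_right_less]) (auto simp: F_def max_def)
    ultimately show ?thesis unfolding continuous_within by (rule Lim_transform_eventually)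
  qed
  have "emeasure (interval_measure F) {a<..b} = ennreal (F b - F a)"
    by (rule emeasure_interval_measure_Ioc[OF ab(2)]) (auto simp: F_def intro!: anti_L cont)
  moreover have "minus_deriv_measure V = interval_measure F"
    unfolding minus_deriv_measure_def F_def L_def ..
  ultimately show ?thesis using ab by (simp add: F_def L_def)
qed

lemma set_integrable_mult_bounded:
  fixes u m :: "real \<Rightarrow> 'a :: {real_normed_algebra, banach, second_countable_topology}"
  assumes u: "set_integrable half_line {..R} u" and m: "m \<in> borel_measurable half_line"
    and B: "\<And>r. 0 < r \<Longrightarrow> norm (m r) \<le> B"
  shows "set_integrable half_line {..R} (\<lambda>r. m r * u r)"
  unfolding set_integrable_def
proof (rule Bochner_Integration.integrable_bound)
  have i: "integrable half_line (\<lambda>r. indicator {..R} r *\<^sub>R u r)" using u by (simp add: set_integrable_def)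
  thus "integrable half_line (\<lambda>r. B *\<^sub>R (indicator {..R} r *\<^sub>R u r))" by (rule integrable_scaleR_right)
  have "(\<lambda>r. m r * (indicator {..R} r *\<^sub>R u r)) \<in> borel_measurable half_line"
    by (rule borel_measurable_times[OF m borel_measurable_integrable[OF i]])
  thus "(\<lambda>r. indicator {..R} r *\<^sub>R (m r * u r)) \<in> borel_measurable half_line" by simp
  show "AE r in half_line. norm (indicator {..R} r *\<^sub>R (m r * u r)) \<le> norm (B *\<^sub>R indicator {..R} r *\<^sub>R u r)"
    using AE_half_line_pos
  proof eventually_elim
    case (elim r)
    have "norm (m r * u r) \<le> norm (m r) * norm (u r)" by (rule norm_mult_ineq)
    also have "\<dots> \<le> \<bar>B\<bar> * norm (u r)" using B[OF elim] by (intro mult_right_mono) auto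
    finally show ?case by (simp add: indicator_def)
  qed
qed

lemma ac_deriv_of_real:
  assumes "ac_deriv (\<lambda>r. complex_of_real (g r)) (\<lambda>r. complex_of_real (g' r))"
  shows "set_integrable half_line {..r} g'" and "0 \<le> r \<Longrightarrow> g r = g 0 + (LINT t:{..r}|half_line. g' t)"
proof -
  have *: "indicator {..r} t *\<^sub>R complex_of_real (g' t) = complex_of_real (indicator {..r} t *\<^sub>R g' t)" for t
    by (simp add: scaleR_conv_of_real)
  show "set_integrable half_line {..r} g'"
    using ac_deriv_integrable[OF assms, of r] unfolding set_integrable_def * complex_of_real_integrable_eq .
  assume "0 \<le> r"
  from ac_derivD[OF assms this] have "complex_of_real (g r) = complex_of_real (g 0 + (LINT t:{..r}|half_line. g' t))"
    unfolding set_lebesgue_integral_def * integral_complex_of_real by simp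
  thus "g r = g 0 + (LINT t:{..r}|half_line. g' t)" unfolding of_real_eq_iff .
qed

lemma ac_deriv_real_C1:
  assumes d: "\<And>r. 0 \<le> r \<Longrightarrow> (m has_real_derivative m' r) (at r)" and c: "continuous_on {0..} m'"
  shows "ac_deriv (\<lambda>r. complex_of_real (m r)) (\<lambda>r. complex_of_real (m' r))"
  by (rule ac_deriv_C1)
     (use d in \<open>auto intro!: has_vector_derivative_of_real continuous_intros c simp flip: has_real_derivative_iff_has_vector_derivative\<close>)

lemma powr_weight_derivative:
  "0 \<le> r \<Longrightarrow> ((\<lambda>r. (1 + r) powr a) has_real_derivative a * (1 + r) powr (a - 1)) (at r)"
  by (auto intro!: derivative_eq_intros)

lemma ac_deriv_powr_weight:
  "ac_deriv (\<lambda>r. complex_of_real ((1 + r) powr a)) (\<lambda>r. complex_of_real (a * (1 + r) powr (a - 1)))"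
  by (rule ac_deriv_real_C1[OF powr_weight_derivative]) (auto intro!: continuous_intros)

section \<open>From the measure inequality to a monotone weighted potential\<close>

locale decreasing_potential =
  fixes V :: "real \<Rightarrow> real" and \<delta> :: real
  assumes V_nonneg: "\<And>r. 0 \<le> r \<Longrightarrow> 0 \<le> V r"
    and V_antimono: "antimono_on {0..} V"
    and \<delta>_pos: "\<delta> > 0"
    and V_deriv: "deriv_le_measure_sense V \<delta>"
begin

lemma V_le: "0 \<le> x \<Longrightarrow> x \<le> y \<Longrightarrow> V y \<le> V x"
  by (rule monotone_onD[OF V_antimono]) auto

definition V_right where "V_right r = Lim (at_right r) V"

lemma V_right_nonneg: "0 \<le> r \<Longrightarrow> 0 \<le> V_right r"
  using antimono_right_limit(3)[OF V_antimono, of r "r+1"] V_nonneg[of "r+1"] by (simp add: V_right_def)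

text \<open>A discrete Gronwall step: on (a, b] the density \<delta> V / (1 + r) is at least
  \<delta> \<open>V_right b\<close> / (1 + b), and the measure of (a, b] is the drop of the right
  limit.\<close>

lemma V_right_step:
  assumes ab: "0 \<le> a" "a \<le> b"
  shows "V_right b * (1 + \<delta> * (b - a) / (1 + b)) \<le> V_right a"
proof -
  have "ennreal (\<delta> / (1 + b) * V_right b) * emeasure lborel {a<..b} = (\<integral>\<^sup>+r\<in>{a<..b}. ennreal (\<delta> / (1 + b) * V_right b) \<partial>lborel)"
    by (simp add: nn_integral_cmult_indicator)
  also have "\<dots> \<le> (\<integral>\<^sup>+r\<in>{a<..b}. ennreal (\<delta> / (1 + r) * V r) \<partial>lborel)"
  proof (rule nn_integral_mono)
    fix r
    have "\<delta> / (1 + b) * V_right b \<le> \<delta> / (1 + r) * V r" if "a < r" "r \<le> b"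
    proof (rule mult_mono)
      have "V_right b \<le> V b" using antimono_right_limit(2)[OF V_antimono, of b] ab by (simp add: V_right_def)
      also have "\<dots> \<le> V r" using that ab by (intro V_le) auto
      finally show "V_right b \<le> V r" .
      show "\<delta> / (1 + b) \<le> \<delta> / (1 + r)" using that ab \<delta>_pos by (intro divide_left_mono) auto
      show "0 \<le> \<delta> / (1 + r)" using that ab \<delta>_pos by simp
      show "0 \<le> V_right b" using ab by (intro V_right_nonneg) simp
    qed
    thus "ennreal (\<delta> / (1 + b) * V_right b) * indicator {a<..b} r \<le> ennreal (\<delta> / (1 + r) * V r) * indicator {a<..b} r"
      by (auto simp: indicator_def intro!: ennreal_leI)
  qed
  also have "\<dots> \<le> emeasure (minus_deriv_measure V) {a<..b}"
    by (rule V_deriv[unfolded deriv_le_measure_sense_def, rule_format]) (use ab in auto)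
  also have "\<dots> = ennreal (V_right a - V_right b)"
    unfolding V_right_def by (rule emeasure_minus_deriv_measure[OF V_antimono ab])
  finally have *: "ennreal (\<delta> / (1 + b) * V_right b * (b - a)) \<le> ennreal (V_right a - V_right b)"
    using ab \<delta>_pos V_right_nonneg[of b] by (simp add: ennreal_mult'' flip: ennreal_mult)
  have "V_right b \<le> V_right a"
    using antimono_right_limit(2)[OF V_antimono, of b] antimono_right_limit(3)[OF V_antimono, of a b] ab
    by (cases "a = b") (auto simp: V_right_def)
  hence "\<delta> / (1 + b) * V_right b * (b - a) \<le> V_right a - V_right b"
    using * by (simp add: ennreal_le_iff)
  thus ?thesis by (simp add: algebra_simps)
qed

text \<open>In the variable t = ln (1 + r) the relative length (b - a) / (1 + b) of a step depends
  only on its length y, so steps can be iterated. The exponent equals \<delta> y up to second order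
  in y, which suffices in the limit of small steps.\<close>

lemma V_right_step_exp:
  assumes y: "0 \<le> y" and t: "0 \<le> t"
  shows "V_right (exp (t + y) - 1) * exp (\<delta> * y / (1 + (1 + \<delta>) * y)) \<le> V_right (exp t - 1)"
proof -
  define x where "x = (exp (t + y) - exp t) / exp (t + y)"
  have xy: "x = 1 - exp (- y)" by (simp add: x_def field_simps exp_add exp_minus)
  have "exp (- y) \<le> 1 / (1 + y)"
    using exp_ge_add_one_self[of y] y by (simp add: exp_minus field_simps)
  hence x: "y / (1 + y) \<le> x" using y unfolding xy by (simp add: field_simps)
  have x0: "0 \<le> x" using y by (simp add: xy)
  \<comment> \<open>The left side is the increasing function
    \<open>\<delta> * x / (1 + \<delta> * x)\<close> evaluated at the lower bound
    \<open>y / (1 + y)\<close> of \<open>x\<close>.\<close>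
  have "\<delta> * y / (1 + (1 + \<delta>) * y) \<le> \<delta> * x / (1 + \<delta> * x)"
  proof -
    have "y \<le> x * (1 + y)" using x y by (simp add: field_simps)
    hence "\<delta> * y \<le> \<delta> * (x * (1 + y))" using \<delta>_pos by simp
    hence "(\<delta> * y) * (1 + \<delta> * x) \<le> \<delta> * x * (1 + (1 + \<delta>) * y)" by (simp add: algebra_simps)
    moreover have A: "0 < 1 + (1 + \<delta>) * y" and B: "0 < 1 + \<delta> * x" using y x0 \<delta>_pos by (auto intro: add_pos_nonneg)
    ultimately show ?thesis unfolding pos_divide_le_eq[OF A] times_divide_eq_left pos_le_divide_eq[OF B] by simp
  qed
  \<comment> \<open>This is \<open>1 - t \<le> exp (- t)\<close> at
    \<open>t = \<delta> * x / (1 + \<delta> * x)\<close>, where \<open>1 - t\<close> is the inverse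
    of \<open>1 + \<delta> * x\<close>.\<close>
  moreover have "exp (\<delta> * x / (1 + \<delta> * x)) \<le> 1 + \<delta> * x"
  proof -
    have p: "0 < 1 + \<delta> * x" using x0 \<delta>_pos by (auto intro: add_pos_nonneg)
    have "1 + - (\<delta> * x / (1 + \<delta> * x)) \<le> exp (- (\<delta> * x / (1 + \<delta> * x)))" by (rule exp_ge_add_one_self)
    also have "1 + - (\<delta> * x / (1 + \<delta> * x)) = inverse (1 + \<delta> * x)" using p by (simp add: field_simps)
    finally show ?thesis using p by (simp add: exp_minus le_imp_inverse_le inverse_le_iff_le)
  qed
  ultimately have "exp (\<delta> * y / (1 + (1 + \<delta>) * y)) \<le> 1 + \<delta> * x"
    by (meson exp_le_cancel_iff order_trans)
  hence "V_right (exp (t + y) - 1) * exp (\<delta> * y / (1 + (1 + \<delta>) * y)) \<le> V_right (exp (t + y) - 1) * (1 + \<delta> * x)"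
    using y t by (intro mult_left_mono V_right_nonneg) auto
  also have "\<dots> \<le> V_right (exp t - 1)"
    using V_right_step[of "exp t - 1" "exp (t + y) - 1"] y t by (simp add: x_def)
  finally show ?thesis .
qed

lemma V_right_steps_exp:
  assumes y: "0 \<le> y" and t: "0 \<le> t"
  shows "V_right (exp (t + real n * y) - 1) * exp (real n * (\<delta> * y / (1 + (1 + \<delta>) * y))) \<le> V_right (exp t - 1)"
proof (induction n)
  case (Suc n)
  define e where "e = \<delta> * y / (1 + (1 + \<delta>) * y)"
  have "V_right (exp (t + real (Suc n) * y) - 1) * exp (real (Suc n) * e)
     = (V_right (exp ((t + real n * y) + y) - 1) * exp e) * exp (real n * e)"
    by (simp add: algebra_simps flip: exp_add)
  also have "\<dots> \<le> V_right (exp (t + real n * y) - 1) * exp (real n * e)"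
    unfolding e_def by (intro mult_right_mono V_right_step_exp) (use y t in auto)
  also note Suc[folded e_def]
  finally show ?case unfolding e_def .
qed simp

text \<open>The logarithmic distance l from a to b is divided into \<open>Suc n\<close> equal steps.
  The accumulated exponent tends to \<delta> l as n grows, and exp (\<delta> l) is the quotient of
  the two weights.\<close>

lemma V_right_weighted:
  assumes ab: "0 \<le> a" "a \<le> b"
  shows "V_right b * (1 + b) powr \<delta> \<le> V_right a * (1 + a) powr \<delta>"
proof -
  define t where "t = ln (1 + a)"
  define l where "l = ln (1 + b) - ln (1 + a)"
  have t: "0 \<le> t" and l: "0 \<le> l" using ab by (auto simp: t_def l_def)
  have "V_right b * exp (real (Suc n) * (\<delta> * (l / Suc n) / (1 + (1 + \<delta>) * (l / Suc n)))) \<le> V_right a" for n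
    using V_right_steps_exp[of "l / Suc n" t "Suc n"] t l ab by (simp add: t_def l_def del: of_nat_Suc)
  moreover have "real (Suc n) * (\<delta> * (l / Suc n) / (1 + (1 + \<delta>) * (l / Suc n))) = \<delta> * l / (1 + (1 + \<delta>) * l * inverse (real (Suc n)))" for n
  proof -
    have "N * (\<delta> * (l / N) / Z) = \<delta> * l / Z" if "N > 0" for N Z :: real using that by simp
    from this[of "real (Suc n)"] show ?thesis by (simp add: divide_inverse mult.assoc del: of_nat_Suc)
  qed
  ultimately have le: "V_right b * exp (\<delta> * l / (1 + (1 + \<delta>) * l * inverse (real (Suc n)))) \<le> V_right a" for n
    by metis
  have "(\<lambda>n. V_right b * exp (\<delta> * l / (1 + (1 + \<delta>) * l * inverse (real (Suc n))))) \<longlonglongrightarrow> V_right b * exp (\<delta> * l / (1 + (1 + \<delta>) * l * 0))"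
    by (intro tendsto_intros LIMSEQ_inverse_real_of_nat) auto
  hence "V_right b * exp (\<delta> * l) \<le> V_right a"
    by (intro tendsto_upperbound[OF _ always_eventually]) (use le in auto)
  hence "V_right b * exp (\<delta> * l) * exp (\<delta> * t) \<le> V_right a * exp (\<delta> * t)" by (intro mult_right_mono) auto
  thus ?thesis using ab by (simp add: t_def l_def powr_def algebra_simps flip: exp_add)
qed

text \<open>For a < c < b the value V b lies below the right limit at c, and the right limit at a
  lies below V a. Letting c increase to b transfers the monotonicity from the right limits to V,
  whatever value V takes at its jumps.\<close>

lemma V_weighted_antimono:
  assumes ab: "0 \<le> a" "a \<le> b"
  shows "V b * (1 + b) powr \<delta> \<le> V a * (1 + a) powr \<delta>"
proof (cases "a = b")
  case False
  hence ab': "a < b" using ab by simp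
  have le: "V b * (1 + c) powr \<delta> \<le> V a * (1 + a) powr \<delta>" if c: "a < c" "c < b" for c
  proof -
    have "V b * (1 + c) powr \<delta> \<le> V_right c * (1 + c) powr \<delta>"
      using antimono_right_limit(3)[OF V_antimono, of c b] c ab by (intro mult_right_mono) (auto simp: V_right_def)
    also have "\<dots> \<le> V_right a * (1 + a) powr \<delta>" using c ab by (intro V_right_weighted) auto
    also have "\<dots> \<le> V a * (1 + a) powr \<delta>"
      using antimono_right_limit(2)[OF V_antimono, of a] ab by (intro mult_right_mono) (auto simp: V_right_def)
    finally show ?thesis .
  qed
  have "((\<lambda>c. V b * (1 + c) powr \<delta>) \<longlongrightarrow> V b * (1 + b) powr \<delta>) (at_left b)"
    using ab by (intro tendsto_intros) auto
  moreover have "eventually (\<lambda>c. V b * (1 + c) powr \<delta> \<le> V a * (1 + a) powr \<delta>) (at_left b)"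
    using ab' le unfolding eventually_at_left[OF ab'] by blast
  ultimately show ?thesis by (rule tendsto_upperbound) simp
qed simp

end

text \<open>The hypothesis on \<open>V'\<close> enters the estimates only through the monotonicity of \<open>(1 + r) powr \<delta> V\<close>,
  which is stable under the rescaling \<open>V / h\<^sup>2\<close>.\<close>

locale repulsive_potential =
  fixes V :: "real \<Rightarrow> real" and \<delta> :: real
  assumes V_nonneg: "\<And>r. 0 \<le> r \<Longrightarrow> 0 \<le> V r"
    and \<delta>_pos: "\<delta> > 0"
    and V_weighted_antimono: "\<And>a b. 0 \<le> a \<Longrightarrow> a \<le> b \<Longrightarrow> V b * (1 + b) powr \<delta> \<le> V a * (1 + a) powr \<delta>"
begin

lemma V_le:
  assumes "0 \<le> x" "x \<le> y" shows "V y \<le> V x"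
proof -
  have "V y * (1 + x) powr \<delta> \<le> V y * (1 + y) powr \<delta>"
    using assms \<delta>_pos by (intro mult_left_mono powr_mono2 V_nonneg) auto
  also have "\<dots> \<le> V x * (1 + x) powr \<delta>" by (rule V_weighted_antimono[OF assms])
  finally show ?thesis using assms by (simp add: mult_le_cancel_right)
qed

lemma V_measurable: "V \<in> borel_measurable half_line"
  by (rule antimono_borel_measurable_half_line) (auto simp: monotone_on_def intro: V_le)

lemma V_bounded: "0 < r \<Longrightarrow> \<bar>V r\<bar> \<le> V 0"
  using V_le[of 0 r] V_nonneg[of r] by simp

text \<open>This is the inequality "integral of -V' g at least integral of \<delta> V g / (1 + r)"
  with the derivative moved onto g. With W = (1 + r)^\<delta> V nonincreasing and G = (1 +
  r)^(-\<delta>) g, the integrand is W G'. The second mean value theorem evaluates its integral as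
  (W 0 - W R) G c + W R G R for some c, and both terms are nonnegative.\<close>

lemma V_integral_nonneg_finite:
  assumes ac: "ac_deriv (\<lambda>r. complex_of_real (g r)) (\<lambda>r. complex_of_real (g' r))"
    and g: "\<And>r. 0 \<le> r \<Longrightarrow> 0 \<le> g r" "g 0 = 0" and R: "0 \<le> R"
  shows "0 \<le> (LINT r:{..R}|half_line. V r * (g' r - \<delta> * g r / (1 + r)))"
proof -
  define G where "G r = (1 + r) powr (-\<delta>) * g r" for r
  define G' where "G' r = (-\<delta> * (1 + r) powr (-\<delta> - 1)) * g r + (1 + r) powr (-\<delta>) * g' r" for r
  have G: "ac_deriv (\<lambda>r. complex_of_real (G r)) (\<lambda>r. complex_of_real (G' r))"
    using ac_deriv_mult[OF ac_deriv_powr_weight[of "-\<delta>"] ac] by (simp add: G_def G'_def)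
  note si = ac_deriv_of_real(1)[OF G]
  have ai: "G' absolutely_integrable_on {0..r}" for r
    using si half_line_set_integral_eq(1) by blast
  hence io: "G' integrable_on {0..r}" for r by (rule set_lebesgue_integral_eq_integral(1))
  have Gint: "integral {0..r} G' = G r" if "0 \<le> r" for r
    using ac_deriv_of_real(2)[OF G that] half_line_set_integral_eq(2)[OF si, of r] g by (simp add: G_def)
  define W where "W r = V r * (1 + r) powr \<delta>" for r
  have W: "W y \<le> W x" if "0 \<le> x" "x \<le> y" for x y
    unfolding W_def by (rule V_weighted_antimono[OF that])
  obtain c where c: "c \<in> {0..R}" and
    int: "((\<lambda>x. (- W x) * G' x) has_integral ((- W 0) * integral {0..c} G' + (- W R) * integral {c..R} G')) {0..R}"
    by (rule second_mean_value_theorem_full[OF io R, of "\<lambda>x. - W x"]) (use W in auto)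
  have "integral {0..c} G' + integral {c..R} G' = integral {0..R} G'"
    by (rule Henstock_Kurzweil_Integration.integral_combine) (use c io in auto)
  hence e: "integral {c..R} G' = G R - G c" using Gint[of c] Gint[of R] c R by simp
  have v: "(- W 0) * integral {0..c} G' + (- W R) * integral {c..R} G' = - ((W 0 - W R) * G c + W R * G R)"
    unfolding e using Gint[of c] c by (simp add: algebra_simps)
  have eq: "V r * (g' r - \<delta> * g r / (1 + r)) = - ((- W r) * G' r)" if "0 \<le> r" for r
  proof -
    have "(1 + r) powr \<delta> * (1 + r) powr (-\<delta>) = 1" "(1 + r) powr \<delta> * (1 + r) powr (-\<delta> - 1) = 1 / (1 + r)"
      using that by (simp_all add: powr_minus_divide flip: powr_add)
    moreover have "- ((- W r) * G' r) = V r * (((1 + r) powr \<delta> * (1 + r) powr (-\<delta>)) * g' r - \<delta> * ((1 + r) powr \<delta> * (1 + r) powr (-\<delta> - 1)) * g r)"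
      by (simp add: W_def G'_def algebra_simps)
    ultimately show ?thesis by simp
  qed
  have "((\<lambda>r. - ((- W r) * G' r)) has_integral ((W 0 - W R) * G c + W R * G R)) {0..R}"
    using has_integral_neg[OF int] unfolding v by (simp add: add.commute)
  hence hi: "((\<lambda>r. V r * (g' r - \<delta> * g r / (1 + r))) has_integral ((W 0 - W R) * G c + W R * G R)) {0..R}"
    by (rule has_integral_eq[rotated]) (use eq in auto)
  have gi: "set_integrable half_line {..R} (\<lambda>r. g' r - \<delta> * g r / (1 + r))"
  proof (rule set_integral_diff(1)[OF ac_deriv_of_real(1)[OF ac]])
    have "continuous_on {0..} (\<lambda>r. Re (complex_of_real (g r)))"
      by (intro continuous_intros ac_deriv_continuous[OF ac])
    hence "continuous_on {0..R} g" by (simp add: continuous_on_subset)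
    hence "continuous_on {0..R} (\<lambda>r. \<delta> * g r / (1 + r))" by (intro continuous_intros) auto
    thus "set_integrable half_line {..R} (\<lambda>r. \<delta> * g r / (1 + r))"
      using absolutely_integrable_continuous_real half_line_set_integral_eq(1) by blast
  qed
  have "set_integrable half_line {..R} (\<lambda>r. V r * (g' r - \<delta> * g r / (1 + r)))"
    by (rule set_integrable_mult_bounded[OF gi V_measurable, of "V 0"]) (use V_bounded in auto)
  hence "(LINT r:{..R}|half_line. V r * (g' r - \<delta> * g r / (1 + r))) = (W 0 - W R) * G c + W R * G R"
    using half_line_set_integral_eq(2) integral_unique[OF hi] by metis
  moreover have "0 \<le> (W 0 - W R) * G c + W R * G R"
    using W[of 0 R] c R g V_nonneg[of R] by (intro add_nonneg_nonneg mult_nonneg_nonneg) (auto simp: G_def W_def)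
  ultimately show ?thesis by simp
qed

lemma V_integral_nonneg:
  assumes ac: "ac_deriv (\<lambda>r. complex_of_real (g r)) (\<lambda>r. complex_of_real (g' r))"
    and g: "\<And>r. 0 \<le> r \<Longrightarrow> 0 \<le> g r" "g 0 = 0"
    and i: "integrable half_line (\<lambda>r. V r * (g' r - \<delta> * g r / (1 + r)))"
  shows "0 \<le> (LINT r|half_line. V r * (g' r - \<delta> * g r / (1 + r)))"
proof (rule tendsto_lowerbound[OF set_integral_half_line_tendsto[OF i]])
  show "eventually (\<lambda>R. 0 \<le> (LINT r:{..R}|half_line. V r * (g' r - \<delta> * g r / (1 + r)))) at_top"
    using eventually_ge_at_top[of 0] by eventually_elim (rule V_integral_nonneg_finite[OF ac g])
qed simp

end

lemma (in decreasing_potential) repulsive_rescaled: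
  assumes "h > 0" shows "repulsive_potential (\<lambda>r. V r / h\<^sup>2) \<delta>"
  by unfold_locales
     (use V_nonneg \<delta>_pos V_weighted_antimono assms in \<open>auto simp: divide_right_mono\<close>)

section \<open>Energy estimates\<close>

text \<open>For Re z \<ge> 0 one has \<kappa> \<le> 2 |Im z|: the imaginary part of the identity
  controls N, and the real part then controls A at the price of |z|. For Re z < 0 all terms of the
  real part have the same sign, so it controls A and -(Re z) N. The single quantity \<kappa> covers
  both regimes.\<close>

lemma numerical_range_bounds:
  fixes z I :: complex and A B N :: real
  assumes nn: "0 \<le> A" "0 \<le> B" "0 \<le> N" and eq: "of_real A + of_real B - z * of_real N = I"
  defines "\<kappa> \<equiv> \<bar>Im z\<bar> + cmod z - Re z"
  shows "\<kappa> * N \<le> 4 * cmod I" "\<kappa> * A \<le> 4 * cmod z * cmod I"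
proof -
  have re: "A + B - Re z * N = Re I" and im: "- Im z * N = Im I"
    using arg_cong[OF eq, of Re] arg_cong[OF eq, of Im] by auto
  have reI: "Re I \<le> cmod I" by (rule complex_Re_le_cmod)
  have imI: "\<bar>Im z\<bar> * N \<le> cmod I"
    using abs_Im_le_cmod[of I] im nn by (metis abs_minus_cancel abs_mult abs_of_nonneg mult_minus_left)
  have zle: "cmod z \<le> \<bar>Re z\<bar> + \<bar>Im z\<bar>" by (rule cmod_le)
  have bounds: "\<bar>Im z\<bar> \<le> cmod z" "\<bar>Re z\<bar> \<le> cmod z" by (rule abs_Im_le_cmod abs_Re_le_cmod)+
  have "\<kappa> * N \<le> 4 * cmod I \<and> \<kappa> * A \<le> 4 * cmod z * cmod I"
  proof (cases "0 \<le> Re z")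
    case True
    have "\<kappa> \<le> 2 * \<bar>Im z\<bar>" unfolding \<kappa>_def using zle True by simp
    hence "\<kappa> * N \<le> 2 * (\<bar>Im z\<bar> * N)" using nn mult_right_mono[of \<kappa> "2 * \<bar>Im z\<bar>" N] by simp
    also have "\<dots> \<le> 2 * cmod I" using imI by simp
    finally have kN: "\<kappa> * N \<le> 2 * cmod I" .
    have k2: "\<kappa> \<le> 2 * cmod z" and k0: "0 \<le> \<kappa>" unfolding \<kappa>_def using True bounds complex_Re_le_cmod[of z] by auto
    have "Re z * N \<le> cmod z * N" using nn by (intro mult_right_mono complex_Re_le_cmod)
    hence "A \<le> cmod I + cmod z * N" using re reI nn by linarith
    hence "\<kappa> * A \<le> \<kappa> * (cmod I + cmod z * N)" using k0 by (rule mult_left_mono)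
    also have "\<dots> = \<kappa> * cmod I + cmod z * (\<kappa> * N)" by (simp add: algebra_simps)
    also have "\<dots> \<le> 2 * cmod z * cmod I + cmod z * (2 * cmod I)"
      by (intro add_mono mult_right_mono[OF k2] mult_left_mono[OF kN]) auto
    finally have "\<kappa> * A \<le> 4 * cmod z * cmod I" by (simp add: algebra_simps)
    thus ?thesis using kN norm_ge_zero[of I] by (intro conjI) linarith+
  next
    case False
    have n: "0 \<le> (- Re z) * N" by (rule mult_nonneg_nonneg) (use False nn in auto)
    have rz: "(- Re z) * N \<le> cmod I" using re reI nn by simp
    have A: "A \<le> cmod I" using n re reI nn by simp
    have "\<kappa> * N \<le> 2 * (\<bar>Im z\<bar> * N) + 2 * ((- Re z) * N)"
    proof -
      have "\<kappa> \<le> 2 * \<bar>Im z\<bar> + 2 * (- Re z)" unfolding \<kappa>_def using zle False by simp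
      from mult_right_mono[OF this nn(3)] show ?thesis by (simp add: algebra_simps)
    qed
    also have "\<dots> \<le> 4 * cmod I" using imI rz by simp
    finally have kN: "\<kappa> * N \<le> 4 * cmod I" .
    have "\<kappa> \<le> 4 * cmod z" unfolding \<kappa>_def using bounds by simp
    hence "\<kappa> * A \<le> (4 * cmod z) * cmod I" using A nn by (intro mult_mono) auto
    thus ?thesis using kN by simp
  qed
  thus "\<kappa> * N \<le> 4 * cmod I" "\<kappa> * A \<le> 4 * cmod z * cmod I" by auto
qed

lemma numerical_range_pos:
  assumes "z \<notin> \<real>\<^sub>\<ge>\<^sub>0" shows "0 < \<bar>Im z\<bar> + cmod z - Re z"
proof (rule ccontr)
  assume "\<not> ?thesis"
  hence "\<bar>Im z\<bar> = 0" "cmod z = Re z" using complex_Re_le_cmod[of z] by auto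
  hence "Im z = 0" "0 \<le> Re z" by (simp, metis norm_ge_zero)
  thus False using assms by (simp add: complex_nonneg_Reals_iff)
qed

lemma ac_deriv_norm_sq:
  assumes "ac_deriv U Y"
  shows "ac_deriv (\<lambda>r. complex_of_real ((cmod (U r))\<^sup>2)) (\<lambda>r. complex_of_real (2 * Re (cnj (U r) * Y r)))"
proof -
  have "Y r * cnj (U r) + U r * cnj (Y r) = complex_of_real (2 * Re (cnj (U r) * Y r))" for r
    using complex_add_cnj[of "cnj (U r) * Y r"] by (simp add: mult.commute)
  thus ?thesis
    using ac_deriv_mult[OF assms ac_deriv_cnj[OF assms]] by (simp only: complex_norm_square)
qed

lemma ac_deriv_of_real_mult:
  assumes "ac_deriv (\<lambda>r. complex_of_real (a r)) (\<lambda>r. complex_of_real (a' r))"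
    "ac_deriv (\<lambda>r. complex_of_real (b r)) (\<lambda>r. complex_of_real (b' r))"
  shows "ac_deriv (\<lambda>r. complex_of_real (a r * b r)) (\<lambda>r. complex_of_real (a' r * b r + a r * b' r))"
  using ac_deriv_mult[OF assms] by simp

lemma ac_deriv_of_real_integral:
  assumes ac: "ac_deriv (\<lambda>r. complex_of_real (g r)) (\<lambda>r. complex_of_real (g' r))"
    and i: "integrable half_line g" "integrable half_line g'"
  shows "(LINT r|half_line. g' r) = - g 0"
proof -
  have "(LINT r|half_line. complex_of_real (g' r)) = - complex_of_real (g 0)"
    by (rule ac_deriv_integral_half_line[OF ac]) (use i in \<open>simp_all only: complex_of_real_integrable_eq\<close>)
  hence "complex_of_real (LINT r|half_line. g' r) = complex_of_real (- g 0)"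
    by (simp only: integral_complex_of_real of_real_minus)
  thus ?thesis by (simp only: of_real_eq_iff)
qed

lemma integrable_weight_mult_L2:
  fixes m :: "real \<Rightarrow> real"
  assumes m: "m \<in> borel_measurable half_line" "\<And>r. 0 < r \<Longrightarrow> \<bar>m r\<bar> \<le> B" and fg: "f \<in> L2" "g \<in> L2"
  shows "integrable half_line (\<lambda>r. complex_of_real (m r) * (f r * g r))"
    and "integrable half_line (\<lambda>r. m r * Re (f r * g r))"
    and "integrable half_line (\<lambda>r. m r * (cmod (f r) * cmod (g r)))"
    and "integrable half_line (\<lambda>r. m r * (cmod (f r))\<^sup>2)"
proof -
  have m': "(\<lambda>r. complex_of_real (m r)) \<in> borel_measurable half_line" using m(1) by simp
  have L: "(\<lambda>r. complex_of_real (m r) * f r) \<in> L2"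
    by (rule L2_bounded_mult[OF fg(1) m']) (use m(2) in auto)
  have *: "integrable half_line (\<lambda>r. (complex_of_real (m r) * f r) * g r)"
    by (rule integrable_mult_L2[OF L fg(2)])
  thus i: "integrable half_line (\<lambda>r. complex_of_real (m r) * (f r * g r))" by (simp add: mult.assoc)
  from integrable_bounded_linear[OF bounded_linear_Re i] show "integrable half_line (\<lambda>r. m r * Re (f r * g r))"
    by simp
  have n: "integrable half_line (\<lambda>r. m r * (cmod (f r) * cmod (g r)))" if "g \<in> L2" for g
  proof (rule Bochner_Integration.integrable_bound[OF integrable_norm_mult_L2[OF L that]])
    show "(\<lambda>r. m r * (cmod (f r) * cmod (g r))) \<in> borel_measurable half_line"
      using m(1) L2_measurable[OF fg(1)] L2_measurable[OF that] by simp
  qed (auto simp: norm_mult abs_mult)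
  from n[OF fg(2)] show "integrable half_line (\<lambda>r. m r * (cmod (f r) * cmod (g r)))" .
  from n[OF fg(1)] show "integrable half_line (\<lambda>r. m r * (cmod (f r))\<^sup>2)" by (simp add: power2_eq_square)
qed

lemma powr_weight_measurable: "(\<lambda>r. (1 + r) powr a) \<in> borel_measurable half_line"
  by (rule borel_measurable_half_lineI) simp

lemma powr_weight_bound: "a \<le> 0 \<Longrightarrow> 0 < r \<Longrightarrow> \<bar>(1 + r) powr a\<bar> \<le> (1 :: real)"
  using powr_mono[of a 0 "1 + r"] by simp

definition weight :: "real \<Rightarrow> (real \<Rightarrow> complex) \<Rightarrow> (real \<Rightarrow> complex)" where
  "weight a = mult_op (\<lambda>r. (1 + r) powr a)"

lemma weight_L2: "a \<le> 0 \<Longrightarrow> f \<in> L2 \<Longrightarrow> weight a f \<in> L2"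
  unfolding weight_def mult_op_def
  by (rule L2_bounded_mult[where B=1]) (use powr_weight_measurable powr_weight_bound in auto)

lemma weight_measurable: "f \<in> borel_measurable half_line \<Longrightarrow> weight a f \<in> borel_measurable half_line"
  unfolding weight_def mult_op_def using powr_weight_measurable by simp

lemma cmod_weight: "0 < r \<Longrightarrow> cmod (weight a f r) = (1 + r) powr a * cmod (f r)"
  by (simp add: weight_def mult_op_def norm_mult)

context repulsive_potential
begin

text \<open>The assumption is the integrated equation tested with the conjugate of u, with y in the
  place of u'. In this form it serves both the solutions on the half line and the truncations of
  solutions to [0, N].\<close>

lemma quadratic_form_bounds:
  assumes L: "u \<in> L2" "y \<in> L2" "f \<in> L2"
    and zero: "(LINT r|half_line. ((of_real (V r) - z) * u r - f r) * cnj (u r) + y r * cnj (y r)) = 0"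
  defines "\<kappa> \<equiv> \<bar>Im z\<bar> + cmod z - Re z" and "J \<equiv> LINT r|half_line. cmod (f r) * cmod (u r)"
  shows "\<kappa> * (L2_norm u)\<^sup>2 \<le> 4 * J" "\<kappa> * (L2_norm y)\<^sup>2 \<le> 4 * cmod z * J"
    "\<kappa> * L2_norm u \<le> 4 * L2_norm f"
proof -
  have i: "integrable half_line (\<lambda>r. complex_of_real ((cmod (y r))\<^sup>2))" "integrable half_line (\<lambda>r. complex_of_real ((cmod (u r))\<^sup>2))"
    "integrable half_line (\<lambda>r. complex_of_real (V r * (cmod (u r))\<^sup>2))" "integrable half_line (\<lambda>r. f r * cnj (u r))"
    using L(1,2)[THEN L2_integrable_sq] integrable_weight_mult_L2(4)[OF V_measurable V_bounded L(1) L(1)]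
      integrable_mult_L2[OF L(3) L2_cnj[OF L(1)]]
    by (simp_all only: complex_of_real_integrable_eq)
  have "0 = (LINT r|half_line. complex_of_real ((cmod (y r))\<^sup>2) + complex_of_real (V r * (cmod (u r))\<^sup>2)
      - z * complex_of_real ((cmod (u r))\<^sup>2) - f r * cnj (u r))"
    unfolding zero[symmetric] of_real_mult complex_norm_square by (simp add: algebra_simps)
  also have "\<dots> = of_real ((L2_norm y)\<^sup>2) + of_real (LINT r|half_line. V r * (cmod (u r))\<^sup>2) - z * of_real ((L2_norm u)\<^sup>2)
     - (LINT r|half_line. f r * cnj (u r))"
    using i by (simp add: L2_norm_sq del: of_real_power of_real_mult)
  finally have eq: "of_real ((L2_norm y)\<^sup>2) + of_real (LINT r|half_line. V r * (cmod (u r))\<^sup>2) - z * of_real ((L2_norm u)\<^sup>2)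
     = (LINT r|half_line. f r * cnj (u r))" by simp
  have "0 \<le> (LINT r|half_line. V r * (cmod (u r))\<^sup>2)"
    by (rule integral_nonneg_AE) (use AE_half_line_pos in eventually_elim, auto intro!: mult_nonneg_nonneg V_nonneg)
  note b = numerical_range_bounds[OF _ this _ eq, folded \<kappa>_def]
  have I: "cmod (LINT r|half_line. f r * cnj (u r)) \<le> J"
    using integral_norm_bound[of half_line "\<lambda>r. f r * cnj (u r)"] by (simp add: J_def norm_mult)
  show k: "\<kappa> * (L2_norm u)\<^sup>2 \<le> 4 * J" using b(1) I by simp
  have "4 * cmod z * cmod (LINT r|half_line. f r * cnj (u r)) \<le> 4 * cmod z * J"
    using I by (intro mult_left_mono) auto
  thus "\<kappa> * (L2_norm y)\<^sup>2 \<le> 4 * cmod z * J" using b(2) by simp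
  show "\<kappa> * L2_norm u \<le> 4 * L2_norm f"
  proof (cases "L2_norm u = 0")
    case False
    have "(\<kappa> * L2_norm u) * L2_norm u \<le> 4 * J" using k by (simp add: power2_eq_square mult.assoc)
    also have "\<dots> \<le> (4 * L2_norm f) * L2_norm u" unfolding J_def using L2_Cauchy_Schwarz[OF L(3,1)] by simp
    finally show ?thesis using False L2_norm_nonneg[of u] by (simp add: mult_le_cancel_right)
  qed simp
qed

end

text \<open>The equation -u'' + V u - z u = f in terms of representatives: Y and W stand for u' and
  u''. Square integrability of all three disposes of boundary terms at infinity.\<close>

locale radial_solution = repulsive_potential V \<delta> for V :: "real \<Rightarrow> real" and \<delta> :: real +
  fixes z :: complex and U Y W f :: "real \<Rightarrow> complex"
  assumes ac: "ac_deriv U Y" "ac_deriv Y W" and L2: "U \<in> L2" "Y \<in> L2" "W \<in> L2" "f \<in> L2"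
    and U0: "U 0 = 0"
    and eq: "AE r in half_line. W r = (of_real (V r) - z) * U r - f r"
begin

definition "\<kappa> = \<bar>Im z\<bar> + cmod z - Re z"

definition "J = (LINT r|half_line. cmod (f r) * cmod (U r))"

lemma numerical_bounds:
  "\<kappa> * (L2_norm U)\<^sup>2 \<le> 4 * J" "\<kappa> * (L2_norm Y)\<^sup>2 \<le> 4 * cmod z * J" "\<kappa> * L2_norm U \<le> 4 * L2_norm f"
proof -
  have "ac_deriv (\<lambda>r. Y r * cnj (U r)) (\<lambda>r. W r * cnj (U r) + Y r * cnj (Y r))"
    by (intro ac_deriv_mult ac_deriv_cnj ac)
  from ac_deriv_integral_half_line[OF this] have "0 = (LINT r|half_line. W r * cnj (U r) + Y r * cnj (Y r))"
    using U0 L2 L2_cnj by (simp add: integrable_mult_L2)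
  also have "\<dots> = (LINT r|half_line. ((of_real (V r) - z) * U r - f r) * cnj (U r) + Y r * cnj (Y r))"
  proof (rule integral_cong_AE)
    show "AE r in half_line. W r * cnj (U r) + Y r * cnj (Y r) = ((of_real (V r) - z) * U r - f r) * cnj (U r) + Y r * cnj (Y r)"
      using eq by eventually_elim simp
    have m: "(\<lambda>r. (of_real (V r) - z) * U r - f r) \<in> borel_measurable half_line"
      using V_measurable L2[THEN L2_measurable] by simp
    show "(\<lambda>r. ((of_real (V r) - z) * U r - f r) * cnj (U r) + Y r * cnj (Y r)) \<in> borel_measurable half_line"
      by (rule borel_measurable_add[OF borel_measurable_times[OF m] borel_measurable_times])
         (intro L2_measurable L2_cnj L2)+
  qed (intro borel_measurable_add borel_measurable_times L2_measurable L2_cnj L2)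
  finally have z0: "(LINT r|half_line. ((of_real (V r) - z) * U r - f r) * cnj (U r) + Y r * cnj (Y r)) = 0" by simp
  note b = quadratic_form_bounds[OF L2(1,2,4) z0, folded \<kappa>_def J_def]
  show "\<kappa> * (L2_norm U)\<^sup>2 \<le> 4 * J" "\<kappa> * (L2_norm Y)\<^sup>2 \<le> 4 * cmod z * J" "\<kappa> * L2_norm U \<le> 4 * L2_norm f"
    by (rule b)+
qed

lemma \<kappa>_nonneg: "0 \<le> \<kappa>"
  unfolding \<kappa>_def using complex_Re_le_cmod[of z] by simp

lemma J_nonneg: "0 \<le> J" unfolding J_def by simp

text \<open>The geometric mean of the first two numerical bounds, combined with Cauchy-Schwarz. It
  controls the error caused by replacing z with |z|, and its factor sqrt |z| matches the weight that
  the main estimate puts on u.\<close>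

lemma cross_term_bound: "\<kappa> * (LINT r|half_line. cmod (U r) * cmod (Y r)) \<le> 4 * sqrt (cmod z) * J"
proof -
  have "(\<kappa> * (L2_norm U * L2_norm Y))\<^sup>2 = (\<kappa> * (L2_norm U)\<^sup>2) * (\<kappa> * (L2_norm Y)\<^sup>2)"
    by (simp add: power2_eq_square)
  also have "\<dots> \<le> (4 * J) * (4 * cmod z * J)"
    by (intro mult_mono numerical_bounds(1,2) mult_nonneg_nonneg \<kappa>_nonneg J_nonneg) auto
  also have "\<dots> = (4 * sqrt (cmod z) * J)\<^sup>2" by (simp add: power_mult_distrib power2_eq_square)
  finally have "\<kappa> * (L2_norm U * L2_norm Y) \<le> 4 * sqrt (cmod z) * J"
    by (rule power2_le_imp_le) (simp add: J_nonneg)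
  moreover have "\<kappa> * (LINT r|half_line. cmod (U r) * cmod (Y r)) \<le> \<kappa> * (L2_norm U * L2_norm Y)"
    by (intro mult_left_mono L2_Cauchy_Schwarz L2 \<kappa>_nonneg)
  ultimately show ?thesis by simp
qed

lemma V_weighted_integrable:
  "integrable half_line (\<lambda>r. V r * (cmod (U r))\<^sup>2 / (1 + r))"
proof -
  have "(\<lambda>r. V r * (1 + r) powr (-1)) \<in> borel_measurable half_line"
    by (rule borel_measurable_times[OF V_measurable powr_weight_measurable])
  moreover have "\<bar>V r * (1 + r) powr (-1)\<bar> \<le> V 0 * 1" if "0 < r" for r
    unfolding abs_mult using that V_nonneg[of 0] by (intro mult_mono V_bounded powr_weight_bound) auto
  ultimately have "integrable half_line (\<lambda>r. V r * (1 + r) powr (-1) * (cmod (U r))\<^sup>2)"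
    by (rule integrable_weight_mult_L2(4)[OF _ _ L2(1) L2(1)])
  also have "?this \<longleftrightarrow> ?thesis"
    by (intro Bochner_Integration.integrable_cong) (auto simp: powr_minus_divide)
  finally show ?thesis .
qed

text \<open>The multiplier is \<open>m Y\<close> with the increasing bounded weight \<open>m = M - (1 + r) powr - \<epsilon>\<close>;
  \<open>M\<close> is so large that \<open>\<delta> m / (1 + r) - m'\<close> dominates \<open>\<delta> / (2 (1 + r))\<close>.\<close>

lemma multiplier_estimate:
  assumes s: "s > 1/2"
  defines "\<epsilon> \<equiv> 2 * s - 1"
  defines "M \<equiv> 2 + 2 * \<epsilon> / \<delta>"
  shows "\<epsilon> * (LINT r|half_line. (1 + r) powr (-2 * s) * ((cmod (Y r))\<^sup>2 + cmod z * (cmod (U r))\<^sup>2))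
      + \<delta> / 2 * (LINT r|half_line. V r * (cmod (U r))\<^sup>2 / (1 + r))
    \<le> 2 * M * (LINT r|half_line. cmod (f r) * cmod (Y r)) + 8 * M * sqrt (cmod z) * J"
proof -
  have \<epsilon>: "\<epsilon> > 0" and M: "M \<ge> 2" "\<delta> * (M - 1) = \<delta> + 2 * \<epsilon>"
    using s \<delta>_pos by (auto simp: \<epsilon>_def M_def field_simps)
  define m where "m r = M - (1 + r) powr (-\<epsilon>)" for r
  define m' where "m' r = \<epsilon> * (1 + r) powr (-\<epsilon> - 1)" for r
  have m: "m r \<le> M" "M - 1 \<le> m r" "1 \<le> m r" "0 \<le> m' r" "m' r \<le> \<epsilon>" "m' r * (1 + r) \<le> \<epsilon>" if "0 \<le> r" for r
  proof -
    have p: "(1 + r) powr (-\<epsilon>) \<le> 1" "(1 + r) powr (-\<epsilon> - 1) \<le> 1"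
      using that \<epsilon> powr_mono[of "-\<epsilon>" 0 "1 + r"] powr_mono[of "-\<epsilon> - 1" 0 "1 + r"] by auto
    show "m r \<le> M" "M - 1 \<le> m r" "0 \<le> m' r" "m' r \<le> \<epsilon>"
      using p \<epsilon> by (auto simp: m_def m'_def mult_left_le)
    thus "1 \<le> m r" using M by simp
    have "m' r * (1 + r) = \<epsilon> * ((1 + r) powr (-\<epsilon> - 1) * (1 + r) powr 1)"
      using that by (simp add: m'_def)
    also have "\<dots> = \<epsilon> * (1 + r) powr (-\<epsilon>)" by (simp only: powr_add[symmetric]) simp
    also have "\<dots> \<le> \<epsilon>" using p \<epsilon> by (simp add: mult_left_le)
    finally show "m' r * (1 + r) \<le> \<epsilon>" .
  qed
  have acm: "ac_deriv (\<lambda>r. complex_of_real (m r)) (\<lambda>r. complex_of_real (m' r))"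
    using ac_deriv_diff[OF ac_deriv_const[of "of_real M"] ac_deriv_powr_weight[of "-\<epsilon>"]]
    by (simp add: m_def m'_def)
  define t where "t r = Re (cnj (U r) * Y r)" for r
  \<comment> \<open>The energy without its V part. The term m V |u|^2 has no absolutely continuous
    derivative; it enters through \<open>v\<close> below, whose integral is nonnegative by
    \<open>V_integral_nonneg\<close>.\<close>
  define q where "q r = m r * ((cmod (Y r))\<^sup>2 + cmod z * (cmod (U r))\<^sup>2)" for r
  define q' where "q' r = m' r * ((cmod (Y r))\<^sup>2 + cmod z * (cmod (U r))\<^sup>2)
      + m r * (2 * Re (cnj (Y r) * W r) + cmod z * (2 * t r))" for r
  define g where "g r = m r * (cmod (U r))\<^sup>2" for r
  define g' where "g' r = m' r * (cmod (U r))\<^sup>2 + m r * (2 * t r)" for r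
  have acg: "ac_deriv (\<lambda>r. complex_of_real (g r)) (\<lambda>r. complex_of_real (g' r))"
    unfolding g_def g'_def t_def by (rule ac_deriv_of_real_mult[OF acm ac_deriv_norm_sq[OF ac(1)]])
  have "ac_deriv (\<lambda>r. complex_of_real ((cmod (Y r))\<^sup>2 + cmod z * (cmod (U r))\<^sup>2))
     (\<lambda>r. complex_of_real (2 * Re (cnj (Y r) * W r) + cmod z * (2 * t r)))"
    using ac_deriv_add[OF ac_deriv_norm_sq[OF ac(2)] ac_deriv_cmult[OF ac_deriv_norm_sq[OF ac(1)], of "of_real (cmod z)"]]
    by (simp only: t_def of_real_add of_real_mult)
  hence acq: "ac_deriv (\<lambda>r. complex_of_real (q r)) (\<lambda>r. complex_of_real (q' r))"
    unfolding q_def q'_def by (rule ac_deriv_of_real_mult[OF acm])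
  have mm: "m \<in> borel_measurable half_line" "m' \<in> borel_measurable half_line"
    unfolding m_def m'_def using powr_weight_measurable by simp_all
  have mb: "\<bar>m r\<bar> \<le> M" "\<bar>m' r\<bar> \<le> \<epsilon>" if "0 < r" for r using m[of r] that by auto
  have vm: "(\<lambda>r. V r * m r) \<in> borel_measurable half_line" "(\<lambda>r. V r * m' r) \<in> borel_measurable half_line"
     "(\<lambda>r. V r * m r / (1 + r)) \<in> borel_measurable half_line"
    using mm V_measurable borel_measurable_half_lineI[of "\<lambda>r. 1 + r"] by auto
  have vb: "\<bar>V r * m r\<bar> \<le> V 0 * M" "\<bar>V r * m' r\<bar> \<le> V 0 * \<epsilon>" "\<bar>V r * m r / (1 + r)\<bar> \<le> V 0 * M" if "0 < r" for r
  proof -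
    have V0: "0 \<le> V 0" by (rule V_nonneg) simp
    show 1: "\<bar>V r * m r\<bar> \<le> V 0 * M" "\<bar>V r * m' r\<bar> \<le> V 0 * \<epsilon>" unfolding abs_mult
      using that V0 by (auto intro!: mult_mono V_bounded mb)
    have "\<bar>V r * m r / (1 + r)\<bar> \<le> \<bar>V r * m r\<bar>" using that by (simp add: abs_div divide_le_eq mult_left_le_one_le mult_right_le_one_le field_simps)
    thus "\<bar>V r * m r / (1 + r)\<bar> \<le> V 0 * M" using 1 by simp
  qed
  note im = integrable_weight_mult_L2(4)[OF mm(1) mb(1) L2(2) L2(2)] integrable_weight_mult_L2(4)[OF mm(1) mb(1) L2(1) L2(1)]
    integrable_weight_mult_L2(2)[OF mm(1) mb(1) L2_cnj[OF L2(1)] L2(2), folded t_def] integrable_weight_mult_L2(2)[OF mm(1) mb(1) L2_cnj[OF L2(2)] L2(3)]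
  note im' = integrable_weight_mult_L2(4)[OF mm(2) mb(2) L2(2) L2(2)] integrable_weight_mult_L2(4)[OF mm(2) mb(2) L2(1) L2(1)]
  note iV = integrable_weight_mult_L2(2)[OF vm(1) vb(1) L2_cnj[OF L2(1)] L2(2), folded t_def]
    integrable_weight_mult_L2(4)[OF vm(2) vb(2) L2(1) L2(1)] integrable_weight_mult_L2(4)[OF vm(3) vb(3) L2(1) L2(1)]
  have iq: "integrable half_line q" unfolding q_def
    using Bochner_Integration.integrable_add[OF im(1) integrable_mult_right[OF im(2), of "cmod z"]]
    by (simp add: algebra_simps)
  have iq': "integrable half_line q'"
  proof -
    have "integrable half_line (\<lambda>r. m' r * (cmod (Y r))\<^sup>2 + cmod z * (m' r * (cmod (U r))\<^sup>2) + 2 * (m r * Re (cnj (Y r) * W r)) + 2 * cmod z * (m r * t r))"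
      by (intro Bochner_Integration.integrable_add integrable_mult_right im im')
    thus ?thesis unfolding q'_def by (simp add: algebra_simps)
  qed
  define v where "v r = V r * (g' r - \<delta> * g r / (1 + r))" for r
  have iv: "integrable half_line v"
  proof -
    have "integrable half_line (\<lambda>r. V r * m' r * (cmod (U r))\<^sup>2 + 2 * (V r * m r * t r) - \<delta> * (V r * m r / (1 + r) * (cmod (U r))\<^sup>2))"
      by (intro Bochner_Integration.integrable_add Bochner_Integration.integrable_diff integrable_mult_right iV)
    thus ?thesis unfolding v_def g_def g'_def by (simp add: algebra_simps)
  qed
  have v0: "0 \<le> (LINT r|half_line. v r)"
    unfolding v_def
  proof (rule V_integral_nonneg[OF acg])
    show "0 \<le> g r" if "0 \<le> r" for r using m[OF that] by (simp add: g_def)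
    show "g 0 = 0" by (simp add: g_def U0)
    show "integrable half_line (\<lambda>r. V r * (g' r - \<delta> * g r / (1 + r)))" using iv unfolding v_def .
  qed
  \<comment> \<open>The boundary term is -m(0) |u'(0)|^2, since u(0) = 0; it has the favourable sign
    because m(0) = M - 1 > 0.\<close>
  have q0: "(LINT r|half_line. q' r) \<le> 0"
    using ac_deriv_of_real_integral[OF acq iq iq'] m[of 0] by (simp add: q_def)
  have if': "integrable half_line (\<lambda>r. cmod (U r) * cmod (Y r))" "integrable half_line (\<lambda>r. cmod (f r) * cmod (Y r))"
    by (intro integrable_norm_mult_L2 L2)+
  have pointwise: "AE r in half_line. m' r * ((cmod (Y r))\<^sup>2 + cmod z * (cmod (U r))\<^sup>2) + \<delta> / 2 * (V r * (cmod (U r))\<^sup>2 / (1 + r))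
     \<le> q' r - v r + 2 * M * \<kappa> * (cmod (U r) * cmod (Y r)) + 2 * M * (cmod (f r) * cmod (Y r))"
    using eq AE_half_line_pos
  proof eventually_elim
    case (elim r)
    have Vr: "0 \<le> V r" and mr: "0 \<le> m r" "m r \<le> M" using elim(2) V_nonneg[of r] m[of r] by auto
    have ReW: "Re (cnj (Y r) * W r) = V r * t r - Re (z * U r * cnj (Y r)) - Re (f r * cnj (Y r))"
      unfolding elim(1) t_def by (simp add: algebra_simps)
    have 1: "2 * m r * (cmod z * t r - Re (z * U r * cnj (Y r))) \<ge> - (2 * M * \<kappa> * (cmod (U r) * cmod (Y r)))"
    proof -
      \<comment> \<open>The energy was weighted with |z| while the equation contains z. The mismatch
        carries the factor |z| - z, whose modulus is at most \<kappa>, so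
        \<open>cross_term_bound\<close> applies.\<close>
      have "cmod z * t r - Re (z * U r * cnj (Y r)) = Re ((of_real (cmod z) - z) * (U r * cnj (Y r)))"
        by (simp add: t_def algebra_simps)
      hence "\<bar>cmod z * t r - Re (z * U r * cnj (Y r))\<bar> \<le> cmod ((of_real (cmod z) - z) * (U r * cnj (Y r)))"
        using abs_Re_le_cmod by metis
      also have "\<dots> = cmod (of_real (cmod z) - z) * (cmod (U r) * cmod (Y r))" by (simp add: norm_mult)
      also have "\<dots> \<le> \<kappa> * (cmod (U r) * cmod (Y r))"
      proof (intro mult_right_mono)
        have "cmod (of_real (cmod z) - z) \<le> \<bar>cmod z - Re z\<bar> + \<bar>Im z\<bar>"
          using cmod_le[of "of_real (cmod z) - z"] by simp
        thus "cmod (of_real (cmod z) - z) \<le> \<kappa>" using complex_Re_le_cmod[of z] by (simp add: \<kappa>_def)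
      qed simp
      finally have "m r * \<bar>cmod z * t r - Re (z * U r * cnj (Y r))\<bar> \<le> M * (\<kappa> * (cmod (U r) * cmod (Y r)))"
        using mr by (intro mult_mono) auto
      moreover have "m r * (- \<bar>cmod z * t r - Re (z * U r * cnj (Y r))\<bar>) \<le> m r * (cmod z * t r - Re (z * U r * cnj (Y r)))"
        using mr(1) by (intro mult_left_mono) simp_all
      ultimately show ?thesis unfolding mult_minus_right mult.assoc by linarith
    qed
    have 2: "- (2 * m r * Re (f r * cnj (Y r))) \<ge> - (2 * M * (cmod (f r) * cmod (Y r)))"
    proof -
      have "Re (f r * cnj (Y r)) \<le> cmod (f r) * cmod (Y r)"
        using complex_Re_le_cmod[of "f r * cnj (Y r)"] by (simp add: norm_mult)
      hence "m r * Re (f r * cnj (Y r)) \<le> m r * (cmod (f r) * cmod (Y r))" using mr by (intro mult_left_mono)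
      also have "\<dots> \<le> M * (cmod (f r) * cmod (Y r))" using mr by (intro mult_right_mono) auto
      finally show ?thesis by simp
    qed
    have 3: "\<delta> / 2 * (V r * (cmod (U r))\<^sup>2 / (1 + r)) \<le> V r * (cmod (U r))\<^sup>2 * (\<delta> * m r / (1 + r) - m' r)"
    proof -
      have "\<delta> * (M - 1) \<le> \<delta> * m r" using m(2)[of r] elim(2) \<delta>_pos by (intro mult_left_mono) auto
      hence "\<delta> / 2 \<le> \<delta> * m r - m' r * (1 + r)" using M m(6)[of r] elim(2) \<epsilon> \<delta>_pos by simp
      hence "\<delta> / 2 / (1 + r) \<le> (\<delta> * m r - m' r * (1 + r)) / (1 + r)" using elim(2) by (intro divide_right_mono) auto
      also have "\<dots> = \<delta> * m r / (1 + r) - m' r" using elim(2) by (simp add: field_simps)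
      finally have "V r * (cmod (U r))\<^sup>2 * (\<delta> / 2 / (1 + r)) \<le> V r * (cmod (U r))\<^sup>2 * (\<delta> * m r / (1 + r) - m' r)"
        using Vr by (intro mult_left_mono) auto
      thus ?thesis by (simp add: field_simps)
    qed
    \<comment> \<open>The terms 2 m V Re (conj u u') of \<open>q'\<close> and \<open>v\<close>
      cancel, so V remains only as a factor of |u|^2.\<close>
    have "q' r - v r = m' r * ((cmod (Y r))\<^sup>2 + cmod z * (cmod (U r))\<^sup>2)
        + V r * (cmod (U r))\<^sup>2 * (\<delta> * m r / (1 + r) - m' r)
        + 2 * m r * (cmod z * t r - Re (z * U r * cnj (Y r))) - 2 * m r * Re (f r * cnj (Y r))"
      unfolding q'_def v_def g_def g'_def ReW by (simp add: algebra_simps)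
    thus ?case using 1 2 3 by linarith
  qed
  have il: "integrable half_line (\<lambda>r. m' r * ((cmod (Y r))\<^sup>2 + cmod z * (cmod (U r))\<^sup>2))"
    using Bochner_Integration.integrable_add[OF im'(1) integrable_mult_right[OF im'(2), of "cmod z"]]
    by (simp add: algebra_simps)
  have "(LINT r|half_line. m' r * ((cmod (Y r))\<^sup>2 + cmod z * (cmod (U r))\<^sup>2)) + \<delta> / 2 * (LINT r|half_line. V r * (cmod (U r))\<^sup>2 / (1 + r))
     = (LINT r|half_line. m' r * ((cmod (Y r))\<^sup>2 + cmod z * (cmod (U r))\<^sup>2) + \<delta> / 2 * (V r * (cmod (U r))\<^sup>2 / (1 + r)))"
    using il V_weighted_integrable by (simp del: times_divide_eq_right times_divide_eq_left)
  also have "\<dots> \<le> (LINT r|half_line. q' r - v r + 2 * M * \<kappa> * (cmod (U r) * cmod (Y r)) + 2 * M * (cmod (f r) * cmod (Y r)))"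
    by (rule integral_mono_AE[OF _ _ pointwise])
       (intro Bochner_Integration.integrable_add Bochner_Integration.integrable_diff integrable_mult_right il V_weighted_integrable iq' iv if')+
  also have "\<dots> = (LINT r|half_line. q' r) - (LINT r|half_line. v r) + 2 * M * \<kappa> * (LINT r|half_line. cmod (U r) * cmod (Y r))
     + 2 * M * (LINT r|half_line. cmod (f r) * cmod (Y r))"
    using iq' iv if' by simp
  also have "\<dots> \<le> 2 * M * (\<kappa> * (LINT r|half_line. cmod (U r) * cmod (Y r))) + 2 * M * (LINT r|half_line. cmod (f r) * cmod (Y r))"
    using v0 q0 by simp
  also have "\<dots> \<le> 2 * M * (4 * sqrt (cmod z) * J) + 2 * M * (LINT r|half_line. cmod (f r) * cmod (Y r))"
    using M by (intro add_right_mono mult_left_mono cross_term_bound) auto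
  finally have est: "(LINT r|half_line. m' r * ((cmod (Y r))\<^sup>2 + cmod z * (cmod (U r))\<^sup>2)) + \<delta> / 2 * (LINT r|half_line. V r * (cmod (U r))\<^sup>2 / (1 + r))
     \<le> 2 * M * (4 * sqrt (cmod z) * J) + 2 * M * (LINT r|half_line. cmod (f r) * cmod (Y r))" .
  have "m' r = \<epsilon> * (1 + r) powr (-2 * s)" for r by (simp add: m'_def \<epsilon>_def)
  hence "(LINT r|half_line. m' r * ((cmod (Y r))\<^sup>2 + cmod z * (cmod (U r))\<^sup>2))
     = \<epsilon> * (LINT r|half_line. (1 + r) powr (-2 * s) * ((cmod (Y r))\<^sup>2 + cmod z * (cmod (U r))\<^sup>2))"
    by (simp add: mult.assoc)
  with est show ?thesis by (simp add: mult_ac)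
qed

text \<open>Moving the weight of f onto u' and u bounds the right side of
  \<open>multiplier_estimate\<close> by a multiple of ||g|| S, where S^2 is the weighted energy on
  the left. Dividing by S bounds S, and inserting this bound once more controls the V term.\<close>

lemma weighted_estimates:
  assumes s: "s > 1/2" and g: "g \<in> L2" and f: "f = weight (-s) g"
  defines "\<epsilon> \<equiv> 2 * s - 1"
  defines "M \<equiv> 2 + 2 * \<epsilon> / \<delta>"
  shows "L2_norm (weight (-s) Y) \<le> 10 * M / \<epsilon> * L2_norm g"
    and "sqrt (cmod z) * L2_norm (weight (-s) U) \<le> 10 * M / \<epsilon> * L2_norm g"
    and "\<delta> / 2 * (LINT r|half_line. V r * (cmod (U r))\<^sup>2 / (1 + r)) \<le> 100 * M\<^sup>2 / \<epsilon> * (L2_norm g)\<^sup>2"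
proof -
  have \<epsilon>: "\<epsilon> > 0" and M: "M > 0" using s \<delta>_pos by (auto simp: \<epsilon>_def M_def add_pos_nonneg)
  define F where "F = L2_norm g"
  define y where "y = L2_norm (weight (-s) Y)"
  define u where "u = L2_norm (weight (-s) U)"
  have wL: "weight (-s) Y \<in> L2" "weight (-s) U \<in> L2" using s by (auto intro!: weight_L2 L2)
  have pair: "(LINT r|half_line. cmod (f r) * cmod (X r)) \<le> F * L2_norm (weight (-s) X)" if "weight (-s) X \<in> L2" for X
  proof -
    have "(LINT r|half_line. cmod (f r) * cmod (X r)) = (LINT r|half_line. cmod (g r) * cmod (weight (-s) X r))"
      by (rule Bochner_Integration.integral_cong) (auto simp: f cmod_weight)
    also have "\<dots> \<le> F * L2_norm (weight (-s) X)" unfolding F_def by (rule L2_Cauchy_Schwarz[OF g that])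
    finally show ?thesis .
  qed
  define S where "S = sqrt (y\<^sup>2 + cmod z * u\<^sup>2)"
  define vv where "vv = (LINT r|half_line. V r * (cmod (U r))\<^sup>2 / (1 + r))"
  have nn: "0 \<le> y" "0 \<le> u" "0 \<le> F" "0 \<le> S" by (auto simp: y_def u_def F_def S_def)
  have vv: "0 \<le> vv" unfolding vv_def
    by (rule integral_nonneg_AE) (use AE_half_line_pos in eventually_elim, auto intro!: mult_nonneg_nonneg divide_nonneg_nonneg V_nonneg)
  have sq: "(1 + r) powr (-2 * s) * (cmod (X r))\<^sup>2 = (cmod (weight (-s) X r))\<^sup>2" if "0 < r" for r X
    using that by (simp add: cmod_weight power_mult_distrib power2_eq_square flip: powr_add)
  have "(LINT r|half_line. (1 + r) powr (-2 * s) * ((cmod (Y r))\<^sup>2 + cmod z * (cmod (U r))\<^sup>2))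
     = (LINT r|half_line. (cmod (weight (-s) Y r))\<^sup>2 + cmod z * (cmod (weight (-s) U r))\<^sup>2)"
    by (rule Bochner_Integration.integral_cong) (auto simp: distrib_left mult.left_commute[of _ "cmod z"] simp flip: sq)
  also have "\<dots> = S\<^sup>2"
    using wL[THEN L2_integrable_sq] by (simp add: S_def y_def u_def L2_norm_sq)
  finally have S2: "(LINT r|half_line. (1 + r) powr (-2 * s) * ((cmod (Y r))\<^sup>2 + cmod z * (cmod (U r))\<^sup>2)) = S\<^sup>2" .
  have yS: "y \<le> S" unfolding S_def by (rule real_le_rsqrt) simp
  have uS: "sqrt (cmod z) * u \<le> S" unfolding S_def by (rule real_le_rsqrt) (simp add: power_mult_distrib)
  have "\<epsilon> * S\<^sup>2 + \<delta> / 2 * vv \<le> 2 * M * (F * y) + 8 * M * sqrt (cmod z) * (F * u)"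
  proof -
    have "2 * M * (LINT r|half_line. cmod (f r) * cmod (Y r)) \<le> 2 * M * (F * y)"
      unfolding y_def using M by (intro mult_left_mono pair wL) auto
    moreover have "8 * M * sqrt (cmod z) * J \<le> 8 * M * sqrt (cmod z) * (F * u)"
      unfolding u_def J_def using M by (intro mult_left_mono pair wL) auto
    ultimately show ?thesis
      using multiplier_estimate[OF s] unfolding S2 vv_def M_def \<epsilon>_def by linarith
  qed
  also have "\<dots> = 2 * M * F * y + 8 * M * F * (sqrt (cmod z) * u)" by (simp add: mult_ac)
  also have "\<dots> \<le> 2 * M * F * S + 8 * M * F * S"
    using yS uS M nn by (intro add_mono mult_left_mono) auto
  \<comment> \<open>The constant 10 is 2 + 8: both weighted norms are replaced by S.\<close>
  finally have main: "\<epsilon> * S\<^sup>2 + \<delta> / 2 * vv \<le> 10 * M * F * S" by (simp add: mult_ac)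
  have S: "S \<le> 10 * M / \<epsilon> * F"
  proof (cases "S = 0")
    case False
    have "0 \<le> \<delta> / 2 * vv" using vv \<delta>_pos by simp
    hence "\<epsilon> * S * S \<le> 10 * M * F * S" using main unfolding power2_eq_square mult.assoc by linarith
    hence "\<epsilon> * S \<le> 10 * M * F" using False nn(4) by (simp add: mult_le_cancel_right)
    thus ?thesis using \<epsilon> by (simp add: field_simps)
  qed (use nn M \<epsilon> in auto)
  show "L2_norm (weight (-s) Y) \<le> 10 * M / \<epsilon> * L2_norm g" using yS S unfolding y_def F_def by linarith
  show "sqrt (cmod z) * L2_norm (weight (-s) U) \<le> 10 * M / \<epsilon> * L2_norm g" using uS S unfolding u_def F_def by linarith
  have "\<delta> / 2 * vv \<le> 10 * M * F * S" using main \<epsilon> zero_le_power2[of S] by (smt (verit) mult_nonneg_nonneg)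
  also have "\<dots> \<le> 10 * M * F * (10 * M / \<epsilon> * F)" using S M nn by (intro mult_left_mono) auto
  also have "\<dots> = 100 * M\<^sup>2 / \<epsilon> * F\<^sup>2" by (simp add: power2_eq_square)
  finally show "\<delta> / 2 * (LINT r|half_line. V r * (cmod (U r))\<^sup>2 / (1 + r)) \<le> 100 * M\<^sup>2 / \<epsilon> * (L2_norm g)\<^sup>2"
    unfolding vv_def F_def .
qed

end

section \<open>Hardy's inequality and the symmetry of the resolvent\<close>

lemma Hardy_inequality:
  assumes ac: "ac_deriv U Y" and L2: "U \<in> L2" "Y \<in> L2" and U0: "U 0 = 0" and a: "0 < a"
  shows "(2 * a + 1) * L2_norm (weight (-a - 1) U) \<le> 2 * L2_norm (weight (-a) Y)"
proof -
  \<comment> \<open>The integral of p' is -p(0) = 0. It consists of -(2 a + 1) times the squared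
    norm to be bounded and a cross term, whose weight exponent 2 a + 1 splits as (a + 1) + a for
    Cauchy-Schwarz.\<close>
  define p where "p r = (1 + r) powr (-2 * a - 1) * (cmod (U r))\<^sup>2" for r
  define p' where "p' r = ((-2 * a - 1) * (1 + r) powr (-2 * a - 1 - 1)) * (cmod (U r))\<^sup>2
     + (1 + r) powr (-2 * a - 1) * (2 * Re (cnj (U r) * Y r))" for r
  have acp: "ac_deriv (\<lambda>r. complex_of_real (p r)) (\<lambda>r. complex_of_real (p' r))"
    unfolding p_def p'_def by (rule ac_deriv_of_real_mult[OF ac_deriv_powr_weight ac_deriv_norm_sq[OF ac]])
  have b: "\<bar>(1 + r) powr (-2 * a - 1)\<bar> \<le> 1" "\<bar>(1 + r) powr (-2 * a - 1 - 1)\<bar> \<le> 1" if "0 < r" for r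
    using that a by (intro powr_weight_bound; simp)+
  note ip = integrable_weight_mult_L2(4)[OF powr_weight_measurable b(1) L2(1) L2(1)]
  note i1 = integrable_weight_mult_L2(4)[OF powr_weight_measurable b(2) L2(1) L2(1)]
  note i2 = integrable_weight_mult_L2(2)[OF powr_weight_measurable b(1) L2_cnj[OF L2(1)] L2(2)]
  have wL: "weight (-a - 1) U \<in> L2" "weight (-a) Y \<in> L2" using a by (auto intro!: weight_L2 L2)
  have i': "integrable half_line p'"
  proof -
    have "integrable half_line (\<lambda>r. (-2 * a - 1) * ((1 + r) powr (-2 * a - 1 - 1) * (cmod (U r))\<^sup>2) + 2 * ((1 + r) powr (-2 * a - 1) * Re (cnj (U r) * Y r)))"
      by (intro Bochner_Integration.integrable_add integrable_mult_right i1 i2)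
    thus ?thesis unfolding p'_def by (simp add: algebra_simps)
  qed
  have "0 = (LINT r|half_line. p' r)"
    using ac_deriv_of_real_integral[OF acp _ i'] ip U0 unfolding p_def by simp
  also have "\<dots> = (LINT r|half_line. (-2 * a - 1) * ((1 + r) powr (-2 * a - 1 - 1) * (cmod (U r))\<^sup>2) + 2 * ((1 + r) powr (-2 * a - 1) * Re (cnj (U r) * Y r)))"
    by (rule Bochner_Integration.integral_cong) (simp_all only: p'_def mult_ac)
  also have "\<dots> = (-2 * a - 1) * (LINT r|half_line. (1 + r) powr (-2 * a - 1 - 1) * (cmod (U r))\<^sup>2) + 2 * (LINT r|half_line. (1 + r) powr (-2 * a - 1) * Re (cnj (U r) * Y r))"
    using integrable_mult_right[OF i1, of "-2 * a - 1"] integrable_mult_right[OF i2, of 2] by simp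
  also have "(LINT r|half_line. (1 + r) powr (-2 * a - 1 - 1) * (cmod (U r))\<^sup>2) = (L2_norm (weight (-a - 1) U))\<^sup>2"
    unfolding L2_norm_sq
  proof (rule Bochner_Integration.integral_cong[OF refl])
    fix r assume "r \<in> space half_line"
    moreover have "- 2 * a - 1 - 1 = (- a - 1) + (- a - 1)" by simp
    ultimately show "(1 + r) powr (-2 * a - 1 - 1) * (cmod (U r))\<^sup>2 = (cmod (weight (-a - 1) U r))\<^sup>2"
      unfolding powr_add[symmetric] by (simp only: powr_add) (simp add: cmod_weight power2_eq_square)
  qed
  finally have "(2 * a + 1) * (L2_norm (weight (-a - 1) U))\<^sup>2 = 2 * (LINT r|half_line. (1 + r) powr (-2 * a - 1) * Re (cnj (U r) * Y r))"
    by (simp add: algebra_simps)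
  also have "(LINT r|half_line. (1 + r) powr (-2 * a - 1) * Re (cnj (U r) * Y r)) \<le> (LINT r|half_line. cmod (weight (-a - 1) U r) * cmod (weight (-a) Y r))"
  proof (rule integral_mono_AE[OF i2 integrable_norm_mult_L2[OF wL]])
    show "AE r in half_line. (1 + r) powr (-2 * a - 1) * Re (cnj (U r) * Y r) \<le> cmod (weight (-a - 1) U r) * cmod (weight (-a) Y r)"
      using AE_half_line_pos
    proof eventually_elim
      case (elim r)
      have "(1 + r) powr (-2 * a - 1) * Re (cnj (U r) * Y r) \<le> (1 + r) powr (-2 * a - 1) * (cmod (U r) * cmod (Y r))"
        using complex_Re_le_cmod[of "cnj (U r) * Y r"] by (intro mult_left_mono) (auto simp: norm_mult)
      moreover have "(1 + r) powr (-2 * a - 1) = (1 + r) powr (-a - 1) * (1 + r) powr (-a)"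
        by (simp flip: powr_add)
      hence "(1 + r) powr (-2 * a - 1) * (cmod (U r) * cmod (Y r)) = cmod (weight (-a - 1) U r) * cmod (weight (-a) Y r)"
        by (simp only: cmod_weight[OF elim] mult_ac)
      ultimately show ?case by linarith
    qed
  qed
  also have "\<dots> \<le> L2_norm (weight (-a - 1) U) * L2_norm (weight (-a) Y)" by (rule L2_Cauchy_Schwarz[OF wL])
  finally have *: "((2 * a + 1) * L2_norm (weight (-a - 1) U)) * L2_norm (weight (-a - 1) U) \<le> (2 * L2_norm (weight (-a) Y)) * L2_norm (weight (-a - 1) U)"
    by (simp add: power2_eq_square mult_ac)
  show ?thesis
  proof (cases "L2_norm (weight (-a - 1) U) = 0")
    case False
    hence "0 < L2_norm (weight (-a - 1) U)" using L2_norm_nonneg[of "weight (-a - 1) U"] by linarith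
    from mult_right_le_imp_le[OF * this] show ?thesis .
  qed simp
qed

text \<open>The Wronskian u' v - u v' vanishes at 0 and at infinity, and its derivative is f' U - f
  U' in the notation of the statement. The pairing is bilinear without conjugation, so both
  solutions belong to the same z.\<close>

lemma radial_solution_symmetric:
  assumes "radial_solution V \<delta> z U Y W f" "radial_solution V \<delta> z U' Y' W' f'"
  shows "(LINT r|half_line. f r * U' r) = (LINT r|half_line. f' r * U r)"
proof -
  interpret A: radial_solution V \<delta> z U Y W f by fact
  interpret B: radial_solution V \<delta> z U' Y' W' f' by fact
  have "ac_deriv (\<lambda>r. Y r * U' r - U r * Y' r) (\<lambda>r. (W r * U' r + Y r * Y' r) - (Y r * Y' r + U r * W' r))"
    by (intro ac_deriv_diff ac_deriv_mult A.ac B.ac)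
  from ac_deriv_integral_half_line[OF this]
  have "(LINT r|half_line. (W r * U' r + Y r * Y' r) - (Y r * Y' r + U r * W' r)) = 0"
    using A.U0 B.U0 A.L2 B.L2 by (simp add: integrable_mult_L2)
  also have "(LINT r|half_line. (W r * U' r + Y r * Y' r) - (Y r * Y' r + U r * W' r)) = (LINT r|half_line. f' r * U r - f r * U' r)"
  proof (rule integral_cong_AE)
    show "AE r in half_line. (W r * U' r + Y r * Y' r) - (Y r * Y' r + U r * W' r) = f' r * U r - f r * U' r"
      using A.eq B.eq
    proof eventually_elim
      case (elim r)
      show ?case unfolding elim by (simp add: algebra_simps)
    qed
  qed (intro borel_measurable_diff borel_measurable_add borel_measurable_times A.L2[THEN L2_measurable] B.L2[THEN L2_measurable])+
  also have "\<dots> = (LINT r|half_line. f' r * U r) - (LINT r|half_line. f r * U' r)"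
    using A.L2 B.L2 by (simp add: integrable_mult_L2)
  finally show ?thesis by simp
qed

section \<open>Existence of solutions\<close>

text \<open>Each integration gains a factor 1 / l in the sup norm with weight exp (-l r), which is
  the source of the contraction below.\<close>

lemma half_line_integral_exp_bound:
  fixes u :: "real \<Rightarrow> complex"
  assumes u: "set_integrable half_line {..r} u" and K: "0 \<le> K" and l: "0 < l" and r: "0 \<le> r"
    and b: "\<And>t. 0 < t \<Longrightarrow> cmod (u t) \<le> K * exp (l * t)"
  shows "cmod (LINT t:{..r}|half_line. u t) \<le> K / l * exp (l * r)"
proof -
  have ac: "ac_deriv (\<lambda>r. complex_of_real (K / l * exp (l * r))) (\<lambda>r. complex_of_real (K * exp (l * r)))"
    by (rule ac_deriv_real_C1) (use l in \<open>auto intro!: derivative_eq_intros continuous_intros\<close>)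
  have "cmod (LINT t:{..r}|half_line. u t) \<le> (LINT t:{..r}|half_line. cmod (u t))"
    unfolding set_lebesgue_integral_def
    by (rule order_trans[OF integral_norm_bound]) simp
  also have "\<dots> \<le> (LINT t:{..r}|half_line. K * exp (l * t))"
    unfolding set_lebesgue_integral_def
  proof (rule integral_mono_AE)
    show "integrable half_line (\<lambda>t. indicator {..r} t *\<^sub>R cmod (u t))"
      using integrable_norm[OF u[unfolded set_integrable_def]] by simp
    show "integrable half_line (\<lambda>t. indicator {..r} t *\<^sub>R (K * exp (l * t)))"
      using ac_deriv_of_real(1)[OF ac] by (simp add: set_integrable_def)
    show "AE t in half_line. indicator {..r} t *\<^sub>R cmod (u t) \<le> indicator {..r} t *\<^sub>R (K * exp (l * t))"
      using AE_half_line_pos by eventually_elim (use b in \<open>auto simp: indicator_def\<close>)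
  qed
  also have "\<dots> = K / l * exp (l * r) - K / l" using ac_deriv_of_real(2)[OF ac r] by simp
  also have "\<dots> \<le> K / l * exp (l * r)" using K l by simp
  finally show ?thesis .
qed

lemma L2_primitive_bound:
  assumes f: "f \<in> L2" and r: "0 \<le> r"
  shows "cmod (LINT t:{..r}|half_line. f t) \<le> r + (L2_norm f)\<^sup>2"
proof -
  have ac: "ac_deriv (\<lambda>r. complex_of_real r) (\<lambda>r. complex_of_real 1)"
    by (rule ac_deriv_real_C1) (auto intro!: derivative_eq_intros)
  have i1: "integrable half_line (\<lambda>t. indicator {..r} t :: real)" and e1: "(LINT t|half_line. indicator {..r} t) = r"
    using ac_deriv_of_real(1)[OF ac, of r] ac_deriv_of_real(2)[OF ac r] by (simp_all add: set_integrable_def set_lebesgue_integral_def)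
  have i2: "integrable half_line (\<lambda>t. (cmod (f t))\<^sup>2)" by (rule L2_integrable_sq[OF f])
  have "cmod (LINT t:{..r}|half_line. f t) \<le> (LINT t|half_line. cmod (indicator {..r} t *\<^sub>R f t))"
    unfolding set_lebesgue_integral_def by (rule integral_norm_bound)
  also have "\<dots> \<le> (LINT t|half_line. indicator {..r} t + (cmod (f t))\<^sup>2)"
  proof (rule integral_mono)
    show "integrable half_line (\<lambda>t. cmod (indicator {..r} t *\<^sub>R f t))"
      using L2_set_integrable[OF f, of r] unfolding set_integrable_def by (rule integrable_norm)
    show "integrable half_line (\<lambda>t. indicator {..r} t + (cmod (f t))\<^sup>2)" using i1 i2 by simp
    fix t
    have "0 \<le> (cmod (f t) - 1)\<^sup>2" by simp
    hence "2 * cmod (f t) \<le> 1 + (cmod (f t))\<^sup>2" by (simp add: power2_diff)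
    hence "cmod (f t) \<le> 1 + (cmod (f t))\<^sup>2" using norm_ge_zero[of "f t"] by linarith
    thus "cmod (indicator {..r} t *\<^sub>R f t) \<le> indicator {..r} t + (cmod (f t))\<^sup>2"
      by (auto simp: indicator_def)
  qed
  also have "\<dots> = r + (L2_norm f)\<^sup>2" using i1 i2 e1 by (simp add: L2_norm_sq)
  finally show ?thesis .
qed

lemma continuous_set_integrable:
  fixes U :: "real \<Rightarrow> complex"
  assumes "continuous_on {0..} U" shows "set_integrable half_line {..r} U"
  using absolutely_integrable_continuous_real[OF continuous_on_subset[OF assms, of "{0..r}"]]
  by (auto simp: half_line_set_integral_eq(1))

text \<open>Picard iteration is a contraction in the sup norm weighted with \<open>exp (- l r)\<close> for large \<open>l\<close>.\<close>

lemma initial_value_problem: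
  fixes q f :: "real \<Rightarrow> complex"
  assumes q: "q \<in> borel_measurable half_line" "\<And>r. 0 < r \<Longrightarrow> cmod (q r) \<le> B" and f: "f \<in> L2"
  obtains U Y where "ac_deriv U Y" "ac_deriv Y (\<lambda>r. q r * U r - f r)" "U 0 = 0" "Y 0 = c"
proof -
  have B0: "0 \<le> B" using q(2)[of 1] norm_ge_zero[of "q 1"] by linarith
  \<comment> \<open>The iteration integrates twice and so gains 1 / l^2;
    \<open>B \<le> l / 2\<close> and \<open>1 \<le> l\<close> make the contraction factor at most
    1/2.\<close>
  define l where "l = 1 + 2 * B"
  have l: "l \<ge> 1" "B \<le> l / 2" using B0 by (auto simp: l_def)
  \<comment> \<open>The unknown is w = exp (-l r) U, so that the weighted sup norm of U becomes the
    ordinary sup norm of w; \<open>u\<close>, \<open>y\<close> and \<open>T\<close> are the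
    resulting second derivative, first derivative and next iterate.\<close>
  define u where "u w t = q t * (exp (of_real (l * t)) * w t) - f t" for w :: "real \<Rightarrow> complex" and t
  define y where "y w t = c + (LINT s:{..t}|half_line. u w s)" for w :: "real \<Rightarrow> complex" and t
  define T where "T w r = 0 + (LINT t:{..r}|half_line. y w t)" for w :: "real \<Rightarrow> complex" and r
  have exp_cont: "continuous_on A (\<lambda>t. exp (complex_of_real (l * t)))" for A by (intro continuous_intros)
  have si0: "set_integrable half_line {..r} (\<lambda>t. q t * (exp (of_real (l * t)) * w t))" if "continuous_on UNIV w" for w r
  proof (rule set_integrable_mult_bounded[OF continuous_set_integrable q])
    show "continuous_on {0..} (\<lambda>t. exp (complex_of_real (l * t)) * w t)"
      by (intro continuous_intros continuous_on_subset[OF that]) auto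
  qed
  have si: "set_integrable half_line {..r} (u w)" if "continuous_on UNIV w" for w r
    unfolding u_def by (rule set_integral_diff(1)[OF si0[OF that] L2_set_integrable[OF f]])
  have yac: "ac_deriv (y w) (u w)" if "continuous_on UNIV w" for w
    unfolding y_def by (rule ac_deriv_integral) (rule si[OF that])
  have ysi: "set_integrable half_line {..r} (y w)" if "continuous_on UNIV w" for w r
    by (rule continuous_set_integrable[OF ac_deriv_continuous[OF yac[OF that]]])
  have Tac: "ac_deriv (T w) (y w)" if "continuous_on UNIV w" for w
    unfolding T_def by (rule ac_deriv_integral) (rule ysi[OF that])
  have exp_bound: "cmod (q t * (exp (of_real (l * t)) * w t)) \<le> B * K * exp (l * t)"
    if "\<And>t. cmod (w t) \<le> K" "0 < t" for w :: "real \<Rightarrow> complex" and K t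
  proof -
    have "cmod (q t * (exp (of_real (l * t)) * w t)) = cmod (q t) * (exp (l * t) * cmod (w t))"
      by (simp add: norm_mult)
    also have "\<dots> \<le> B * (exp (l * t) * K)" using that q(2)[OF that(2)] B0
      by (intro mult_mono) auto
    finally show ?thesis by (simp add: mult_ac)
  qed
  have Tbound: "cmod (T w r) \<le> (cmod c + 1 + (L2_norm f)\<^sup>2 + B * K) * exp (l * r)"
    if w: "continuous_on UNIV w" "\<And>t. cmod (w t) \<le> K" and r: "0 \<le> r" for w :: "real \<Rightarrow> complex" and K r
  proof -
    define D where "D = cmod c + 1 + (L2_norm f)\<^sup>2 + B * K"
    have K: "0 \<le> K" using w(2)[of 0] norm_ge_zero[of "w 0"] by linarith
    have D: "0 \<le> D" using K B0 by (simp add: D_def)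
    have yb: "cmod (y w t) \<le> D * exp (l * t)" if t: "0 < t" for t
    proof -
      have e1: "1 \<le> exp (l * t)" using l t by simp
      have te: "t \<le> exp (l * t)" using exp_ge_add_one_self[of "l * t"] l t mult_right_mono[of 1 l t] by linarith
      have "y w t = c + (LINT s:{..t}|half_line. q s * (exp (of_real (l * s)) * w s)) - (LINT s:{..t}|half_line. f s)"
        unfolding y_def u_def by (subst set_integral_diff(2)[OF si0[OF w(1)] L2_set_integrable[OF f]]) simp
      also have "cmod \<dots> \<le> cmod c + cmod (LINT s:{..t}|half_line. q s * (exp (of_real (l * s)) * w s)) + cmod (LINT s:{..t}|half_line. f s)"
        by (rule order_trans[OF norm_triangle_ineq4 add_right_mono[OF norm_triangle_ineq]])
      also have "\<dots> \<le> cmod c + B * K / l * exp (l * t) + (t + (L2_norm f)\<^sup>2)"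
        by (intro add_mono order_refl half_line_integral_exp_bound si0 w exp_bound L2_primitive_bound f) (use B0 K l t in auto)
      also have "\<dots> \<le> cmod c * exp (l * t) + B * K * exp (l * t) + (1 * exp (l * t) + (L2_norm f)\<^sup>2 * exp (l * t))"
      proof (intro add_mono)
        show "cmod c \<le> cmod c * exp (l * t)" "(L2_norm f)\<^sup>2 \<le> (L2_norm f)\<^sup>2 * exp (l * t)" using mult_left_mono[OF e1] by fastforce+
        have "B * K / l \<le> B * K" using divide_left_mono[of 1 l "B * K"] mult_nonneg_nonneg[OF B0 K] l by simp
        thus "B * K / l * exp (l * t) \<le> B * K * exp (l * t)" by (intro mult_right_mono) auto
      qed (use te in auto)
      finally show ?thesis by (simp add: D_def algebra_simps)
    qed
    have "cmod (T w r) \<le> D / l * exp (l * r)"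
      unfolding T_def add_0 by (rule half_line_integral_exp_bound[OF ysi[OF w(1)] D _ r yb]) (use l in auto)
    also have "\<dots> \<le> D * exp (l * r)" using D l by (intro mult_right_mono) (auto simp: divide_le_eq mult_le_cancel_left1)
    finally show ?thesis unfolding D_def .
  qed
  have Tdiff: "cmod (T w r - T w' r) \<le> 1 / 2 * K * exp (l * r)"
    if w: "continuous_on UNIV w" "continuous_on UNIV w'" "\<And>t. cmod (w t - w' t) \<le> K" and r: "0 \<le> r" for w w' :: "real \<Rightarrow> complex" and K r
  proof -
    have K: "0 \<le> K" using w(3)[of 0] norm_ge_zero[of "w 0 - w' 0"] by linarith
    have yd: "y w t - y w' t = (LINT s:{..t}|half_line. q s * (exp (of_real (l * s)) * (w s - w' s)))" for t
    proof -
      have "y w t - y w' t = (LINT s:{..t}|half_line. u w s - u w' s)"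
        unfolding y_def by (subst set_integral_diff(2)[OF si[OF w(1)] si[OF w(2)]]) simp
      thus ?thesis by (simp add: u_def algebra_simps)
    qed
    have yb: "cmod (y w t - y w' t) \<le> B * K / l * exp (l * t)" if t: "0 < t" for t
      unfolding yd by (intro half_line_integral_exp_bound si0 exp_bound w continuous_intros) (use B0 K l t in auto)
    have "T w r - T w' r = (LINT t:{..r}|half_line. y w t - y w' t)"
      unfolding T_def by (subst set_integral_diff(2)[OF ysi[OF w(1)] ysi[OF w(2)]]) simp
    also have "cmod \<dots> \<le> B * K / l / l * exp (l * r)"
      by (intro half_line_integral_exp_bound yb set_integral_diff(1) ysi w r) (use B0 K l in auto)
    also have "\<dots> \<le> 1 / 2 * K * exp (l * r)"
    proof (rule mult_right_mono)
      have "B * K \<le> l / 2 * K" using l K by (intro mult_right_mono) auto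
      also have "\<dots> \<le> l * l * (1 / 2 * K)" using l K mult_left_mono[of 1 l "l * K"] by (simp add: mult_ac)
      finally show "B * K / l / l \<le> 1 / 2 * K" using l by (simp add: divide_le_eq mult_ac)
    qed simp
    finally show ?thesis .
  qed
  \<comment> \<open>The constant extension to negative arguments makes the iterate a bounded
    continuous function on the whole line, an element of a complete space.\<close>
  define \<Phi> where "\<Phi> w x = exp (- of_real (l * max 0 x)) * T w (max 0 x)" for w :: "real \<Rightarrow> complex" and x
  have cont: "continuous_on UNIV (apply_bcontfun w)" for w :: "real \<Rightarrow>\<^sub>C complex" by simp
  have \<Phi>: "\<Phi> (apply_bcontfun w) \<in> bcontfun" for w :: "real \<Rightarrow>\<^sub>C complex"
  proof (rule bcontfun_normI)
    have "continuous_on {0..} (\<lambda>r. exp (- of_real (l * r)) * T w r)"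
      by (intro continuous_intros ac_deriv_continuous[OF Tac] cont)
    thus "continuous_on UNIV (\<Phi> w)" unfolding \<Phi>_def
      by (rule continuous_on_compose2) (auto intro!: continuous_intros)
    fix x
    have "cmod (\<Phi> w x) = exp (- (l * max 0 x)) * cmod (T w (max 0 x))"
      by (simp add: \<Phi>_def norm_mult)
    also have "\<dots> \<le> exp (- (l * max 0 x)) * ((cmod c + 1 + (L2_norm f)\<^sup>2 + B * norm w) * exp (l * max 0 x))"
      by (intro mult_left_mono Tbound cont norm_bounded) auto
    also have "\<dots> = cmod c + 1 + (L2_norm f)\<^sup>2 + B * norm w"
      by (simp add: exp_minus field_simps)
    finally show "cmod (\<Phi> w x) \<le> cmod c + 1 + (L2_norm f)\<^sup>2 + B * norm w" .
  qed
  have "\<exists>!w. w \<in> UNIV \<and> Bcontfun (\<Phi> (apply_bcontfun w)) = w"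
  proof (rule Banach_fix[of UNIV "1/2"])
    fix w w' :: "real \<Rightarrow>\<^sub>C complex"
    show "dist (Bcontfun (\<Phi> w)) (Bcontfun (\<Phi> w')) \<le> 1 / 2 * dist w w'"
    proof (rule dist_bound)
      fix x
      have "dist (\<Phi> w x) (\<Phi> w' x) = cmod (exp (- of_real (l * max 0 x)) * (T w (max 0 x) - T w' (max 0 x)))"
        by (simp add: \<Phi>_def dist_norm algebra_simps)
      also have "\<dots> = exp (- (l * max 0 x)) * cmod (T w (max 0 x) - T w' (max 0 x))" by (simp add: norm_mult)
      also have "\<dots> \<le> exp (- (l * max 0 x)) * (1 / 2 * dist w w' * exp (l * max 0 x))"
        by (intro mult_left_mono Tdiff cont) (auto simp flip: dist_norm intro: dist_bounded)
      also have "\<dots> = 1 / 2 * dist w w'" by (simp add: exp_minus field_simps)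
      finally show "dist (apply_bcontfun (Bcontfun (\<Phi> w)) x) (apply_bcontfun (Bcontfun (\<Phi> w')) x) \<le> 1 / 2 * dist w w'"
        by (simp add: Bcontfun_inverse \<Phi>)
    qed
  qed (auto simp: complete_UNIV)
  then obtain w where "Bcontfun (\<Phi> (apply_bcontfun w)) = w" by blast
  hence fix_eq: "apply_bcontfun w x = \<Phi> w x" for x using \<Phi> Bcontfun_inverse by metis
  have TU: "exp (of_real (l * r)) * w r = T w r" if "0 \<le> r" for r
    using fix_eq[of r] that by (simp add: \<Phi>_def max_def mult.assoc flip: exp_add)
  show ?thesis
  proof (rule that)
    show "ac_deriv (T w) (y w)" by (rule Tac[OF cont])
    show "ac_deriv (y w) (\<lambda>r. q r * T w r - f r)"
    proof (rule ac_deriv_cong_AE[OF yac[OF cont]])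
      show "AE r in half_line. q r * T w r - f r = u w r"
        using AE_half_line_pos
      proof eventually_elim
        case (elim r)
        show ?case unfolding u_def TU[OF less_imp_le[OF elim]] ..
      qed
      show "(\<lambda>r. q r * T w r - f r) \<in> borel_measurable half_line"
        by (intro borel_measurable_diff borel_measurable_times q L2_measurable f ac_deriv_measurable[OF Tac[OF cont]])
    qed simp
    show "T w 0 = 0" "y w 0 = c" by (simp_all add: T_def y_def set_integral_half_line_zero)
  qed
qed

section \<open>Truncations and boundary value problems on finite intervals\<close>

definition trunc :: "real \<Rightarrow> (real \<Rightarrow> complex) \<Rightarrow> (real \<Rightarrow> complex)" where
  "trunc R U r = (if r \<le> R then U r else 0)"

lemma trunc_L2:
  assumes "continuous_on {0..} U" shows "trunc R U \<in> L2"
proof -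
  have "integrable half_line (\<lambda>r. indicator {..R} r *\<^sub>R (U r * cnj (U r)))"
    unfolding set_integrable_def[symmetric] by (intro continuous_set_integrable continuous_intros assms)
  moreover have "indicator {..R} r *\<^sub>R (U r * cnj (U r)) = complex_of_real ((cmod (trunc R U r))\<^sup>2)" for r
    unfolding complex_norm_square by (simp add: trunc_def indicator_def)
  ultimately have "integrable half_line (\<lambda>r. (cmod (trunc R U r))\<^sup>2)" by (simp only: complex_of_real_integrable_eq)
  moreover have "trunc R U \<in> borel_measurable half_line"
  proof -
    have "(\<lambda>r. indicator {..R} r *\<^sub>R U r) \<in> borel_measurable half_line"
      by (intro borel_measurable_scaleR borel_measurable_half_lineI continuous_measurable_half_line assms) simp
    also have "(\<lambda>r. indicator {..R} r *\<^sub>R U r) = trunc R U" by (auto simp: trunc_def)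
    finally show ?thesis .
  qed
  ultimately show ?thesis by (simp add: L2_def)
qed

lemma trunc_norm_mono:
  assumes "continuous_on {0..} U" "R \<le> R'"
  shows "L2_norm (trunc R U) \<le> L2_norm (trunc R' U)"
  using L2_norm_bounded_mono[OF trunc_L2[OF assms(1), of R'] L2_measurable[OF trunc_L2[OF assms(1), of R]], of 1] assms(2)
  by (auto simp: trunc_def)

text \<open>A continuous function that vanishes almost everywhere on (0, R) vanishes there
  everywhere, hence also at 0. Applied to a derivative with value 1 at 0, this makes the truncated
  norm nonzero and allows division by it.\<close>

lemma trunc_norm_zero:
  assumes U: "continuous_on {0..} U" and R: "0 < R" and z: "L2_norm (trunc R U) = 0"
  shows "U 0 = 0"
proof -
  have "AE r in half_line. (cmod (trunc R U r))\<^sup>2 = 0"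
    using z integral_nonneg_eq_0_iff_AE[OF L2_integrable_sq[OF trunc_L2[OF U, of R]]] by (simp add: L2_norm_def)
  hence ae: "AE r in lebesgue. 0 < r \<longrightarrow> r \<le> R \<longrightarrow> U \<bar>r\<bar> = 0"
    unfolding AE_half_line_iff by eventually_elim (auto simp: trunc_def split: if_splits)
  have c: "continuous_on UNIV (\<lambda>r. U \<bar>r\<bar>)"
    by (rule continuous_on_compose2[OF U]) (auto intro!: continuous_intros)
  have pos: "U \<bar>x\<bar> = 0" if x: "x \<in> {0<..<R}" for x
  proof -
    have "closed ({..0} \<union> {R..} \<union> {y. U \<bar>y\<bar> = 0})"
      using c by (intro closed_Un closed_Collect_eq) auto
    moreover have "AE y in lebesgue. y \<in> {..0} \<union> {R..} \<union> {y. U \<bar>y\<bar> = 0}"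
      using ae by eventually_elim auto
    ultimately have "x \<in> {..0} \<union> {R..} \<union> {y. U \<bar>y\<bar> = 0}" by (rule mem_closed_if_AE_lebesgue)
    thus ?thesis using x by simp
  qed
  have "U \<bar>0\<bar> = 0"
  proof (rule continuous_constant_on_closure[of "{0<..<R}" "\<lambda>r. U \<bar>r\<bar>"])
    show "continuous_on (closure {0<..<R}) (\<lambda>r. U \<bar>r\<bar>)" using c by (rule continuous_on_subset) simp
  qed (use pos R in auto)
  thus ?thesis by simp
qed

text \<open>Monotone convergence along the integer truncations.\<close>

lemma L2_if_trunc_bounded:
  assumes U: "continuous_on {0..} U" and b: "\<And>R. L2_norm (trunc R U) \<le> K"
  shows "U \<in> L2"
proof -
  let ?f = "\<lambda>n r. (cmod (trunc (real n) U r))\<^sup>2"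
  have i: "integrable half_line (?f n)" for n by (rule L2_integrable_sq[OF trunc_L2[OF U]])
  have mono: "mono (\<lambda>n. ?f n r)" for r
    by (rule monoI) (auto simp: trunc_def)
  have "incseq (\<lambda>n. LINT r|half_line. ?f n r)"
    by (rule monoI, rule integral_mono[OF i i]) (use mono in \<open>auto simp: mono_def\<close>)
  moreover have "(LINT r|half_line. ?f n r) \<le> K\<^sup>2" for n
    using power_mono[OF b[of "real n"], of 2] by (simp add: L2_norm_sq)
  ultimately obtain L where L: "(\<lambda>n. LINT r|half_line. ?f n r) \<longlonglongrightarrow> L"
    using incseq_convergent[of "\<lambda>n. LINT r|half_line. ?f n r" "K\<^sup>2"] by blast
  have "integrable half_line (\<lambda>r. (cmod (U r))\<^sup>2)"
  proof (rule integrable_monotone_convergence[OF i _ _ L])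
    show "AE r in half_line. mono (\<lambda>n. ?f n r)" using mono by simp
    show "AE r in half_line. (\<lambda>n. ?f n r) \<longlonglongrightarrow> (cmod (U r))\<^sup>2"
    proof (rule AE_I2)
      fix r
      have "eventually (\<lambda>n. r \<le> real n) sequentially"
        using filterlim_real_sequentially by (simp add: filterlim_at_top)
      hence "eventually (\<lambda>n. ?f n r = (cmod (U r))\<^sup>2) sequentially" by eventually_elim (simp add: trunc_def)
      thus "(\<lambda>n. ?f n r) \<longlonglongrightarrow> (cmod (U r))\<^sup>2" by (rule tendsto_eventually)
    qed
    show "(\<lambda>r. (cmod (U r))\<^sup>2) \<in> borel_measurable half_line"
      using continuous_measurable_half_line[OF U] by simp
  qed
  thus ?thesis using continuous_measurable_half_line[OF U] by (simp add: L2_def)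
qed

context repulsive_potential
begin

text \<open>The Dirichlet conditions at both ends remove the boundary terms, so the truncations
  satisfy the identity of \<open>quadratic_form_bounds\<close> and the bounds do not depend on
  N.\<close>

lemma boundary_value_bounds:
  assumes ac: "ac_deriv U Y" "ac_deriv Y (\<lambda>r. (of_real (V r) - z) * U r - f r)" and f: "f \<in> L2"
    and bc: "U 0 = 0" "U N = 0" and N: "0 \<le> N"
  defines "\<kappa> \<equiv> \<bar>Im z\<bar> + cmod z - Re z"
  shows "\<kappa> * L2_norm (trunc N U) \<le> 4 * L2_norm f"
    and "\<kappa> * (L2_norm (trunc N Y))\<^sup>2 \<le> 4 * cmod z * (L2_norm f * L2_norm (trunc N U))"
proof -
  have L: "trunc N U \<in> L2" "trunc N Y \<in> L2" using ac by (auto intro!: trunc_L2 ac_deriv_continuous)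
  have "ac_deriv (\<lambda>r. Y r * cnj (U r)) (\<lambda>r. ((of_real (V r) - z) * U r - f r) * cnj (U r) + Y r * cnj (Y r))"
    by (intro ac_deriv_mult ac_deriv_cnj ac)
  from ac_derivD[OF this N] have "0 = (LINT r:{..N}|half_line. ((of_real (V r) - z) * U r - f r) * cnj (U r) + Y r * cnj (Y r))"
    using bc by simp
  also have "\<dots> = (LINT r|half_line. ((of_real (V r) - z) * trunc N U r - f r) * cnj (trunc N U r) + trunc N Y r * cnj (trunc N Y r))"
    unfolding set_lebesgue_integral_def
    by (rule Bochner_Integration.integral_cong) (auto simp: trunc_def indicator_def)
  finally have zero: "(LINT r|half_line. ((of_real (V r) - z) * trunc N U r - f r) * cnj (trunc N U r) + trunc N Y r * cnj (trunc N Y r)) = 0"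
    by simp
  note b = quadratic_form_bounds[OF L f zero, folded \<kappa>_def]
  show "\<kappa> * L2_norm (trunc N U) \<le> 4 * L2_norm f" by (rule b(3))
  have "4 * cmod z * (LINT r|half_line. cmod (f r) * cmod (trunc N U r)) \<le> 4 * cmod z * (L2_norm f * L2_norm (trunc N U))"
    by (intro mult_left_mono L2_Cauchy_Schwarz f L) auto
  thus "\<kappa> * (L2_norm (trunc N Y))\<^sup>2 \<le> 4 * cmod z * (L2_norm f * L2_norm (trunc N U))"
    using b(2) by simp
qed

text \<open>Weyl's argument: solve the boundary value problems on \<open>[0, N]\<close>; the initial slopes are bounded by
  the uniform energy estimate, and a limit point of them yields a square integrable solution.\<close>

lemma radial_solution_exists:
  assumes z: "z \<notin> \<real>\<^sub>\<ge>\<^sub>0" and f: "f \<in> L2"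
  obtains U Y W where "radial_solution V \<delta> z U Y W f"
proof -
  define \<kappa> where "\<kappa> = \<bar>Im z\<bar> + cmod z - Re z"
  have \<kappa>: "\<kappa> > 0" unfolding \<kappa>_def by (rule numerical_range_pos[OF z])
  have qm: "(\<lambda>r. complex_of_real (V r) - z) \<in> borel_measurable half_line" using V_measurable by simp
  have qb: "cmod (complex_of_real (V r) - z) \<le> V 0 + cmod z" if "0 < r" for r
    using norm_triangle_ineq4[of "complex_of_real (V r)" z] V_bounded[OF that] by simp
  obtain p p' where p: "ac_deriv p p'" "ac_deriv p' (\<lambda>r. (of_real (V r) - z) * p r - f r)" "p 0 = 0" "p' 0 = 0"
    by (rule initial_value_problem[OF qm qb f])
  obtain \<phi> \<phi>' where \<phi>: "ac_deriv \<phi> \<phi>'" "ac_deriv \<phi>' (\<lambda>r. (of_real (V r) - z) * \<phi> r - 0)" "\<phi> 0 = 0" "\<phi>' 0 = 1"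
    by (rule initial_value_problem[OF qm qb L2_zero])
  have cont: "continuous_on {0..} p" "continuous_on {0..} p'" "continuous_on {0..} \<phi>" "continuous_on {0..} \<phi>'"
    using p \<phi> by (auto intro: ac_deriv_continuous)
  have \<phi>'_norm: "L2_norm (trunc N \<phi>') \<noteq> 0" if "0 < N" for N
    using trunc_norm_zero[OF cont(4) that] \<phi>(4) by auto
  \<comment> \<open>If \<phi> vanished at N, it would be a Dirichlet eigenfunction on [0, N] with
    eigenvalue z. The numerical range bound with zero source would then annihilate \<phi>', against
    \<phi>'(0) = 1.\<close>
  have \<phi>_nz: "\<phi> N \<noteq> 0" if N: "0 < N" for N
  proof
    assume "\<phi> N = 0"
    note b = boundary_value_bounds(2)[OF \<phi>(1,2) L2_zero \<phi>(3) this less_imp_le[OF N], folded \<kappa>_def]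
    have "L2_norm (\<lambda>r. 0) = 0" by (simp add: L2_norm_def)
    hence "\<kappa> * (L2_norm (trunc N \<phi>'))\<^sup>2 \<le> 0" using b by simp
    hence "(L2_norm (trunc N \<phi>'))\<^sup>2 \<le> 0" using \<kappa> by (simp add: mult_le_0_iff)
    thus False using \<phi>'_norm[OF N] by simp
  qed
  define U where "U c r = p r + c * \<phi> r" for c r
  define Y where "Y c r = p' r + c * \<phi>' r" for c r
  have U: "ac_deriv (U c) (Y c)" for c
    unfolding U_def Y_def by (intro ac_deriv_add ac_deriv_cmult p \<phi>)
  have Y: "ac_deriv (Y c) (\<lambda>r. (of_real (V r) - z) * U c r - f r)" for c
    using ac_deriv_add[OF p(2) ac_deriv_cmult[OF \<phi>(2), of c]] unfolding U_def Y_def by (simp add: algebra_simps)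
  have U0: "U c 0 = 0" for c by (simp add: U_def p \<phi>)
  have contU: "continuous_on {0..} (U c)" "continuous_on {0..} (Y c)" for c
    using U Y by (auto intro: ac_deriv_continuous)
  \<comment> \<open>The slope at 0 for which the particular solution plus c \<phi> vanishes at
    \<open>Suc n\<close>; the shift keeps the interval length at least 1.\<close>
  define c where "c n = - p (real (Suc n)) / \<phi> (real (Suc n))" for n
  have bc: "U (c n) (real (Suc n)) = 0" for n
    using \<phi>_nz[of "real (Suc n)"] by (simp add: U_def c_def del: of_nat_Suc)
  define K where "K = 4 * L2_norm f / \<kappa>"
  define K' where "K' = sqrt (4 * cmod z * (L2_norm f * K) / \<kappa>)"
  have bU: "L2_norm (trunc (real (Suc n)) (U (c n))) \<le> K" for n
    using boundary_value_bounds(1)[OF U Y f U0 bc, folded \<kappa>_def] \<kappa> by (simp add: K_def pos_le_divide_eq mult.commute del: of_nat_Suc)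
  have bY: "L2_norm (trunc (real (Suc n)) (Y (c n))) \<le> K'" for n
  proof -
    have "\<kappa> * (L2_norm (trunc (real (Suc n)) (Y (c n))))\<^sup>2 \<le> 4 * cmod z * (L2_norm f * L2_norm (trunc (real (Suc n)) (U (c n))))"
      by (rule boundary_value_bounds(2)[OF U Y f U0 bc, folded \<kappa>_def]) simp
    also have "\<dots> \<le> 4 * cmod z * (L2_norm f * K)" by (intro mult_left_mono bU) auto
    finally have "(L2_norm (trunc (real (Suc n)) (Y (c n))))\<^sup>2 \<le> 4 * cmod z * (L2_norm f * K) / \<kappa>"
      using \<kappa> by (simp add: pos_le_divide_eq mult.commute del: of_nat_Suc)
    thus ?thesis unfolding K'_def by (rule real_le_rsqrt)
  qed
  have trunc_lin: "trunc R (U a) = (\<lambda>r. trunc R (U b) r + (a - b) * trunc R \<phi> r)" "trunc R (Y a) = (\<lambda>r. trunc R (Y b) r + (a - b) * trunc R \<phi>' r)" for a b R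
    by (auto simp: trunc_def U_def Y_def algebra_simps)
  have tri: "L2_norm (trunc R (U a)) \<le> L2_norm (trunc R (U b)) + cmod (a - b) * L2_norm (trunc R \<phi>)"
    "L2_norm (trunc R (Y a)) \<le> L2_norm (trunc R (Y b)) + cmod (a - b) * L2_norm (trunc R \<phi>')" for a b R
    unfolding trunc_lin[of R a b] L2_norm_cmult[symmetric]
    by (intro L2_norm_triangle L2_cmult trunc_L2 contU cont)+
  have "bounded (range c)"
  proof (rule boundedI)
    fix x assume "x \<in> range c"
    then obtain n where x: "x = c n" by blast
    \<comment> \<open>On [0, 1], which lies in every interval, c \<phi>' is the derivative of the
      n-th solution minus p'. Both have norms bounded independently of n, while the norm of \<phi>'
      there is positive.\<close>
    have eq: "(\<lambda>r. c n * trunc 1 \<phi>' r) = (\<lambda>r. trunc 1 (Y (c n)) r + (-1) * trunc 1 p' r)"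
      by (auto simp: trunc_def Y_def)
    have "cmod (c n) * L2_norm (trunc 1 \<phi>') \<le> L2_norm (trunc 1 (Y (c n))) + cmod (-1) * L2_norm (trunc 1 p')"
      unfolding L2_norm_cmult[symmetric] eq by (intro L2_norm_triangle L2_cmult trunc_L2 contU cont)
    also have "\<dots> \<le> K' + L2_norm (trunc 1 p')"
      using order_trans[OF trunc_norm_mono[OF contU(2), of 1 "real (Suc n)"] bY] by simp
    finally show "norm x \<le> (K' + L2_norm (trunc 1 p')) / L2_norm (trunc 1 \<phi>')"
      using \<phi>'_norm[of 1] L2_norm_nonneg[of "trunc 1 \<phi>'"] unfolding x by (simp add: pos_le_divide_eq less_le)
  qed
  then obtain a \<sigma> where \<sigma>: "strict_mono \<sigma>" and lim: "(c \<circ> \<sigma>) \<longlonglongrightarrow> a"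
    using bounded_imp_convergent_subsequence[of c] by blast
  have ev: "eventually (\<lambda>n. R \<le> real (Suc (\<sigma> n))) sequentially" for R
  proof -
    obtain m where m: "R \<le> real m" using real_arch_simple by blast
    have "R \<le> real (Suc (\<sigma> n))" if "m \<le> n" for n
    proof -
      have "real m \<le> real (\<sigma> n)" using that seq_suble[OF \<sigma>, of n] by simp
      thus ?thesis using m by simp
    qed
    thus ?thesis unfolding eventually_sequentially by blast
  qed
  have lim0: "(\<lambda>n. K0 + cmod (a - c (\<sigma> n)) * x) \<longlonglongrightarrow> K0 + cmod (a - a) * x" for K0 x
    using lim by (intro tendsto_intros) (simp add: o_def)
  \<comment> \<open>For fixed R the intervals of the subsequence eventually contain [0, R]; there
    the uniform bound K holds, and replacing c by its limit a costs |a - c| times a fixed norm,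
    which tends to 0.\<close>
  have "L2_norm (trunc R (U a)) \<le> K" for R
  proof -
    have "eventually (\<lambda>n. L2_norm (trunc R (U a)) \<le> K + cmod (a - c (\<sigma> n)) * L2_norm (trunc R \<phi>)) sequentially"
      using ev[of R]
    proof eventually_elim
      case (elim n)
      have "L2_norm (trunc R (U (c (\<sigma> n)))) \<le> K"
        using trunc_norm_mono[OF contU(1) elim, of "c (\<sigma> n)"] bU[of "\<sigma> n"] by (rule order_trans)
      thus ?case using tri(1)[of R a "c (\<sigma> n)"] by linarith
    qed
    from tendsto_lowerbound[OF lim0 this] show ?thesis by simp
  qed
  hence UL: "U a \<in> L2" by (rule L2_if_trunc_bounded[OF contU(1)])
  have "L2_norm (trunc R (Y a)) \<le> K'" for R
  proof -
    have "eventually (\<lambda>n. L2_norm (trunc R (Y a)) \<le> K' + cmod (a - c (\<sigma> n)) * L2_norm (trunc R \<phi>')) sequentially"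
      using ev[of R]
    proof eventually_elim
      case (elim n)
      have "L2_norm (trunc R (Y (c (\<sigma> n)))) \<le> K'"
        using trunc_norm_mono[OF contU(2) elim, of "c (\<sigma> n)"] bY[of "\<sigma> n"] by (rule order_trans)
      thus ?case using tri(2)[of R a "c (\<sigma> n)"] by linarith
    qed
    from tendsto_lowerbound[OF lim0 this] show ?thesis by simp
  qed
  hence YL: "Y a \<in> L2" by (rule L2_if_trunc_bounded[OF contU(2)])
  have "(\<lambda>r. (of_real (V r) - z) * U a r - f r) \<in> L2"
    by (intro L2_diff f L2_bounded_mult[OF UL qm qb])
  hence "radial_solution V \<delta> z (U a) (Y a) (\<lambda>r. (of_real (V r) - z) * U a r - f r) f"
    using U Y UL YL f U0 by unfold_locales auto
  thus ?thesis by (rule that)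
qed

end

section \<open>Weighted resolvent estimates\<close>

lemma radial_solution_diff:
  assumes "radial_solution V \<delta> z U Y W f" "radial_solution V \<delta> z U' Y' W' f'"
  shows "radial_solution V \<delta> z (\<lambda>r. U r - U' r) (\<lambda>r. Y r - Y' r) (\<lambda>r. W r - W' r) (\<lambda>r. f r - f' r)"
proof -
  interpret A: radial_solution V \<delta> z U Y W f by fact
  interpret B: radial_solution V \<delta> z U' Y' W' f' by fact
  show ?thesis
  proof unfold_locales
    show "AE r in half_line. W r - W' r = (of_real (V r) - z) * (U r - U' r) - (f r - f' r)"
      using A.eq B.eq
    proof eventually_elim
      case (elim r)
      show ?case unfolding elim by (simp add: algebra_simps)
    qed
  qed (auto intro!: ac_deriv_diff A.ac B.ac L2_diff A.L2 B.L2 simp: A.U0 B.U0)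
qed

lemma weight_weight: "weight a (weight b f) = weight (a + b) f"
  by (simp add: weight_def mult_op_def powr_add fun_eq_iff)

lemma weight_lin: "weight a (\<lambda>r. f r - g r) = (\<lambda>r. weight a f r - weight a g r)"
  by (simp add: weight_def mult_op_def algebra_simps)

lemma weight_norm_mono:
  assumes "a \<le> b" "f \<in> borel_measurable half_line" "weight b f \<in> L2"
  shows "L2_norm (weight a f) \<le> L2_norm (weight b f)"
proof -
  have "AE r in half_line. cmod (weight a f r) \<le> 1 * cmod (weight b f r)"
    using AE_half_line_pos by eventually_elim (use assms(1) in \<open>auto simp: cmod_weight intro!: mult_right_mono powr_mono\<close>)
  from L2_norm_bounded_mono[OF assms(3) weight_measurable[OF assms(2)] this] show ?thesis by simp
qed

section \<open>Dyadic decomposition and interpolation between the weights\<close>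

lemma restrict_L2:
  assumes "g \<in> L2" "S \<in> sets borel"
  shows "(\<lambda>r. if r \<in> S then g r else 0) \<in> L2" "L2_norm (\<lambda>r. if r \<in> S then g r else 0) \<le> L2_norm g"
proof -
  have "(\<lambda>r. indicator S r *\<^sub>R g r) \<in> borel_measurable half_line"
    using assms by (intro borel_measurable_scaleR borel_measurable_half_lineI L2_measurable) auto
  moreover have "(\<lambda>r. indicator S r *\<^sub>R g r) = (\<lambda>r. if r \<in> S then g r else 0)" by auto
  ultimately have m: "(\<lambda>r. if r \<in> S then g r else 0) \<in> borel_measurable half_line" by simp
  show "(\<lambda>r. if r \<in> S then g r else 0) \<in> L2" by (rule L2_bounded_mono[OF assms(1) m, of 1]) auto
  show "L2_norm (\<lambda>r. if r \<in> S then g r else 0) \<le> L2_norm g"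
    using L2_norm_bounded_mono[OF assms(1) m, of 1] by auto
qed

lemma restrict_compl_L2:
  assumes "g \<in> L2" "S \<in> sets borel"
  shows "(\<lambda>r. if r \<in> S then 0 else g r) \<in> L2"
proof -
  have "(\<lambda>r. if r \<in> S then 0 else g r) = (\<lambda>r. if r \<in> - S then g r else 0)" by auto
  thus ?thesis using restrict_L2(1)[OF assms(1), of "- S"] assms(2) by simp
qed

lemma L2_tail_tendsto:
  assumes g: "g \<in> L2"
  shows "(\<lambda>n. L2_norm (\<lambda>r. if r \<in> {..<2 ^ n - 1} then 0 else g r)) \<longlonglongrightarrow> 0"
proof -
  let ?h = "\<lambda>n r. if r \<in> {..<2 ^ n - 1} then 0 else g r"
  have h: "?h n \<in> L2" for n
    by (rule restrict_compl_L2[OF g]) simp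
  have "(\<lambda>n. LINT r|half_line. (cmod (?h n r))\<^sup>2) \<longlonglongrightarrow> (LINT r|half_line. 0)"
  proof (rule integral_dominated_convergence[where w="\<lambda>r. (cmod (g r))\<^sup>2"])
    show "integrable half_line (\<lambda>r. (cmod (g r))\<^sup>2)" by (rule L2_integrable_sq[OF g])
    show "(\<lambda>r. (cmod (?h n r))\<^sup>2) \<in> borel_measurable half_line" for n
      by (rule borel_measurable_integrable[OF L2_integrable_sq[OF h]])
    show "AE r in half_line. (\<lambda>n. (cmod (?h n r))\<^sup>2) \<longlonglongrightarrow> 0"
    proof (rule AE_I2)
      fix r :: real
      have "eventually (\<lambda>n. r + 1 < real n) sequentially"
        using filterlim_real_sequentially by (simp add: filterlim_at_top_dense)
      hence "eventually (\<lambda>n. (cmod (?h n r))\<^sup>2 = 0) sequentially"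
      proof eventually_elim
        case (elim n)
        have "real n < 2 ^ n" by (rule of_nat_less_two_power)
        hence "r < 2 ^ n - 1" using elim by linarith
        thus ?case by simp
      qed
      thus "(\<lambda>n. (cmod (?h n r))\<^sup>2) \<longlonglongrightarrow> 0" by (rule tendsto_eventually)
    qed
  qed auto
  from tendsto_real_sqrt[OF this] show ?thesis unfolding L2_norm_def by simp
qed

text \<open>The constant \<open>10 * M / \<epsilon>\<close> of \<open>weighted_estimates\<close>,
  with \<open>M\<close> and \<open>\<epsilon>\<close> written out.\<close>

definition weighted_const :: "real \<Rightarrow> real \<Rightarrow> real" where
  "weighted_const \<delta> s = 10 * (2 + 2 * (2 * s - 1) / \<delta>) / (2 * s - 1)"

text \<open>The sum of the bounds from \<open>localized_resolvent_bound\<close> over all dyadic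
  shells, a geometric series of ratio \<open>2 powr (-\<eta>)\<close>.\<close>

definition dyadic_const :: "real \<Rightarrow> real \<Rightarrow> real \<Rightarrow> real" where
  "dyadic_const \<delta> a \<eta> = 3 * weighted_const \<delta> a / (1 - 2 powr (-\<eta>))"

context repulsive_potential
begin

lemma weighted_const_pos: "s > 1/2 \<Longrightarrow> weighted_const \<delta> s > 0"
  unfolding weighted_const_def using \<delta>_pos by (intro divide_pos_pos mult_pos_pos add_pos_nonneg) auto

lemma Hardy_resolvent_bound:
  assumes sol: "radial_solution V \<delta> z U Y W f" and a: "a > 1/2" and g: "g \<in> L2" and f: "f = weight (-a) g"
  shows "L2_norm (weight (-a - 1) U) \<le> weighted_const \<delta> a * L2_norm g"
proof -
  interpret radial_solution V \<delta> z U Y W f by fact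
  have "1 * L2_norm (weight (-a - 1) U) \<le> ((2 * a + 1) / 2) * L2_norm (weight (-a - 1) U)"
    using a by (intro mult_right_mono) auto
  hence "L2_norm (weight (-a - 1) U) \<le> L2_norm (weight (-a) Y)"
    using Hardy_inequality[OF ac(1) L2(1,2) U0, of a] a by simp
  also have "\<dots> \<le> weighted_const \<delta> a * L2_norm g"
    using weighted_estimates(1)[OF a g f] by (simp add: weighted_const_def)
  finally show ?thesis .
qed

text \<open>A duality argument: the squared norm of w = (1 + r)^(-a) u is the pairing of u with k =
  (1 + r)^(-a) conj w. Solving the equation with source k and exchanging the roles by symmetry
  leaves the other solution with weight a + 1, where \<open>Hardy_resolvent_bound\<close>
  applies.\<close>

lemma dual_Hardy_resolvent_bound:
  assumes sol: "radial_solution V \<delta> z U Y W f" and z: "z \<notin> \<real>\<^sub>\<ge>\<^sub>0"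
    and a: "a > 1/2" and g: "g \<in> L2" and f: "f = weight (-a - 1) g"
  shows "L2_norm (weight (-a) U) \<le> weighted_const \<delta> a * L2_norm g"
proof -
  interpret radial_solution V \<delta> z U Y W f by fact
  define w where "w = weight (-a) U"
  have w: "w \<in> L2" unfolding w_def using a L2(1) by (intro weight_L2) auto
  define k where "k = weight (-a) (\<lambda>r. cnj (w r))"
  have k: "k \<in> L2" unfolding k_def using a by (intro weight_L2 L2_cnj w) auto
  obtain U' Y' W' where sol': "radial_solution V \<delta> z U' Y' W' k"
    by (rule radial_solution_exists[OF z k])
  interpret D: radial_solution V \<delta> z U' Y' W' k by fact
  have cn: "L2_norm (\<lambda>r. cnj (w r)) = L2_norm w" by (simp add: L2_norm_def)
  have U': "L2_norm (weight (-a - 1) U') \<le> weighted_const \<delta> a * L2_norm w"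
    using Hardy_resolvent_bound[OF sol' a L2_cnj[OF w] k_def] unfolding cn .
  have wU': "weight (-a - 1) U' \<in> L2" using a D.L2(1) by (intro weight_L2) auto
  have "complex_of_real ((L2_norm w)\<^sup>2) = (LINT r|half_line. complex_of_real ((cmod (w r))\<^sup>2))"
    unfolding L2_norm_sq integral_complex_of_real ..
  also have "\<dots> = (LINT r|half_line. k r * U r)"
    unfolding complex_norm_square by (simp add: k_def weight_def mult_op_def w_def mult_ac)
  also have "\<dots> = (LINT r|half_line. f r * U' r)" by (rule radial_solution_symmetric[OF sol' sol])
  also have "\<dots> = (LINT r|half_line. g r * weight (-a - 1) U' r)"
    unfolding f by (simp add: weight_def mult_op_def mult_ac)
  finally have "(L2_norm w)\<^sup>2 = cmod (LINT r|half_line. g r * weight (-a - 1) U' r)"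
    by (metis abs_of_nonneg norm_of_real zero_le_power2)
  also have "\<dots> \<le> (LINT r|half_line. cmod (g r) * cmod (weight (-a - 1) U' r))"
    using integral_norm_bound[of half_line "\<lambda>r. g r * weight (-a - 1) U' r"] by (simp add: norm_mult)
  also have "\<dots> \<le> L2_norm g * L2_norm (weight (-a - 1) U')" by (rule L2_Cauchy_Schwarz[OF g wU'])
  also have "\<dots> \<le> L2_norm g * (weighted_const \<delta> a * L2_norm w)" by (intro mult_left_mono U') auto
  finally have *: "L2_norm w * L2_norm w \<le> (weighted_const \<delta> a * L2_norm g) * L2_norm w"
    by (simp add: power2_eq_square mult_ac)
  show ?thesis
  proof (cases "L2_norm w = 0")
    case False
    hence "0 < L2_norm w" using L2_norm_nonneg[of w] by linarith
    from mult_right_le_imp_le[OF * this] show ?thesis unfolding w_def .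
  qed (use weighted_const_pos[OF a] in \<open>simp add: w_def\<close>)
qed

text \<open>Interpolation between \<open>Hardy_resolvent_bound\<close> and \<open>dual_Hardy_resolvent_bound\<close> for a right-hand side
  localized where \<open>1 + r\<close> is comparable to \<open>l\<close>.\<close>

lemma localized_resolvent_bound:
  assumes sol: "radial_solution V \<delta> z U Y W f" and z: "z \<notin> \<real>\<^sub>\<ge>\<^sub>0"
    and a: "a > 1/2" and \<sigma>: "a \<le> \<sigma>" "\<sigma> \<le> a + 1" and s: "a \<le> s" and g: "g \<in> L2" and f: "f = weight (-s) g"
    and l: "1 \<le> l" and supp: "\<And>r. g r \<noteq> 0 \<Longrightarrow> l \<le> 1 + r \<and> 1 + r \<le> 2 * l"
  shows "L2_norm (weight (-\<sigma>) U) \<le> 3 * weighted_const \<delta> a * l powr (2 * a + 1 - \<sigma> - s) * L2_norm g"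
proof -
  interpret radial_solution V \<delta> z U Y W f by fact
  define C where "C = weighted_const \<delta> a"
  have C: "C > 0" unfolding C_def by (rule weighted_const_pos[OF a])
  \<comment> \<open>The source is written with each of the two admissible weights. On the support of
    g the leftover powers are at most l^(a - s) and 2 l^(a + 1 - s); the 2 comes from 1 + r \<le> 2
    l.\<close>
  define G where "G = weight (a - s) g"
  define G' where "G' = weight (a + 1 - s) g"
  have b: "cmod (G r) \<le> l powr (a - s) * cmod (g r)" for r
  proof (cases "g r = 0")
    case False
    hence "(1 + r) powr (a - s) \<le> l powr (a - s)" using supp[OF False] l s by (intro powr_mono2') auto
    thus ?thesis using supp[OF False] l by (simp add: G_def cmod_weight weight_def mult_op_def norm_mult mult_right_mono)
  qed (simp add: G_def weight_def mult_op_def)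
  have b': "cmod (G' r) \<le> 2 * l powr (a + 1 - s) * cmod (g r)" for r
  proof (cases "g r = 0")
    case False
    have r: "l \<le> 1 + r" "1 + r \<le> 2 * l" using supp[OF False] by auto
    have "(1 + r) powr (a + 1 - s) = (1 + r) * (1 + r) powr (a - s)"
      using r l powr_add[of "1 + r" 1 "a - s"] by (simp add: algebra_simps)
    also have "\<dots> \<le> (2 * l) * l powr (a - s)" using r l s by (intro mult_mono powr_mono2') auto
    also have "\<dots> = 2 * l powr (a + 1 - s)" using l powr_add[of l 1 "a - s"] by (simp add: algebra_simps)
    finally show ?thesis using r l by (simp add: G'_def weight_def mult_op_def norm_mult mult_right_mono)
  qed (simp add: G'_def weight_def mult_op_def)
  have m: "G \<in> borel_measurable half_line" "G' \<in> borel_measurable half_line"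
    unfolding G_def G'_def by (intro weight_measurable L2_measurable g)+
  have GL: "G \<in> L2" "L2_norm G \<le> l powr (a - s) * L2_norm g"
    using L2_bounded_mono[OF g m(1) AE_I2[OF b]] L2_norm_bounded_mono[OF g m(1) AE_I2[OF b]] by simp_all
  have GL': "G' \<in> L2" "L2_norm G' \<le> 2 * l powr (a + 1 - s) * L2_norm g"
    using L2_bounded_mono[OF g m(2) AE_I2[OF b']] L2_norm_bounded_mono[OF g m(2) AE_I2[OF b']] by simp_all
  have fG: "f = weight (-a) G" "f = weight (-a - 1) G'"
    unfolding f G_def G'_def weight_weight by (simp_all add: algebra_simps)
  have A: "L2_norm (weight (-a - 1) U) \<le> C * (l powr (a - s) * L2_norm g)"
    using C by (intro order_trans[OF Hardy_resolvent_bound[OF sol a GL(1) fG(1), folded C_def] mult_left_mono[OF GL(2)]]) simp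
  have B: "L2_norm (weight (-a) U) \<le> C * (2 * l powr (a + 1 - s) * L2_norm g)"
    using C by (intro order_trans[OF dual_Hardy_resolvent_bound[OF sol z a GL'(1) fG(2), folded C_def] mult_left_mono[OF GL'(2)]]) simp
  have wL: "weight (-a - 1) U \<in> L2" "weight (-a) U \<in> L2" using a L2(1) by (auto intro!: weight_L2)
  define H where "H r = of_real (l powr (a - \<sigma>)) * complex_of_real (cmod (weight (-a) U r)) + of_real (l powr (a + 1 - \<sigma>)) * complex_of_real (cmod (weight (-a - 1) U r))" for r
  have nL: "(\<lambda>r. complex_of_real (cmod (weight (-a) U r))) \<in> L2" "(\<lambda>r. complex_of_real (cmod (weight (-a - 1) U r))) \<in> L2"
    using wL by (auto simp: L2_def)
  have nn: "L2_norm (\<lambda>r. complex_of_real (cmod (h r))) = L2_norm h" for h by (simp add: L2_norm_def)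
  have HL: "H \<in> L2" unfolding H_def by (intro L2_add L2_cmult nL)
  have "L2_norm (weight (-\<sigma>) U) \<le> 1 * L2_norm H"
  proof (rule L2_norm_bounded_mono[OF HL weight_measurable[OF L2_measurable[OF L2(1)]]])
    show "AE r in half_line. cmod (weight (-\<sigma>) U r) \<le> 1 * cmod (H r)"
      using AE_half_line_pos
    proof eventually_elim
      case (elim r)
      \<comment> \<open>Where 1 + r \<ge> l the weight \<sigma> is traded for a, elsewhere for a +
        1. Both trades are favourable because \<sigma> lies between a and a + 1, and they meet at
        the scale l of the source.\<close>
      have key: "(1 + r) powr (-\<sigma>) \<le> l powr (a - \<sigma>) * (1 + r) powr (-a) + l powr (a + 1 - \<sigma>) * (1 + r) powr (-a - 1)"
      proof (cases "l \<le> 1 + r")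
        case True
        have "(1 + r) powr (-\<sigma>) = (1 + r) powr (a - \<sigma>) * (1 + r) powr (-a)" by (simp flip: powr_add)
        also have "\<dots> \<le> l powr (a - \<sigma>) * (1 + r) powr (-a)" using True l \<sigma> by (intro mult_right_mono powr_mono2') auto
        finally show ?thesis by (simp add: add_increasing2)
      next
        case False
        have "(1 + r) powr (-\<sigma>) = (1 + r) powr (a + 1 - \<sigma>) * (1 + r) powr (-a - 1)" by (simp flip: powr_add)
        also have "\<dots> \<le> l powr (a + 1 - \<sigma>) * (1 + r) powr (-a - 1)" using False elim \<sigma> by (intro mult_right_mono powr_mono2) auto
        finally show ?thesis by (simp add: add_increasing)
      qed
      have "H r = complex_of_real ((l powr (a - \<sigma>) * (1 + r) powr (-a) + l powr (a + 1 - \<sigma>) * (1 + r) powr (-a - 1)) * cmod (U r))"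
        by (simp add: H_def cmod_weight[OF elim] algebra_simps)
      hence "cmod (H r) = (l powr (a - \<sigma>) * (1 + r) powr (-a) + l powr (a + 1 - \<sigma>) * (1 + r) powr (-a - 1)) * cmod (U r)"
        by (simp only: norm_of_real) (simp add: abs_mult)
      thus ?case using mult_right_mono[OF key, of "cmod (U r)"] by (simp add: cmod_weight[OF elim])
    qed
  qed simp
  also have "1 * L2_norm H \<le> l powr (a - \<sigma>) * L2_norm (weight (-a) U) + l powr (a + 1 - \<sigma>) * L2_norm (weight (-a - 1) U)"
    using L2_norm_triangle[OF L2_cmult[OF nL(1), of "of_real (l powr (a - \<sigma>))"] L2_cmult[OF nL(2), of "of_real (l powr (a + 1 - \<sigma>))"]]
    unfolding H_def L2_norm_cmult nn by simp
  also have "\<dots> \<le> l powr (a - \<sigma>) * (C * (2 * l powr (a + 1 - s) * L2_norm g)) + l powr (a + 1 - \<sigma>) * (C * (l powr (a - s) * L2_norm g))"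
    by (intro add_mono mult_left_mono A B) auto
  also have "\<dots> = 3 * C * l powr (2 * a + 1 - \<sigma> - s) * L2_norm g"
  proof -
    have "l powr (a - \<sigma>) * l powr (a + 1 - s) = l powr (2 * a + 1 - \<sigma> - s)" "l powr (a + 1 - \<sigma>) * l powr (a - s) = l powr (2 * a + 1 - \<sigma> - s)"
      by (simp_all add: algebra_simps flip: powr_add)
    thus ?thesis by (simp add: algebra_simps)
  qed
  finally show ?thesis unfolding C_def .
qed

text \<open>Induction over the shells of the source. The solution for one shell is subtracted, and
  linearity leaves a solution whose source is cut off one shell earlier.\<close>

lemma dyadic_resolvent_bound:
  assumes z: "z \<notin> \<real>\<^sub>\<ge>\<^sub>0" and a: "a > 1/2" and \<sigma>: "a \<le> \<sigma>" "\<sigma> \<le> a + 1" and s: "a \<le> s" and g: "g \<in> L2"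
    and sol: "radial_solution V \<delta> z U Y W (weight (-s) (\<lambda>r. if r \<in> {..<2 ^ n - 1} then g r else 0))"
  shows "L2_norm (weight (-\<sigma>) U) \<le> (\<Sum>k<n. 3 * weighted_const \<delta> a * (2 powr (2 * a + 1 - \<sigma> - s)) ^ k * L2_norm g)"
  using sol
proof (induction n arbitrary: U Y W)
  case 0
  interpret radial_solution V \<delta> z U Y W "weight (-s) (\<lambda>r. if r \<in> {..<2 ^ 0 - 1} then g r else 0)" by fact
  \<comment> \<open>The cut-off is at 0 here, so the source vanishes on the half line, and the
    numerical range bound makes U vanish in norm.\<close>
  have "L2_norm (weight (-s) (\<lambda>r. if r \<in> {..<2 ^ 0 - 1} then g r else 0)) = L2_norm (\<lambda>r. 0)"
    unfolding L2_norm_def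
    by (intro arg_cong[where f=sqrt] Bochner_Integration.integral_cong) (auto simp: weight_def mult_op_def)
  hence "\<kappa> * L2_norm U \<le> 0" using numerical_bounds(3) by (simp add: L2_norm_def)
  moreover have "0 < \<kappa>" unfolding \<kappa>_def by (rule numerical_range_pos[OF z])
  ultimately have "L2_norm U \<le> 0" by (simp add: mult_le_0_iff)
  moreover have "L2_norm (weight (-\<sigma>) U) \<le> L2_norm (weight 0 U)"
    using a \<sigma> by (intro weight_norm_mono weight_L2 L2 L2_measurable) auto
  moreover have "L2_norm (weight 0 U) = L2_norm U"
    unfolding L2_norm_def by (intro arg_cong[where f=sqrt] Bochner_Integration.integral_cong) (auto simp: cmod_weight)
  ultimately show ?case by simp
next
  case (Suc n)
  interpret radial_solution V \<delta> z U Y W "weight (-s) (\<lambda>r. if r \<in> {..<2 ^ Suc n - 1} then g r else 0)" by fact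
  \<comment> \<open>The shells are dyadic in 1 + r, so this one is 2^n \<le> 1 + r < 2^(n+1), with l
    = 2^n in the localized bound.\<close>
  define gn where "gn r = (if r \<in> {2 ^ n - 1..<2 ^ Suc n - 1} then g r else 0)" for r :: real
  have gn: "gn \<in> L2" "L2_norm gn \<le> L2_norm g" unfolding gn_def by (intro restrict_L2 g; simp)+
  obtain U' Y' W' where sol': "radial_solution V \<delta> z U' Y' W' (weight (-s) gn)"
    by (rule radial_solution_exists[OF z weight_L2[OF _ gn(1), of "-s"]]) (use s a in auto)
  interpret D: radial_solution V \<delta> z U' Y' W' "weight (-s) gn" by fact
  have p2: "r < 2 ^ Suc n - 1" if "r < 2 ^ n - 1" for r :: real
  proof -
    have "(2::real) ^ n \<le> 2 ^ Suc n" by simp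
    thus ?thesis using that by linarith
  qed
  have eqf: "(\<lambda>r. weight (-s) (\<lambda>r. if r \<in> {..<2 ^ Suc n - 1} then g r else 0) r - weight (-s) gn r)
      = weight (-s) (\<lambda>r. if r \<in> {..<2 ^ n - 1} then g r else 0)"
    unfolding weight_lin[symmetric]
    by (intro arg_cong[where f="weight (-s)"]) (auto simp: gn_def fun_eq_iff simp del: power_Suc dest: p2)
  have IH: "L2_norm (weight (-\<sigma>) (\<lambda>r. U r - U' r)) \<le> (\<Sum>k<n. 3 * weighted_const \<delta> a * (2 powr (2 * a + 1 - \<sigma> - s)) ^ k * L2_norm g)"
    by (rule Suc.IH) (use radial_solution_diff[OF Suc.prems sol'] eqf in simp)
  have "L2_norm (weight (-\<sigma>) U') \<le> 3 * weighted_const \<delta> a * (2 ^ n) powr (2 * a + 1 - \<sigma> - s) * L2_norm gn"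
    by (rule localized_resolvent_bound[OF sol' z a \<sigma> s gn(1) refl]) (auto simp: gn_def split: if_splits)
  also have "\<dots> \<le> 3 * weighted_const \<delta> a * (2 ^ n) powr (2 * a + 1 - \<sigma> - s) * L2_norm g"
    using weighted_const_pos[OF a] gn(2) by (intro mult_left_mono) auto
  also have "(2 ^ n) powr (2 * a + 1 - \<sigma> - s) = (2 powr (2 * a + 1 - \<sigma> - s)) ^ n"
    by (simp add: powr_powr mult.commute flip: powr_realpow)
  finally have piece: "L2_norm (weight (-\<sigma>) U') \<le> 3 * weighted_const \<delta> a * (2 powr (2 * a + 1 - \<sigma> - s)) ^ n * L2_norm g" .
  have "weight (-\<sigma>) U = (\<lambda>r. weight (-\<sigma>) (\<lambda>r. U r - U' r) r + weight (-\<sigma>) U' r)"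
    unfolding weight_lin by simp
  hence "L2_norm (weight (-\<sigma>) U) \<le> L2_norm (weight (-\<sigma>) (\<lambda>r. U r - U' r)) + L2_norm (weight (-\<sigma>) U')"
    using L2_norm_triangle[of "weight (-\<sigma>) (\<lambda>r. U r - U' r)" "weight (-\<sigma>) U'"] a \<sigma> L2(1) D.L2(1)
    by (simp add: weight_L2 L2_diff)
  thus ?case using IH piece by simp
qed

text \<open>The finitely many shells up to n contribute at most the full geometric series, uniformly
  in z. The tail of the source is handled by the crude bound 4 / \<kappa>, which degenerates near
  [0, \<infinity>) but multiplies a norm that tends to 0 with n, so it leaves no trace in the
  constant.\<close>

lemma two_weight_resolvent_bound_aux:
  assumes z: "z \<notin> \<real>\<^sub>\<ge>\<^sub>0" and a: "a > 1/2" and \<sigma>: "a \<le> \<sigma>" "\<sigma> \<le> a + 1" and s: "a \<le> s" and \<eta>: "\<sigma> + s = 2 * a + 1 + \<eta>" "\<eta> > 0"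
    and g: "g \<in> L2"
    and sol: "radial_solution V \<delta> z U Y W (weight (-s) g)"
  shows "L2_norm (weight (-\<sigma>) U) \<le> dyadic_const \<delta> a \<eta> * L2_norm g"
proof -
  interpret radial_solution V \<delta> z U Y W "weight (-s) g" by fact
  have \<kappa>: "0 < \<kappa>" unfolding \<kappa>_def by (rule numerical_range_pos[OF z])
  define x where "x = 2 powr (- \<eta>)"
  have x: "0 \<le> x" "x < 1" using \<eta>(2) by (auto simp: x_def powr_minus_divide)
  have xe: "2 powr (2 * a + 1 - \<sigma> - s) = x" unfolding x_def using \<eta>(1) by (intro arg_cong2[where f="(powr)"]) auto
  have le: "L2_norm (weight (-\<sigma>) U) \<le> dyadic_const \<delta> a \<eta> * L2_norm g + 4 / \<kappa> * L2_norm (\<lambda>r. if r \<in> {..<2 ^ n - 1} then 0 else g r)" for n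
  proof -
    let ?gn = "\<lambda>r::real. if r \<in> {..<2 ^ n - 1} then g r else 0"
    let ?hn = "\<lambda>r::real. if r \<in> {..<2 ^ n - 1} then 0 else g r"
    have gn: "?gn \<in> L2" by (rule restrict_L2[OF g]) simp
    have hn: "?hn \<in> L2" by (rule restrict_compl_L2[OF g]) simp
    obtain U' Y' W' where sol': "radial_solution V \<delta> z U' Y' W' (weight (-s) ?gn)"
      by (rule radial_solution_exists[OF z weight_L2[OF _ gn, of "-s"]]) (use s a in auto)
    interpret D: radial_solution V \<delta> z U' Y' W' "weight (-s) ?gn" by fact
    have "(\<lambda>r. weight (-s) g r - weight (-s) ?gn r) = weight (-s) ?hn"
      unfolding weight_lin[symmetric] by (intro arg_cong[where f="weight (-s)"]) (auto simp: fun_eq_iff)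
    hence sold: "radial_solution V \<delta> z (\<lambda>r. U r - U' r) (\<lambda>r. Y r - Y' r) (\<lambda>r. W r - W' r) (weight (-s) ?hn)"
      using radial_solution_diff[OF sol sol'] by simp
    interpret E: radial_solution V \<delta> z "\<lambda>r. U r - U' r" "\<lambda>r. Y r - Y' r" "\<lambda>r. W r - W' r" "weight (-s) ?hn" by (rule sold)
    have w0: "L2_norm (weight 0 h) = L2_norm h" for h
      unfolding L2_norm_def by (intro arg_cong[where f=sqrt] Bochner_Integration.integral_cong) (auto simp: cmod_weight)
    have "L2_norm (weight (-\<sigma>) (\<lambda>r. U r - U' r)) \<le> L2_norm (weight 0 (\<lambda>r. U r - U' r))"
      using a \<sigma> by (intro weight_norm_mono weight_L2 E.L2 L2_measurable) auto
    also have "\<dots> \<le> 4 / \<kappa> * L2_norm (weight (-s) ?hn)"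
      using E.numerical_bounds(3) \<kappa> unfolding w0 by (simp add: field_simps)
    also have "\<dots> \<le> 4 / \<kappa> * L2_norm (weight 0 ?hn)"
      using a s \<kappa> by (intro mult_left_mono weight_norm_mono weight_L2 hn L2_measurable) auto
    finally have e1: "L2_norm (weight (-\<sigma>) (\<lambda>r. U r - U' r)) \<le> 4 / \<kappa> * L2_norm ?hn" unfolding w0 .
    have "L2_norm (weight (-\<sigma>) U') \<le> (\<Sum>k<n. 3 * weighted_const \<delta> a * x ^ k * L2_norm g)"
      using dyadic_resolvent_bound[OF z a \<sigma> s g sol'] unfolding xe .
    also have "\<dots> = 3 * weighted_const \<delta> a * L2_norm g * (\<Sum>k<n. x ^ k)"
      by (simp add: sum_distrib_left mult_ac)
    also have "\<dots> \<le> 3 * weighted_const \<delta> a * L2_norm g * (1 / (1 - x))"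
    proof (rule mult_left_mono)
      show "(\<Sum>k<n. x ^ k) \<le> 1 / (1 - x)"
        using x sum_le_suminf[of "\<lambda>k. x ^ k" "{..<n}"] by (simp add: suminf_geometric summable_geometric)
    qed (use weighted_const_pos[OF a] in simp)
    finally have e2: "L2_norm (weight (-\<sigma>) U') \<le> dyadic_const \<delta> a \<eta> * L2_norm g"
      by (simp add: dyadic_const_def x_def mult_ac)
    have "weight (-\<sigma>) U = (\<lambda>r. weight (-\<sigma>) (\<lambda>r. U r - U' r) r + weight (-\<sigma>) U' r)"
      unfolding weight_lin by simp
    hence "L2_norm (weight (-\<sigma>) U) \<le> L2_norm (weight (-\<sigma>) (\<lambda>r. U r - U' r)) + L2_norm (weight (-\<sigma>) U')"
      using L2_norm_triangle[of "weight (-\<sigma>) (\<lambda>r. U r - U' r)" "weight (-\<sigma>) U'"] a \<sigma> L2(1) D.L2(1)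
      by (simp add: weight_L2 L2_diff)
    thus ?thesis using e1 e2 by linarith
  qed
  have "(\<lambda>n. dyadic_const \<delta> a \<eta> * L2_norm g + 4 / \<kappa> * L2_norm (\<lambda>r. if r \<in> {..<2 ^ n - 1} then 0 else g r)) \<longlonglongrightarrow> dyadic_const \<delta> a \<eta> * L2_norm g + 4 / \<kappa> * 0"
    by (intro tendsto_intros L2_tail_tendsto g)
  from tendsto_lowerbound[OF this always_eventually] le show ?thesis by simp
qed

end

text \<open>The constant depends only on \<open>\<delta>\<close> and the weights, so that it survives the rescaling by \<open>h\<close>.\<close>

lemma two_weight_resolvent_bound:
  assumes \<delta>: "\<delta> > 0" and s: "s1 > 1/2" "s2 > 1/2" "s1 + s2 > 2"
  obtains C where "C > 0"
    "\<And>V z U Y W g. radial_solution V \<delta> z U Y W (weight (-s2) g) \<Longrightarrow> z \<notin> \<real>\<^sub>\<ge>\<^sub>0 \<Longrightarrow> g \<in> L2 \<Longrightarrow>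
       L2_norm (weight (-s1) U) \<le> C * L2_norm g"
proof -
  \<comment> \<open>The parameter a = 1/2 + e must stay below s1 and s2, and 2 e < s1 + s2 - 2
    leaves a positive excess \<eta>. Interpolation reaches output weights only up to a + 1, hence
    the minimum in \<sigma>; if it is a + 1, then \<eta> = s2 - a > 0.\<close>
  define e where "e = min (s1 - 1/2) (min (s2 - 1/2) ((s1 + s2 - 2) / 2)) / 2"
  define a where "a = 1/2 + e"
  define \<sigma> where "\<sigma> = min s1 (a + 1)"
  define \<eta> where "\<eta> = \<sigma> + s2 - 2 * a - 1"
  have e: "0 < e" "e < s1 - 1/2" "e < s2 - 1/2" "2 * e < s1 + s2 - 2"
    using s by (auto simp: e_def min_def)
  have a: "a > 1/2" "a \<le> s2" "a \<le> \<sigma>" "\<sigma> \<le> a + 1" "\<sigma> \<le> s1" "\<eta> > 0" "\<sigma> + s2 = 2 * a + 1 + \<eta>"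
    using e by (auto simp: a_def \<sigma>_def \<eta>_def min_def)
  have x: "2 powr (-\<eta>) < (1::real)" using a by (simp add: powr_minus_divide)
  have C: "dyadic_const \<delta> a \<eta> > 0"
    unfolding dyadic_const_def weighted_const_def using \<delta> a x
    by (intro divide_pos_pos mult_pos_pos add_pos_nonneg) auto
  show ?thesis
  proof (rule that[OF C])
    fix V z U Y W g
    assume sol: "radial_solution V \<delta> z U Y W (weight (-s2) g)" and z: "z \<notin> \<real>\<^sub>\<ge>\<^sub>0" and g: "g \<in> L2"
    interpret radial_solution V \<delta> z U Y W "weight (-s2) g" by fact
    have "L2_norm (weight (-s1) U) \<le> L2_norm (weight (-\<sigma>) U)"
      using a by (intro weight_norm_mono weight_L2 L2 L2_measurable) auto
    also have "\<dots> \<le> dyadic_const \<delta> a \<eta> * L2_norm g"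
      by (rule two_weight_resolvent_bound_aux[OF z a(1) a(3,4) a(2) a(7,6) g sol])
    finally show "L2_norm (weight (-s1) U) \<le> dyadic_const \<delta> a \<eta> * L2_norm g" .
  qed
qed

section \<open>From solutions of the rescaled equation to operator norms of the resolvent\<close>

lemma L2_opnorm_le:
  assumes "0 \<le> K" "\<And>f. f \<in> L2 \<Longrightarrow> T f \<in> L2 \<and> L2_norm (T f) \<le> K * L2_norm f"
  shows "L2_opnorm T \<le> ennreal K"
  unfolding L2_opnorm_def by (rule Inf_lower) (use assms in auto)

context decreasing_potential
begin

lemma schroedinger_radial_solution:
  assumes h: "h > 0" and u: "u \<in> dirichlet_domain" and f: "f \<in> L2"
    and eq: "AE r in half_line. schroedinger V h u r - \<zeta> * u r = f r"
  obtains U Y W where "AE r in half_line. u r = U r" "u \<in> L2"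
    "radial_solution (\<lambda>r. V r / h\<^sup>2) \<delta> (\<zeta> / of_real (h\<^sup>2)) U Y W (\<lambda>r. f r / of_real (h\<^sup>2))"
proof -
  obtain U Y W where U: "AE r in half_line. u r = U r" "ac_deriv U Y" "ac_deriv Y W" "U \<in> L2" "Y \<in> L2" "W \<in> L2" "U 0 = 0"
      "AE r in half_line. weak_deriv (weak_deriv u) r = W r" "u \<in> L2" "weak_deriv (weak_deriv u) \<in> L2"
    by (rule dirichlet_domainE[OF u])
  interpret repulsive_potential "\<lambda>r. V r / h\<^sup>2" \<delta> by (rule repulsive_rescaled[OF h])
  have "radial_solution (\<lambda>r. V r / h\<^sup>2) \<delta> (\<zeta> / of_real (h\<^sup>2)) U Y W (\<lambda>r. f r / of_real (h\<^sup>2))"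
  proof unfold_locales
    show "AE r in half_line. W r = (complex_of_real (V r / h\<^sup>2) - \<zeta> / of_real (h\<^sup>2)) * U r - f r / of_real (h\<^sup>2)"
      using eq U(1) U(8)
    proof eventually_elim
      case (elim r)
      have "f r = - of_real (h\<^sup>2) * W r + of_real (V r) * U r - \<zeta> * U r"
        using elim by (simp add: schroedinger_def)
      moreover have "w = (v / k - \<zeta> / k) * x - y / k" if "y = - k * w + v * x - \<zeta> * x" "k \<noteq> 0" for w v x y k :: complex
        using that(2) unfolding that(1) by (simp add: field_simps)
      moreover have "complex_of_real (h\<^sup>2) \<noteq> 0" using h by simp
      ultimately show ?case unfolding of_real_divide by blast
    qed
    show "(\<lambda>r. f r / of_real (h\<^sup>2)) \<in> L2" using L2_cmult[OF f, of "1 / of_real (h\<^sup>2)"] by simp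
  qed (use U in auto)
  thus ?thesis using that U(1,9) by blast
qed

lemma rescaled_not_nonneg:
  fixes \<zeta> :: complex
  assumes "h > 0" "\<zeta> \<notin> \<real>\<^sub>\<ge>\<^sub>0" shows "\<zeta> / of_real (h\<^sup>2) \<notin> \<real>\<^sub>\<ge>\<^sub>0"
proof
  assume "\<zeta> / of_real (h\<^sup>2) \<in> \<real>\<^sub>\<ge>\<^sub>0"
  hence "(\<zeta> / of_real (h\<^sup>2)) * of_real (h\<^sup>2) \<in> \<real>\<^sub>\<ge>\<^sub>0" by (rule nonneg_Reals_mult_I) (simp del: of_real_power)
  moreover have "(\<zeta> / of_real (h\<^sup>2)) * of_real (h\<^sup>2) = \<zeta>" using assms(1) by simp
  ultimately show False using assms(2) by (simp only:)
qed

lemma schroedinger_equation_solvable: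
  assumes h: "h > 0" and \<zeta>: "\<zeta> \<notin> \<real>\<^sub>\<ge>\<^sub>0" and f: "f \<in> L2"
  shows "\<exists>u\<in>dirichlet_domain. AE r in half_line. schroedinger V h u r - \<zeta> * u r = f r"
proof -
  interpret S: repulsive_potential "\<lambda>r. V r / h\<^sup>2" \<delta> by (rule repulsive_rescaled[OF h])
  have fL: "(\<lambda>r. f r / of_real (h\<^sup>2)) \<in> L2" using L2_cmult[OF f, of "1 / of_real (h\<^sup>2)"] by simp
  obtain U Y W where sol: "radial_solution (\<lambda>r. V r / h\<^sup>2) \<delta> (\<zeta> / of_real (h\<^sup>2)) U Y W (\<lambda>r. f r / of_real (h\<^sup>2))"
    by (rule S.radial_solution_exists[OF rescaled_not_nonneg[OF h \<zeta>] fL])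
  interpret radial_solution "\<lambda>r. V r / h\<^sup>2" \<delta> "\<zeta> / of_real (h\<^sup>2)" U Y W "\<lambda>r. f r / of_real (h\<^sup>2)" by fact
  note D = dirichlet_domainI[OF ac L2(1-3) U0]
  have "AE r in half_line. schroedinger V h U r - \<zeta> * U r = f r"
    using eq D(2)
  proof eventually_elim
    case (elim r)
    show ?case unfolding schroedinger_def elim using h by (simp add: field_simps)
  qed
  with D(1) show ?thesis by blast
qed

text \<open>Solvability comes from Weyl's construction. The lower bound is the numerical range
  estimate for the rescaled equation, where the source carries the factor 1 / h^2; this explains the
  constant \<open>4 / (\<kappa> * h\<^sup>2)\<close>.\<close>

lemma schroedinger_resolvent_set:
  assumes h: "h > 0" and \<zeta>: "\<zeta> \<notin> \<real>\<^sub>\<ge>\<^sub>0"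
  shows "\<zeta> \<in> dirichlet_resolvent_set V h"
proof -
  define \<kappa> where "\<kappa> = \<bar>Im (\<zeta> / of_real (h\<^sup>2))\<bar> + cmod (\<zeta> / of_real (h\<^sup>2)) - Re (\<zeta> / of_real (h\<^sup>2))"
  have \<kappa>: "\<kappa> > 0" unfolding \<kappa>_def by (rule numerical_range_pos[OF rescaled_not_nonneg[OF h \<zeta>]])
  have "L2_norm u \<le> 4 / (\<kappa> * h\<^sup>2) * L2_norm (\<lambda>r. schroedinger V h u r - \<zeta> * u r)" if u: "u \<in> dirichlet_domain" for u
  proof -
    define f where "f = (\<lambda>r. schroedinger V h u r - \<zeta> * u r)"
    obtain u2: "u \<in> L2" "weak_deriv (weak_deriv u) \<in> L2" by (rule dirichlet_domainE[OF u]) blast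
    have "(\<lambda>r. - complex_of_real (h\<^sup>2) * weak_deriv (weak_deriv u) r + complex_of_real (V r) * u r - \<zeta> * u r) \<in> L2"
    proof (intro L2_diff L2_add L2_cmult u2)
      have "V \<in> borel_measurable half_line" by (rule antimono_borel_measurable_half_line[OF V_antimono])
      thus "(\<lambda>r. complex_of_real (V r) * u r) \<in> L2"
        by (intro L2_bounded_mult[OF u2(1), where B="V 0"]) (use V_le V_nonneg in auto)
    qed
    hence f: "f \<in> L2" by (simp add: f_def schroedinger_def)
    obtain U Y W where U: "AE r in half_line. u r = U r"
      and sol: "radial_solution (\<lambda>r. V r / h\<^sup>2) \<delta> (\<zeta> / of_real (h\<^sup>2)) U Y W (\<lambda>r. f r / of_real (h\<^sup>2))"
      by (rule schroedinger_radial_solution[OF h u f, of \<zeta>]) (auto simp: f_def)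
    interpret S: radial_solution "\<lambda>r. V r / h\<^sup>2" \<delta> "\<zeta> / of_real (h\<^sup>2)" U Y W "\<lambda>r. f r / of_real (h\<^sup>2)" by fact
    have "L2_norm u = L2_norm U" by (rule L2_norm_cong_AE[OF U S.L2(1) L2_measurable[OF u2(1)]])
    moreover have "L2_norm (\<lambda>r. f r / of_real (h\<^sup>2)) = L2_norm f / h\<^sup>2"
      using L2_norm_cmult[of "1 / of_real (h\<^sup>2)" f] by (simp add: norm_divide norm_power)
    ultimately have "\<kappa> * L2_norm u \<le> 4 * (L2_norm f / h\<^sup>2)"
      using S.numerical_bounds(3) unfolding S.\<kappa>_def \<kappa>_def by simp
    thus ?thesis using \<kappa> h unfolding f_def by (simp add: field_simps)
  qed
  thus ?thesis
    unfolding L2_resolvent_set_def using schroedinger_equation_solvable[OF h \<zeta>] by blast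
qed

lemma dirichlet_resolvent_radial_solution:
  assumes h: "h > 0" and \<zeta>: "\<zeta> \<notin> \<real>\<^sub>\<ge>\<^sub>0" and f: "f \<in> L2"
  obtains U Y W where "AE r in half_line. dirichlet_resolvent V h \<zeta> f r = U r" "dirichlet_resolvent V h \<zeta> f \<in> L2"
    "radial_solution (\<lambda>r. V r / h\<^sup>2) \<delta> (\<zeta> / of_real (h\<^sup>2)) U Y W (\<lambda>r. f r / of_real (h\<^sup>2))"
proof -
  have "dirichlet_resolvent V h \<zeta> f \<in> dirichlet_domain \<and>
     (AE r in half_line. schroedinger V h (dirichlet_resolvent V h \<zeta> f) r - \<zeta> * dirichlet_resolvent V h \<zeta> f r = f r)"
    using someI_ex[OF schroedinger_equation_solvable[OF h \<zeta> f, unfolded Bex_def]] unfolding L2_resolvent_def .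
  thus ?thesis using schroedinger_radial_solution[OF h _ f] that by blast
qed

text \<open>The reduction shared by the three estimates. The factor \<open>h\<^sup>2\<close> in the
  assumed bound compensates the 1 / h^2 that the source acquires when the equation is divided by
  h^2.\<close>

lemma weighted_resolvent_opnorm_le:
  assumes h: "h > 0" and \<zeta>: "\<zeta> \<notin> \<real>\<^sub>\<ge>\<^sub>0" and s: "0 \<le> s" and K: "0 \<le> K"
    and m: "m \<in> borel_measurable half_line" "\<And>r. 0 < r \<Longrightarrow> \<bar>m r\<bar> \<le> B"
    and est: "\<And>U Y W g. radial_solution (\<lambda>r. V r / h\<^sup>2) \<delta> (\<zeta> / of_real (h\<^sup>2)) U Y W (weight (-s) g) \<Longrightarrow> g \<in> L2 \<Longrightarrow>
      L2_norm (mult_op m U) \<le> K * h\<^sup>2 * L2_norm g"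
  shows "L2_opnorm (mult_op m \<circ> dirichlet_resolvent V h \<zeta> \<circ> mult_op (\<lambda>r. (1 + r) powr (-s))) \<le> ennreal K"
proof (rule L2_opnorm_le[OF K])
  fix g assume g: "g \<in> L2"
  define f where "f = weight (-s) g"
  have f: "f \<in> L2" unfolding f_def by (rule weight_L2) (use s g in auto)
  define u where "u = dirichlet_resolvent V h \<zeta> f"
  obtain U Y W where U: "AE r in half_line. u r = U r" "u \<in> L2"
    and sol: "radial_solution (\<lambda>r. V r / h\<^sup>2) \<delta> (\<zeta> / of_real (h\<^sup>2)) U Y W (\<lambda>r. f r / of_real (h\<^sup>2))"
    unfolding u_def by (rule dirichlet_resolvent_radial_solution[OF h \<zeta> f])
  interpret S: radial_solution "\<lambda>r. V r / h\<^sup>2" \<delta> "\<zeta> / of_real (h\<^sup>2)" U Y W "\<lambda>r. f r / of_real (h\<^sup>2)" by fact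
  define g' where "g' r = (1 / of_real (h\<^sup>2)) * g r" for r
  have g': "g' \<in> L2" unfolding g'_def by (rule L2_cmult[OF g])
  have ng': "L2_norm g' = L2_norm g / h\<^sup>2"
    unfolding g'_def L2_norm_cmult by (simp add: norm_divide norm_power)
  have "(\<lambda>r. f r / of_real (h\<^sup>2)) = weight (-s) g'"
    by (simp add: f_def g'_def weight_def mult_op_def fun_eq_iff)
  hence "L2_norm (mult_op m U) \<le> K * h\<^sup>2 * L2_norm g'" using est sol g' by simp
  also have "\<dots> = K * L2_norm g" using h by (simp add: ng')
  finally have n: "L2_norm (mult_op m U) \<le> K * L2_norm g" .
  have mc: "(\<lambda>r. complex_of_real (m r)) \<in> borel_measurable half_line" using m(1) by simp
  have L: "mult_op m v \<in> L2" if "v \<in> L2" for v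
    unfolding mult_op_def by (rule L2_bounded_mult[OF that mc]) (use m(2) in simp)
  have "L2_norm (mult_op m u) = L2_norm (mult_op m U)"
  proof (rule L2_norm_cong_AE)
    show "AE r in half_line. mult_op m u r = mult_op m U r"
      using U(1) by eventually_elim (simp add: mult_op_def)
  qed (intro L S.L2 L2_measurable U)+
  moreover have "(mult_op m \<circ> dirichlet_resolvent V h \<zeta> \<circ> mult_op (\<lambda>r. (1 + r) powr (-s))) g = mult_op m u"
    by (simp add: u_def f_def weight_def)
  ultimately show "(mult_op m \<circ> dirichlet_resolvent V h \<zeta> \<circ> mult_op (\<lambda>r. (1 + r) powr (-s))) g \<in> L2 \<and>
     L2_norm ((mult_op m \<circ> dirichlet_resolvent V h \<zeta> \<circ> mult_op (\<lambda>r. (1 + r) powr (-s))) g) \<le> K * L2_norm g"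
    using n L[OF U(2)] by simp
qed

end

theorem theorem1p2:
  fixes V :: "real \<Rightarrow> real" and \<delta> s s1 s2 :: real
  assumes "bounded (V ` {0..})"
    and "\<And>r. 0 \<le> r \<Longrightarrow> 0 \<le> V r"
    and "antimono_on {0..} V"
    and "\<delta> > 0"
    and "deriv_le_measure_sense V \<delta>"
    and "s > 1/2" and "s1 > 1/2" and "s2 > 1/2" and "s1 + s2 > 2"
  shows "\<exists>C>0. \<forall>\<zeta>::complex. \<zeta> \<notin> \<real>\<^sub>\<ge>\<^sub>0 \<longrightarrow> (\<forall>h>0.
     \<zeta> \<in> dirichlet_resolvent_set V h \<and>
     L2_opnorm (mult_op (\<lambda>r. (1 + r) powr (-s)) \<circ> dirichlet_resolvent V h \<zeta>
        \<circ> mult_op (\<lambda>r. (1 + r) powr (-s))) \<le> ennreal (C / (h * sqrt (cmod \<zeta>))) \<and>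
     L2_opnorm (mult_op (\<lambda>r. (1 + r) powr (-s1)) \<circ> dirichlet_resolvent V h \<zeta>
        \<circ> mult_op (\<lambda>r. (1 + r) powr (-s2))) \<le> ennreal (C / h\<^sup>2) \<and>
     L2_opnorm (mult_op (\<lambda>r. sqrt (V r) * (1 + r) powr (-1/2)) \<circ> dirichlet_resolvent V h \<zeta>
        \<circ> mult_op (\<lambda>r. (1 + r) powr (-s))) \<le> ennreal (C / h))"
proof -
  interpret decreasing_potential V \<delta> by unfold_locales (use assms in auto)
  obtain C2 where C2: "C2 > 0" "\<And>V z U Y W g. radial_solution V \<delta> z U Y W (weight (-s2) g) \<Longrightarrow> z \<notin> \<real>\<^sub>\<ge>\<^sub>0 \<Longrightarrow> g \<in> L2 \<Longrightarrow>
       L2_norm (weight (-s1) U) \<le> C2 * L2_norm g"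
    using two_weight_resolvent_bound[OF assms(4,7,8,9)] by blast
  define \<epsilon> where "\<epsilon> = 2 * s - 1"
  define M where "M = 2 + 2 * \<epsilon> / \<delta>"
  have \<epsilon>: "\<epsilon> > 0" and M: "M > 0" using assms(4,6) by (auto simp: \<epsilon>_def M_def add_pos_nonneg)
  define C1 where "C1 = 10 * M / \<epsilon>"
  \<comment> \<open>The square root of the bound on the V term in \<open>weighted_estimates\<close>
    after division by \<delta> / 2.\<close>
  define C3 where "C3 = sqrt (2 / \<delta> * (100 * M\<^sup>2 / \<epsilon>))"
  define C where "C = C1 + C2 + C3"
  have pos: "C1 > 0" "C3 > 0" using \<epsilon> M assms(4) by (auto simp: C1_def C3_def)
  have C: "C > 0" "C1 \<le> C" "C2 \<le> C" "C3 \<le> C" using pos C2(1) by (auto simp: C_def)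
  show ?thesis
  proof (intro exI[of _ C] conjI allI impI C(1))
    fix \<zeta> :: complex and h :: real
    assume \<zeta>: "\<zeta> \<notin> \<real>\<^sub>\<ge>\<^sub>0" and h: "h > 0"
    note z = rescaled_not_nonneg[OF h \<zeta>]
    have \<zeta>0: "cmod \<zeta> > 0" using \<zeta> by auto
    have wb: "\<bar>(1 + r) powr (-t)\<bar> \<le> 1" if "0 < r" "0 \<le> t" for r t :: real
      using that by (intro powr_weight_bound) auto
    show "\<zeta> \<in> dirichlet_resolvent_set V h" by (rule schroedinger_resolvent_set[OF h \<zeta>])
    show "L2_opnorm (mult_op (\<lambda>r. (1 + r) powr (-s)) \<circ> dirichlet_resolvent V h \<zeta>
        \<circ> mult_op (\<lambda>r. (1 + r) powr (-s))) \<le> ennreal (C / (h * sqrt (cmod \<zeta>)))"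
    proof (rule weighted_resolvent_opnorm_le[OF h \<zeta> _ _ powr_weight_measurable wb])
      fix U Y W g
      assume sol: "radial_solution (\<lambda>r. V r / h\<^sup>2) \<delta> (\<zeta> / of_real (h\<^sup>2)) U Y W (weight (-s) g)" and g: "g \<in> L2"
      \<comment> \<open>The rescaled spectral parameter contributes sqrt |\<zeta>| / h, and with the
        h^2 of the reduction this becomes 1 / (h sqrt |\<zeta>|).\<close>
      have "sqrt (cmod (\<zeta> / of_real (h\<^sup>2))) = sqrt (cmod \<zeta>) / h"
        using h by (simp add: norm_divide norm_power real_sqrt_divide)
      hence "sqrt (cmod \<zeta>) / h * L2_norm (weight (-s) U) \<le> C1 * L2_norm g"
        using radial_solution.weighted_estimates(2)[OF sol assms(6) g refl] by (simp add: C1_def M_def \<epsilon>_def)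
      also have "\<dots> \<le> C * L2_norm g" using C by (intro mult_right_mono) auto
      finally have "L2_norm (weight (-s) U) \<le> C * L2_norm g / (sqrt (cmod \<zeta>) / h)"
        using h \<zeta>0 by (subst pos_le_divide_eq) (auto simp: mult.commute)
      also have "\<dots> = C / (h * sqrt (cmod \<zeta>)) * h\<^sup>2 * L2_norm g"
        using h \<zeta>0 by (simp add: field_simps power2_eq_square)
      finally show "L2_norm (mult_op (\<lambda>r. (1 + r) powr (-s)) U) \<le> C / (h * sqrt (cmod \<zeta>)) * h\<^sup>2 * L2_norm g"
        unfolding weight_def .
    qed (use assms(6) C(1) h in auto)
    show "L2_opnorm (mult_op (\<lambda>r. (1 + r) powr (-s1)) \<circ> dirichlet_resolvent V h \<zeta>
        \<circ> mult_op (\<lambda>r. (1 + r) powr (-s2))) \<le> ennreal (C / h\<^sup>2)"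
    proof (rule weighted_resolvent_opnorm_le[OF h \<zeta> _ _ powr_weight_measurable wb])
      fix U Y W g
      assume sol: "radial_solution (\<lambda>r. V r / h\<^sup>2) \<delta> (\<zeta> / of_real (h\<^sup>2)) U Y W (weight (-s2) g)" and g: "g \<in> L2"
      have "L2_norm (weight (-s1) U) \<le> C2 * L2_norm g" by (rule C2(2)[OF sol z g])
      also have "\<dots> \<le> C * L2_norm g" using C by (intro mult_right_mono) auto
      finally show "L2_norm (mult_op (\<lambda>r. (1 + r) powr (-s1)) U) \<le> C / h\<^sup>2 * h\<^sup>2 * L2_norm g"
        using h unfolding weight_def by simp
    qed (use assms(7,8) C(1) h in auto)
    have Vm: "V \<in> borel_measurable half_line" by (rule antimono_borel_measurable_half_line[OF V_antimono])
    show "L2_opnorm (mult_op (\<lambda>r. sqrt (V r) * (1 + r) powr (-1/2)) \<circ> dirichlet_resolvent V h \<zeta>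
        \<circ> mult_op (\<lambda>r. (1 + r) powr (-s))) \<le> ennreal (C / h)"
    proof (rule weighted_resolvent_opnorm_le[OF h \<zeta>])
      show "(\<lambda>r. sqrt (V r) * (1 + r) powr (-1/2)) \<in> borel_measurable half_line"
        using Vm powr_weight_measurable[of "-1/2"] by (intro borel_measurable_times borel_measurable_continuous_on[of sqrt] continuous_intros)
      show "\<bar>sqrt (V r) * (1 + r) powr (-1/2)\<bar> \<le> sqrt (V 0) * 1" if "0 < r" for r
        unfolding abs_mult using that V_le[of 0 r] V_nonneg[of r] V_nonneg[of 0] wb[of r "1/2"]
        by (intro mult_mono) auto
      fix U Y W g
      assume sol: "radial_solution (\<lambda>r. V r / h\<^sup>2) \<delta> (\<zeta> / of_real (h\<^sup>2)) U Y W (weight (-s) g)" and g: "g \<in> L2"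
      \<comment> \<open>The norm contains V while the estimate bounds the integral with V / h^2. The
        factor h^2 becomes h after the square root and turns the scale 1 / h^2 into 1 / h.\<close>
      have sq: "(cmod (mult_op (\<lambda>r. sqrt (V r) * (1 + r) powr (-1/2)) U r))\<^sup>2 = h\<^sup>2 * (V r / h\<^sup>2 * (cmod (U r))\<^sup>2 / (1 + r))" if "0 < r" for r
      proof -
        have "((1 + r) powr (-1/2))\<^sup>2 = 1 / (1 + r)"
          using that by (simp add: power2_eq_square powr_minus_divide flip: powr_add)
        thus ?thesis using that h V_nonneg[of r]
          by (simp add: mult_op_def norm_mult power_mult_distrib)
      qed
      have "(L2_norm (mult_op (\<lambda>r. sqrt (V r) * (1 + r) powr (-1/2)) U))\<^sup>2 = h\<^sup>2 * (LINT r|half_line. V r / h\<^sup>2 * (cmod (U r))\<^sup>2 / (1 + r))"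
        unfolding L2_norm_sq integral_mult_right_zero[symmetric]
        by (rule Bochner_Integration.integral_cong) (use sq in auto)
      also have "\<dots> \<le> h\<^sup>2 * (C3 * L2_norm g)\<^sup>2"
      proof (rule mult_left_mono)
        have "(C3 * L2_norm g)\<^sup>2 = 2 / \<delta> * (100 * M\<^sup>2 / \<epsilon> * (L2_norm g)\<^sup>2)"
          using \<epsilon> M assms(4) by (simp add: C3_def power_mult_distrib)
        moreover have "\<delta> / 2 * (LINT r|half_line. V r / h\<^sup>2 * (cmod (U r))\<^sup>2 / (1 + r)) \<le> 100 * M\<^sup>2 / \<epsilon> * (L2_norm g)\<^sup>2"
          using radial_solution.weighted_estimates(3)[OF sol assms(6) g refl] unfolding M_def \<epsilon>_def .
        hence "2 / \<delta> * (\<delta> / 2 * (LINT r|half_line. V r / h\<^sup>2 * (cmod (U r))\<^sup>2 / (1 + r))) \<le> 2 / \<delta> * (100 * M\<^sup>2 / \<epsilon> * (L2_norm g)\<^sup>2)"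
          using assms(4) by (intro mult_left_mono) auto
        moreover have "2 / \<delta> * (\<delta> / 2 * x) = x" for x using assms(4) by simp
        ultimately show "(LINT r|half_line. V r / h\<^sup>2 * (cmod (U r))\<^sup>2 / (1 + r)) \<le> (C3 * L2_norm g)\<^sup>2"
          by metis
      qed simp
      also have "\<dots> = (h * C3 * L2_norm g)\<^sup>2" by (simp add: power_mult_distrib)
      finally have "L2_norm (mult_op (\<lambda>r. sqrt (V r) * (1 + r) powr (-1/2)) U) \<le> h * C3 * L2_norm g"
        by (rule power2_le_imp_le) (use h pos in auto)
      also have "\<dots> \<le> h * C * L2_norm g" using C h by (intro mult_right_mono mult_left_mono) auto
      also have "\<dots> = C / h * h\<^sup>2 * L2_norm g" using h by (simp add: power2_eq_square)
      finally show "L2_norm (mult_op (\<lambda>r. sqrt (V r) * (1 + r) powr (-1/2)) U) \<le> C / h * h\<^sup>2 * L2_norm g" .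
    qed (use assms(6) C(1) h in auto)
  qed
qed

end
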